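(* For every $n\ge1$, the generating function $\sum_A\mathrm{W}(A)$ of arrowed monotone triangles with bottom row $(1,2,\dots,n)$ equals the generating function $\sum_D\mathrm{W}(D)$ of set-valued near-balanced column strict plane partitions of order $n$ (as polynomials/Laurent polynomials in $u,v,w,X_1,\dots,X_n$).
   Context: A monotone triangle with $n$ rows is a triangular array of integers $(m_{i,j})_{1\le j\le i\le n}$ with $m_{i+1,j}\le m_{i,j}\le m_{i+1,j+1}$ and $m_{i,j}<m_{i,j+1}$; row $n$ is the bottom row. The northwest-neighbour of $m_{i,j}$ is $m_{i-1,j-1}$, its northeast-neighbour $m_{i-1,j}$. An arrowed monotone triangle is a monotone triangle in which every entry carries a decoration from $\{\nwarrow,\nearrow,\nwarrow\!\nearrow\}$ such that: if an entry equals its northwest-neighbour then it carries $\nearrow$; if it equals its northeast-neighbour then it carries $\nwarrow$. Its weight is $\mathrm{W}(A)=u^{\#\nearrow}v^{\#\nwarrow}w^{\#\nwarrow\nearrow}\prod_{i=1}^n X_i^{(\text{sum of row } i)-(\text{sum of row } i-1)+(\#\nearrow\text{ in row } i)-(\#\nwarrow\text{ in row } i)}$ (counts are of entries with exactly that decoration; sum of row $0$ is $0$). A partition $\lambda=(a_1,\dots,a_l\mid b_1,\dots,b_l)$ in Frobenius notation is near-balanced if $a_i\in\{b_i,b_i+1\}$ for all $i$; $\mathrm{W}(\lambda)=w^{l+\sum_i(b_i-a_i)}$. An SBCSPP of order $n$ and near-balanced shape $\lambda$ is a filling of the cells of $\lambda$ with nonempty subsets of $\{1,\dots,n\}$, singletons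 strictly above the main diagonal, maxima weakly decreasing along rows, and for vertically adjacent cells all elements of the upper cell strictly larger than all elements of the lower cell. Its weight is $\mathrm{W}(D)=\mathrm{W}(\lambda)\,u^{\#\text{cells strictly above diagonal}}\,v^{\binom{n+1}{2}-\#\text{entries in cells on or below diagonal}}\,w^{\#\text{entries}-\#\text{cells}}\prod_iX_i^{\#\,i\text{'s in }D}$, where entries are the integers in the sets. *)

theory Defs
  imports Main
begin

datatype arrow = NW | NE | NWNE

text \<open>A triangle is a function m :: nat => nat => int, where m i j is the entry in
row i, position j (1 <= j <= i <= n); row n is the bottom row. Outside the
triangle the array is normalised to 0 (and decorations to NWNE), so that the set
of objects is finite.\<close>

definition in_tri :: "nat \<Rightarrow> nat \<Rightarrow> nat \<Rightarrow> bool" where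
  "in_tri n i j \<longleftrightarrow> 1 \<le> j \<and> j \<le> i \<and> i \<le> n"

definition monotone_triangle :: "nat \<Rightarrow> (nat \<Rightarrow> nat \<Rightarrow> int) \<Rightarrow> bool" where
  "monotone_triangle n m \<longleftrightarrow>
     (\<forall>i j. \<not> in_tri n i j \<longrightarrow> m i j = 0) \<and>
     (\<forall>i j. 1 \<le> j \<and> j \<le> i \<and> i < n \<longrightarrow> m (i+1) j \<le> m i j \<and> m i j \<le> m (i+1) (j+1)) \<and>
     (\<forall>i j. 1 \<le> j \<and> j < i \<and> i \<le> n \<longrightarrow> m i j < m i (j+1))"

definition arrowed_monotone_triangle ::
  "nat \<Rightarrow> (nat \<Rightarrow> nat \<Rightarrow> int) \<Rightarrow> (nat \<Rightarrow> nat \<Rightarrow> arrow) \<Rightarrow> bool" where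
  "arrowed_monotone_triangle n m d \<longleftrightarrow>
     monotone_triangle n m \<and>
     (\<forall>i j. \<not> in_tri n i j \<longrightarrow> d i j = NWNE) \<and>
     \<comment> \<open>equal to northwest neighbour m (i-1) (j-1) implies nearrow\<close>
     (\<forall>i j. in_tri n i j \<and> 2 \<le> j \<and> m i j = m (i-1) (j-1) \<longrightarrow> d i j = NE) \<and>
     \<comment> \<open>equal to northeast neighbour m (i-1) j implies nwarrow\<close>
     (\<forall>i j. in_tri n i j \<and> j < i \<and> m i j = m (i-1) j \<longrightarrow> d i j = NW)"

definition AMT :: "nat \<Rightarrow> ((nat \<Rightarrow> nat \<Rightarrow> int) \<times> (nat \<Rightarrow> nat \<Rightarrow> arrow)) set" where
  "AMT n = {(m, d). arrowed_monotone_triangle n m d \<and> (\<forall>j\<in>{1..n}. m n j = int j)}"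

definition row_count :: "nat \<Rightarrow> (nat \<Rightarrow> nat \<Rightarrow> arrow) \<Rightarrow> arrow \<Rightarrow> nat \<Rightarrow> nat" where
  "row_count n d a i = card {j \<in> {1..i}. d i j = a}"

definition total_count :: "nat \<Rightarrow> (nat \<Rightarrow> nat \<Rightarrow> arrow) \<Rightarrow> arrow \<Rightarrow> nat" where
  "total_count n d a = (\<Sum>i=1..n. row_count n d a i)"

definition row_sum :: "(nat \<Rightarrow> nat \<Rightarrow> int) \<Rightarrow> nat \<Rightarrow> int" where
  "row_sum m i = (\<Sum>j=1..i. m i j)"

definition weight_AMT :: "nat \<Rightarrow> 'a::field \<Rightarrow> 'a \<Rightarrow> 'a \<Rightarrow> (nat \<Rightarrow> 'a)
    \<Rightarrow> (nat \<Rightarrow> nat \<Rightarrow> int) \<Rightarrow> (nat \<Rightarrow> nat \<Rightarrow> arrow) \<Rightarrow> 'a" where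
  "weight_AMT n u v w X m d =
     u ^ total_count n d NE * v ^ total_count n d NW * w ^ total_count n d NWNE *
     (\<Prod>i=1..n. X i powi (row_sum m i - row_sum m (i-1)
                          + int (row_count n d NE i) - int (row_count n d NW i)))"

text \<open>A partition in Frobenius notation (a_1,...,a_l | b_1,...,b_l) is given by two
lists a, b of equal length l, each strictly decreasing (entries are nats, so >= 0).
Cells (r,c) use English notation: r = row (top row 1), c = column (left column 1).
Row i (i <= l) contains cells (i,c) for i <= c <= i + a_i, column i contains cells
(r,i) for i <= r <= i + b_i.\<close>

definition frobenius :: "nat list \<Rightarrow> nat list \<Rightarrow> bool" where
  "frobenius a b \<longleftrightarrow> length a = length b \<and> sorted_wrt (>) a \<and> sorted_wrt (>) b"

definition near_balanced :: "nat list \<Rightarrow> nat list \<Rightarrow> bool" where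
  "near_balanced a b \<longleftrightarrow> frobenius a b \<and>
     (\<forall>i < length a. a ! i = b ! i \<or> a ! i = b ! i + 1)"

definition cells :: "nat list \<Rightarrow> nat list \<Rightarrow> (nat \<times> nat) set" where
  "cells a b = {(r, c). \<exists>i \<in> {1..length a}.
       (r = i \<and> i \<le> c \<and> c \<le> i + a ! (i-1)) \<or> (c = i \<and> i \<le> r \<and> r \<le> i + b ! (i-1))}"

definition weight_shape :: "'a::field \<Rightarrow> nat list \<Rightarrow> nat list \<Rightarrow> 'a" where
  "weight_shape w a b =
     w powi (int (length a) + (\<Sum>i<length a. int (b ! i) - int (a ! i)))"

definition SBCSPP_filling :: "nat \<Rightarrow> nat list \<Rightarrow> nat list \<Rightarrow> (nat \<times> nat \<Rightarrow> nat set) \<Rightarrow> bool" where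
  "SBCSPP_filling n a b F \<longleftrightarrow>
     (\<forall>x. x \<notin> cells a b \<longrightarrow> F x = {}) \<and>
     (\<forall>x \<in> cells a b. F x \<noteq> {} \<and> F x \<subseteq> {1..n}) \<and>
     (\<forall>r c. (r, c) \<in> cells a b \<and> r < c \<longrightarrow> card (F (r, c)) = 1) \<and>
     (\<forall>r c. (r, c) \<in> cells a b \<and> (r, c+1) \<in> cells a b \<longrightarrow> Max (F (r, c+1)) \<le> Max (F (r, c))) \<and>
     (\<forall>r c. (r, c) \<in> cells a b \<and> (r+1, c) \<in> cells a b \<longrightarrow>
        (\<forall>x \<in> F (r, c). \<forall>y \<in> F (r+1, c). y < x))"

definition SBCSPP :: "nat \<Rightarrow> (nat list \<times> nat list \<times> (nat \<times> nat \<Rightarrow> nat set)) set" where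
  "SBCSPP n = {(a, b, F). near_balanced a b \<and> SBCSPP_filling n a b F}"

definition weight_SBCSPP :: "nat \<Rightarrow> 'a::field \<Rightarrow> 'a \<Rightarrow> 'a \<Rightarrow> (nat \<Rightarrow> 'a)
    \<Rightarrow> nat list \<Rightarrow> nat list \<Rightarrow> (nat \<times> nat \<Rightarrow> nat set) \<Rightarrow> 'a" where
  "weight_SBCSPP n u v w X a b F =
     weight_shape w a b *
     u ^ card {(r, c) \<in> cells a b. r < c} *
     v powi (int ((n+1) choose 2) - int (\<Sum>x \<in> {(r, c) \<in> cells a b. c \<le> r}. card (F x))) *
     w powi (int (\<Sum>x \<in> cells a b. card (F x)) - int (card (cells a b))) *
     (\<Prod>i=1..n. X i ^ card {x \<in> cells a b. i \<in> F x})"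

end

theory Submission
  imports Defs "Jordan_Normal_Form.Determinant"
begin

text \<open>
  Put \<open>p(x) = u x + v/x + w\<close>, \<open>z(x) = -(w + v/x)\<close> and \<open>f(x, y) = v + w x + u x y = x (u y - z(x))\<close>,
  and let the \<open>X\<^sub>i\<close> first be distinct elements of a field.

  Summing over one row at a time shows by induction that the arrowed monotone triangles with bottom
  row \<open>k\<close> have generating function \<open>\<Sum>\<^sub>\<sigma> \<sigma>(\<Prod>\<^sub>i p(X\<^sub>i) X\<^sub>i^k\<^sub>i \<Prod>\<^bsub>i<j\<^esub> f(X\<^sub>i, X\<^sub>j) / (X\<^sub>j - X\<^sub>i))\<close>:
  with a row fixed, the entries of the row above vary in independent intervals, and in the resulting
  geometric sums all terms but those inserting the new variable into a permutation cancel in pairs.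
  For \<open>k = (1, \<dots>, n)\<close> the factorization of \<open>f\<close> turns this sum into \<open>\<Prod>\<^sub>i p(X\<^sub>i) X\<^sub>i^n\<close> times the quotient
  of \<open>det(h\<^sub>i(u X\<^sub>j, z(X\<^sub>j)))\<close> by the Vandermonde determinant of the \<open>X\<^sub>j\<close>, where \<open>h\<^sub>i\<close> is the
  complete homogeneous polynomial.

  On the other side, removing the smallest value from a set-valued filling removes a horizontal strip.
  In Frobenius coordinates arms and legs then move independently up to terms with vanishing
  determinant, which gives a Giambelli formula: the fillings of \<open>(a | b)\<close> have generating function
  \<open>det(K(a\<^sub>i, b\<^sub>j))\<close>. Summed over the near-balanced shapes this is a sum of principal minors, hence
  \<open>det(I + M)\<close> with \<open>M(i, j) = w K(i, j) + K(i + 1, j)\<close>. Since \<open>\<Sum>\<^sub>b K(a, b) z(X\<^sub>j)^b = (u X\<^sub>j)^a X\<^sub>j / v\<close>,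
  multiplying by the matrix \<open>(z(X\<^sub>j)^i)\<close> identifies it with the same determinant in the \<open>h\<^sub>i\<close>.

  Arbitrary \<open>X\<^sub>i\<close> are reached by applying this to \<open>X\<^sub>i + t^i\<close> over the field of rational functions in \<open>t\<close>
  and setting \<open>t = 0\<close>.
\<close>

section \<open>Symmetrized sums and monotone triangles\<close>

text \<open>The two sides meet because \<open>z(x)\<close> arises twice: in the triangles from
  factoring \<open>f\<close>, and in the fillings as a zero. If leg lengths are marked by powers of
  \<open>\<beta>\<close>, the effect of a variable \<open>x\<close> on a leg is the factor
  \<open>1 + w x / v + x \<beta> / v\<close>, which vanishes at \<open>\<beta> = z(x)\<close>. The
  two arms allowed over each leg, weighted \<open>w\<close> and \<open>1\<close>, contribute
  \<open>(x / v) (w + u x) (u x)^i\<close> to the product with the powers of \<open>z\<close>. As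
  \<open>(x / v) (w + z) = -1\<close>, the identity matrix contributes
  \<open>- (x / v) (w + z) z^i\<close>. Apart from \<open>x / v\<close>, the sum changes sign when
  \<open>u x\<close> and \<open>z\<close> are exchanged, hence it is divisible by
  \<open>p(x) = u x - z(x)\<close>; this is the source of the \<open>h_i\<close>. Two obstacles
  remain. The symmetrized sum is not an alternant as it stands, because the factor of its last
  variable depends on all the others; a difference quotient of the polynomial with zeros
  \<open>z(X_i)\<close> removes this dependence up to row operations. And the denominators
  \<open>X_j - X_i\<close> force distinct variables although neither generating function contains
  them; distinctness is removed by specialization, for which both sums must be written without
  negative powers of the variables.\<close>

lemma sum_double_antisym:
  fixes h :: "'b \<Rightarrow> 'b \<Rightarrow> 'a::ab_group_add"
  assumes "finite A" and "\<And>a b. a \<in> A \<Longrightarrow> b \<in> A \<Longrightarrow> a \<noteq> b \<Longrightarrow> h b a = - h a b"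
  shows "(\<Sum>a\<in>A. \<Sum>b\<in>A - {a}. h a b) = 0"
  using assms
\<comment> \<open>Comparing the sum with its negative gives only \<open>2 S = 0\<close>, which says
  nothing in characteristic 2. The induction cancels the pairs containing the new element against
  each other.\<close>
proof (induction A rule: finite_induct)
  case (insert z A)
  have "(\<Sum>a\<in>insert z A. \<Sum>b\<in>insert z A - {a}. h a b)
      = (\<Sum>b\<in>A. h z b) + (\<Sum>a\<in>A. \<Sum>b\<in>insert z (A - {a}). h a b)"
    using insert.hyps by (auto simp: insert_Diff_if intro!: sum.cong arg_cong2[where f="(+)"])
  also have "(\<Sum>a\<in>A. \<Sum>b\<in>insert z (A - {a}). h a b) = (\<Sum>a\<in>A. h a z + (\<Sum>b\<in>A - {a}. h a b))"
    using insert.hyps by (intro sum.cong) auto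
  also have "\<dots> = (\<Sum>a\<in>A. h a z) + (\<Sum>a\<in>A. \<Sum>b\<in>A - {a}. h a b)"
    by (simp add: sum.distrib)
  also have "(\<Sum>a\<in>A. \<Sum>b\<in>A - {a}. h a b) = 0"
    by (rule insert.IH) (use insert.prems in blast)
  also have "(\<Sum>a\<in>A. h a z) = (\<Sum>a\<in>A. - h z a)"
    by (intro sum.cong refl insert.prems) (use insert.hyps in auto)
  finally show ?case by (simp add: sum_negf)
qed simp

text \<open>The case \<open>lo = hi + 1\<close> is included because an entry with a northeast
  component that equals the bound \<open>hi\<close> leaves no room above it; both sides are then
  \<open>0\<close>.\<close>

lemma sum_powi_interval:
  fixes r :: "'a::field"
  assumes "r \<noteq> 0" "r \<noteq> 1" "lo \<le> hi + 1"
  shows "(\<Sum>l\<in>{lo..hi}. r powi l) = (r powi (hi + 1) - r powi lo) / (r - 1)"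
proof -
  have "lo \<le> hi + 1 \<Longrightarrow> (\<Sum>l\<in>{lo..hi}. r powi l) = (r powi (hi + 1) - r powi lo) / (r - 1)"
  proof (induction "hi + 1" arbitrary: hi rule: int_ge_induct)
    case base then show ?case by simp
  next
    case (step i)
    have i: "i = hi" "i = (hi - 1) + 1" using step by simp_all
    have eq: "{lo..hi} = insert hi {lo..hi - 1}" using step i by auto
    have IH: "(\<Sum>l\<in>{lo..hi - 1}. r powi l) = (r powi hi - r powi lo) / (r - 1)"
      using step(2)[OF i(2)] by simp
    have "(\<Sum>l\<in>{lo..hi}. r powi l) = r powi hi + (r powi hi - r powi lo) / (r - 1)"
      unfolding eq using IH by simp
    also have "\<dots> = (r powi (hi + 1) - r powi lo) / (r - 1)"
      using assms(1,2) by (simp add: power_int_add field_simps)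
    finally show ?case .
  qed
  then show ?thesis using assms(3) .
qed

lemma sum_arrow: "(\<Sum>d\<in>UNIV. f d) = f NE + f NW + f NWNE" for f :: "arrow \<Rightarrow> 'a::comm_monoid_add"
proof -
  have U: "(UNIV :: arrow set) = {NE, NW, NWNE}" using arrow.exhaust by auto
  show ?thesis by (simp add: U add.assoc)
qed

lemma finite_UNIV_arrow: "finite (UNIV :: arrow set)"
proof -
  have "(UNIV :: arrow set) = {NE, NW, NWNE}" using arrow.exhaust by auto
  then show ?thesis by (metis finite.emptyI finite_insert)
qed

text \<open>Indicators of the two components of a decoration. The arrow rules say exactly that a
  component makes the inequality towards the neighbour in its direction strict, so they become a
  shift by one.\<close>

definition nw_part :: "arrow \<Rightarrow> int" where "nw_part d = (if d = NE then 0 else 1)"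
definition ne_part :: "arrow \<Rightarrow> int" where "ne_part d = (if d = NW then 0 else 1)"

section \<open>Branching of the symmetrized sum in one new variable\<close>

locale arrow_params =
  fixes u v w :: "'a::field"
begin

definition arrow_weight :: "'a \<Rightarrow> arrow \<Rightarrow> 'a" where
  "arrow_weight x d = (case d of NE \<Rightarrow> u * x | NW \<Rightarrow> v / x | NWNE \<Rightarrow> w)"

definition diag_factor :: "'a \<Rightarrow> 'a" where "diag_factor x = u * x + v / x + w"

text \<open>The order of the arguments matters: \<open>b\<close> stands in an earlier position than
  \<open>a\<close>.\<close>

definition pair_factor :: "'a \<Rightarrow> 'a \<Rightarrow> 'a" where "pair_factor b a = (v + w * b + u * b * a) / (a - b)"

definition head_factor :: "'a \<Rightarrow> 'a set \<Rightarrow> 'a" where "head_factor a A = diag_factor a * (\<Prod>b\<in>A - {a}. pair_factor b a)"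

text \<open>The sum over all orderings of \<open>A\<close>, expanded along the variable in the last position. Writing the
  denominators \<open>a - b\<close> into the summands replaces the signs of an antisymmetrizer.\<close>

fun sym_sum :: "nat \<Rightarrow> 'a set \<Rightarrow> (nat \<Rightarrow> int) \<Rightarrow> 'a" where
  "sym_sum 0 A k = 1"
| "sym_sum (Suc n) A k = (\<Sum>a\<in>A. head_factor a A * a powi k (Suc n) * sym_sum n (A - {a}) k)"

lemma sym_sum_cong: "(\<And>i. i \<in> {1..n} \<Longrightarrow> k i = k' i) \<Longrightarrow> sym_sum n A k = sym_sum n A k'"
  by (induction n arbitrary: A) (auto intro!: sum.cong)

text \<open>The branching of a row in the new variable \<open>x\<close> is summed from the right. In \<open>row_branch\<close>, the
  entry above and to the right of the current one is bounded by \<open>hi\<close>; in \<open>branch\<close> and \<open>branch_used\<close>,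
  the geometric sum over that entry has been evaluated, and the second one is the part coming
  from its lower end, whose power of \<open>y\<close> depends on the decoration of the current entry.\<close>

fun row_branch :: "'a \<Rightarrow> nat \<Rightarrow> 'a set \<Rightarrow> (nat \<Rightarrow> int) \<Rightarrow> int \<Rightarrow> 'a" where
  "row_branch x 0 A k hi = 1"
| "row_branch x (Suc n) A k hi = (\<Sum>d\<in>UNIV. arrow_weight x d * (\<Sum>l\<in>{k (Suc n) + ne_part d..hi}. x powi (k (Suc n) - l) *
     (\<Sum>a\<in>A. head_factor a A * a powi l * row_branch x n (A - {a}) k (k (Suc n) - nw_part d))))"

definition branch :: "'a \<Rightarrow> nat \<Rightarrow> 'a set \<Rightarrow> (nat \<Rightarrow> int) \<Rightarrow> 'a" where
  "branch x n A k = (\<Sum>d\<in>UNIV. arrow_weight x d * x powi k (Suc n) * row_branch x n A k (k (Suc n) - nw_part d))"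

definition branch_used :: "'a \<Rightarrow> nat \<Rightarrow> 'a set \<Rightarrow> (nat \<Rightarrow> int) \<Rightarrow> 'a \<Rightarrow> 'a" where
  "branch_used x n A k y = (\<Sum>d\<in>UNIV. arrow_weight x d * x powi k (Suc n) * (y / x) powi (k (Suc n) + ne_part d)
     * row_branch x n A k (k (Suc n) - nw_part d))"

definition geo_factor :: "'a \<Rightarrow> 'a \<Rightarrow> 'a set \<Rightarrow> 'a" where "geo_factor x a A = head_factor a A / (a / x - 1)"

context
  fixes x :: 'a
  assumes x0: "x \<noteq> 0"
begin

lemma geo_factor_eq: "geo_factor x a A = head_factor a A * x / (a - x)"
proof -
  have "a / x - 1 = (a - x) / x" using x0 by (simp add: field_simps)
  then show ?thesis by (simp add: geo_factor_def)
qed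

lemma pair_factor_swap: "pair_factor a b = - ((v + w * a + u * a * b) / (a - b))"
  by (simp add: pair_factor_def) (metis minus_diff_eq minus_divide_right)

text \<open>The upper end of the geometric sum does not involve the decoration and factors out,
  leaving \<open>branch\<close>. The lower end shifts with \<open>ne_part\<close> and stays inside
  the sum over decorations.\<close>

lemma row_branch_Suc:
  assumes A: "x \<notin> A" "0 \<notin> A" and hi: "k (Suc n) \<le> hi"
  shows "row_branch x (Suc n) A k hi = (\<Sum>a\<in>A. geo_factor x a A *
     ((a / x) powi (hi + 1) * branch x n (A - {a}) k - branch_used x n (A - {a}) k a))"
proof -
  have gs: "(\<Sum>l\<in>{k (Suc n) + ne_part d..hi}. x powi (k (Suc n) - l) * a powi l)
      = x powi k (Suc n) * (((a / x) powi (hi + 1) - (a / x) powi (k (Suc n) + ne_part d)) / (a / x - 1))"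
    if "a \<in> A" for a d
  proof -
    have a: "a \<noteq> 0" "a \<noteq> x" using that A by auto
    have "(\<Sum>l\<in>{k (Suc n) + ne_part d..hi}. x powi (k (Suc n) - l) * a powi l)
        = x powi k (Suc n) * (\<Sum>l\<in>{k (Suc n) + ne_part d..hi}. (a / x) powi l)"
      unfolding sum_distrib_left using x0
      by (intro sum.cong) (auto simp: power_int_diff power_int_divide_distrib)
    also have "(\<Sum>l\<in>{k (Suc n) + ne_part d..hi}. (a / x) powi l)
        = ((a / x) powi (hi + 1) - (a / x) powi (k (Suc n) + ne_part d)) / (a / x - 1)"
      by (rule sum_powi_interval) (use a x0 hi in \<open>auto simp: ne_part_def\<close>)
    finally show ?thesis .
  qed
  have "row_branch x (Suc n) A k hi = (\<Sum>d\<in>UNIV. \<Sum>a\<in>A. arrow_weight x d * head_factor a A *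
      (\<Sum>l\<in>{k (Suc n) + ne_part d..hi}. x powi (k (Suc n) - l) * a powi l) * row_branch x n (A - {a}) k (k (Suc n) - nw_part d))"
    unfolding row_branch.simps sum_distrib_left sum_distrib_right
    by (intro sum.cong refl, subst sum.swap) (simp add: mult_ac)
  also have "\<dots> = (\<Sum>a\<in>A. \<Sum>d\<in>UNIV. geo_factor x a A *
      ((a / x) powi (hi + 1) * (arrow_weight x d * x powi k (Suc n) * row_branch x n (A - {a}) k (k (Suc n) - nw_part d))
      - arrow_weight x d * x powi k (Suc n) * (a / x) powi (k (Suc n) + ne_part d) * row_branch x n (A - {a}) k (k (Suc n) - nw_part d)))"
    by (subst sum.swap, intro sum.cong refl, subst gs)
       (auto simp: geo_factor_def diff_divide_distrib algebra_simps)
  also have "\<dots> = (\<Sum>a\<in>A. geo_factor x a A *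
     ((a / x) powi (hi + 1) * branch x n (A - {a}) k - branch_used x n (A - {a}) k a))"
    unfolding branch_def branch_used_def sum_distrib_left sum_subtractf[symmetric] ..
  finally show ?thesis .
qed

text \<open>Summing over the decoration of the last entry affects the two ends differently: the
  upper end involves \<open>nw_part\<close> and yields the pair factor of \<open>x\<close> and
  \<open>a\<close>, the lower end does not and yields \<open>diag_factor x\<close>.\<close>

lemma branch_Suc:
  assumes A: "x \<notin> A" "0 \<notin> A" and k: "k (Suc n) < k (Suc (Suc n))"
  shows "branch x (Suc n) A k = (\<Sum>a\<in>A. (\<Prod>b\<in>{x}. pair_factor b a) * head_factor a A * a powi k (Suc (Suc n)) * branch x n (A - {a}) k)
     - diag_factor x * x powi k (Suc (Suc n)) * (\<Sum>a\<in>A. geo_factor x a A * branch_used x n (A - {a}) k a)"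
proof -
  let ?K = "k (Suc (Suc n))"
  have Qd: "row_branch x (Suc n) A k (?K - nw_part d) = (\<Sum>a\<in>A. geo_factor x a A * ((a / x) powi (?K - nw_part d + 1) * branch x n (A - {a}) k - branch_used x n (A - {a}) k a))" for d
    by (rule row_branch_Suc) (use A k in \<open>auto simp: nw_part_def\<close>)
  have "branch x (Suc n) A k = (\<Sum>a\<in>A. \<Sum>d\<in>UNIV. arrow_weight x d * x powi ?K * (geo_factor x a A *
     ((a / x) powi (?K - nw_part d + 1) * branch x n (A - {a}) k - branch_used x n (A - {a}) k a)))"
    unfolding branch_def[of x "Suc n"] Qd sum_distrib_left by (rule sum.swap)
  also have "\<dots> = (\<Sum>a\<in>A. (\<Prod>b\<in>{x}. pair_factor b a) * head_factor a A * a powi ?K * branch x n (A - {a}) k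
      - diag_factor x * x powi ?K * (geo_factor x a A * branch_used x n (A - {a}) k a))"
  proof (intro sum.cong refl)
    fix a assume "a \<in> A"
    then have a: "a \<noteq> 0" "a \<noteq> x" using A by auto
    \<comment> \<open>Up to the common factor \<open>a powi ?K / x\<close>, the decorations
      \<open>NE\<close>, \<open>NW\<close> and \<open>NWNE\<close> give \<open>u * x * a\<close>,
      \<open>v\<close> and \<open>w * x\<close>.\<close>
    have 1: "(\<Sum>d\<in>UNIV. arrow_weight x d * x powi ?K * (a / x) powi (?K - nw_part d + 1)) = a powi ?K * (v + w * x + u * x * a) / x"
      using a x0 by (simp add: sum_arrow nw_part_def arrow_weight_def power_int_add power_int_divide_distrib field_simps)
    have 2: "(\<Sum>d\<in>UNIV. arrow_weight x d) = diag_factor x" by (simp add: sum_arrow arrow_weight_def diag_factor_def)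
    have "(\<Sum>d\<in>UNIV. arrow_weight x d * x powi ?K * (geo_factor x a A *
        ((a / x) powi (?K - nw_part d + 1) * branch x n (A - {a}) k - branch_used x n (A - {a}) k a)))
      = geo_factor x a A * branch x n (A - {a}) k * (\<Sum>d\<in>UNIV. arrow_weight x d * x powi ?K * (a / x) powi (?K - nw_part d + 1))
        - x powi ?K * geo_factor x a A * branch_used x n (A - {a}) k a * (\<Sum>d\<in>UNIV. arrow_weight x d)"
      unfolding sum_distrib_left sum_subtractf[symmetric] by (intro sum.cong) (auto simp: algebra_simps)
    also have "\<dots> = (\<Prod>b\<in>{x}. pair_factor b a) * head_factor a A * a powi ?K * branch x n (A - {a}) k
      - diag_factor x * x powi ?K * (geo_factor x a A * branch_used x n (A - {a}) k a)"
      unfolding 1 2 using a x0 by (simp add: geo_factor_eq pair_factor_def mult_ac)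
    finally show "(\<Sum>d\<in>UNIV. arrow_weight x d * x powi ?K * (geo_factor x a A *
        ((a / x) powi (?K - nw_part d + 1) * branch x n (A - {a}) k - branch_used x n (A - {a}) k a)))
      = (\<Prod>b\<in>{x}. pair_factor b a) * head_factor a A * a powi ?K * branch x n (A - {a}) k
      - diag_factor x * x powi ?K * (geo_factor x a A * branch_used x n (A - {a}) k a)" .
  qed
  finally show ?thesis by (simp add: sum_subtractf sum_distrib_left)
qed

text \<open>The last entry now sits between \<open>a\<close> on its upper left and \<open>y\<close>
  on its upper right, and its decoration couples them by the numerator
  \<open>v + w * y + u * y * a\<close>. In the lower-end term \<open>x\<close> takes the place of
  \<open>a\<close>.\<close>

lemma branch_used_Suc:
  assumes A: "x \<notin> A" "0 \<notin> A" and k: "k (Suc n) < k (Suc (Suc n))" and y: "y \<noteq> 0"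
  shows "branch_used x (Suc n) A k y =
     (\<Sum>a\<in>A. geo_factor x a A * (a / x) powi k (Suc (Suc n)) * y powi k (Suc (Suc n)) * ((v + w * y + u * y * a) / x) * branch x n (A - {a}) k)
     - y powi k (Suc (Suc n)) * ((v + w * y + u * y * x) / x) * (\<Sum>a\<in>A. geo_factor x a A * branch_used x n (A - {a}) k a)"
proof -
  let ?K = "k (Suc (Suc n))"
  have Qd: "row_branch x (Suc n) A k (?K - nw_part d) = (\<Sum>a\<in>A. geo_factor x a A * ((a / x) powi (?K - nw_part d + 1) * branch x n (A - {a}) k - branch_used x n (A - {a}) k a))" for d
    by (rule row_branch_Suc) (use A k in \<open>auto simp: nw_part_def\<close>)
  have "branch_used x (Suc n) A k y = (\<Sum>a\<in>A. \<Sum>d\<in>UNIV. arrow_weight x d * x powi ?K * (y / x) powi (?K + ne_part d) * (geo_factor x a A *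
     ((a / x) powi (?K - nw_part d + 1) * branch x n (A - {a}) k - branch_used x n (A - {a}) k a)))"
    unfolding branch_used_def[of x "Suc n"] Qd sum_distrib_left by (rule sum.swap)
  also have "\<dots> = (\<Sum>a\<in>A. geo_factor x a A * (a / x) powi ?K * y powi ?K * ((v + w * y + u * y * a) / x) * branch x n (A - {a}) k
      - y powi ?K * ((v + w * y + u * y * x) / x) * (geo_factor x a A * branch_used x n (A - {a}) k a))"
  proof (intro sum.cong refl)
    fix a assume "a \<in> A"
    then have a: "a \<noteq> 0" "a \<noteq> x" using A by auto
    have 1: "(\<Sum>d\<in>UNIV. arrow_weight x d * x powi ?K * (y / x) powi (?K + ne_part d) * (a / x) powi (?K - nw_part d + 1))
        = (a / x) powi ?K * y powi ?K * ((v + w * y + u * y * a) / x)"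
      using a x0 y by (simp add: sum_arrow nw_part_def ne_part_def arrow_weight_def power_int_add power_int_divide_distrib field_simps)
    have 2: "(\<Sum>d\<in>UNIV. arrow_weight x d * x powi ?K * (y / x) powi (?K + ne_part d)) = y powi ?K * ((v + w * y + u * y * x) / x)"
      using a x0 y by (simp add: sum_arrow ne_part_def arrow_weight_def power_int_add power_int_divide_distrib field_simps)
    have "(\<Sum>d\<in>UNIV. arrow_weight x d * x powi ?K * (y / x) powi (?K + ne_part d) * (geo_factor x a A *
        ((a / x) powi (?K - nw_part d + 1) * branch x n (A - {a}) k - branch_used x n (A - {a}) k a)))
      = geo_factor x a A * branch x n (A - {a}) k * (\<Sum>d\<in>UNIV. arrow_weight x d * x powi ?K * (y / x) powi (?K + ne_part d) * (a / x) powi (?K - nw_part d + 1))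
        - geo_factor x a A * branch_used x n (A - {a}) k a * (\<Sum>d\<in>UNIV. arrow_weight x d * x powi ?K * (y / x) powi (?K + ne_part d))"
      unfolding sum_distrib_left sum_subtractf[symmetric] by (intro sum.cong) (auto simp: algebra_simps)
    then show "(\<Sum>d\<in>UNIV. arrow_weight x d * x powi ?K * (y / x) powi (?K + ne_part d) * (geo_factor x a A *
        ((a / x) powi (?K - nw_part d + 1) * branch x n (A - {a}) k - branch_used x n (A - {a}) k a)))
      = geo_factor x a A * (a / x) powi ?K * y powi ?K * ((v + w * y + u * y * a) / x) * branch x n (A - {a}) k
      - y powi ?K * ((v + w * y + u * y * x) / x) * (geo_factor x a A * branch_used x n (A - {a}) k a)"
      unfolding 1 2 by (simp add: algebra_simps)
  qed
  finally show ?thesis by (simp add: sum_subtractf sum_distrib_left)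
qed

lemma head_factor_split:
  assumes "finite A" "y \<in> A" "a \<in> A" "a \<noteq> y"
  shows "head_factor y A = diag_factor y * pair_factor a y * (\<Prod>b\<in>A - {y, a}. pair_factor b y)"
proof -
  have "A - {y} = insert a (A - {y, a})" using assms by auto
  then show ?thesis using assms by (simp add: head_factor_def)
qed

text \<open>Two neighbouring variables attached to the same entry contribute an antisymmetric term, so that
  only chains of lower ends survive.\<close>

lemma sum_branch_used:
  assumes "finite A" "card A = Suc n" "x \<notin> A" "0 \<notin> A" "\<And>i. i \<in> {1..n} \<Longrightarrow> k i < k (Suc i)"
  shows "(\<Sum>a\<in>A. geo_factor x a A * branch_used x n (A - {a}) k a) = - (\<Prod>a\<in>A. pair_factor a x) * sym_sum (Suc n) A k"
  using assms
proof (induction n arbitrary: A)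
  case 0
  then obtain a where A: "A = {a}" by (metis One_nat_def card_1_singletonE)
  have a: "a \<noteq> 0" "a \<noteq> x" using 0 A by auto
  have "branch_used x 0 {} k a = a powi k 1 * ((v + w * a + u * a * x) / x)"
    using a x0 by (simp add: branch_used_def sum_arrow ne_part_def arrow_weight_def power_int_add power_int_divide_distrib field_simps)
  then show ?case using a x0 by (simp add: A geo_factor_eq head_factor_def pair_factor_swap[of a x])
next
  case (Suc n)
  let ?K = "k (Suc (Suc n))"
  have kk: "k (Suc n) < ?K" using Suc.prems(5)[of "Suc n"] by simp
  \<comment> \<open>\<open>h y a\<close> collects the terms in which \<open>y\<close> comes from a
    lower end and \<open>a\<close> from an upper end on the two sides of the same entry.\<close>
  define h where "h y a = geo_factor x y A * (geo_factor x a (A - {y}) * (a / x) powi ?K * y powi ?K * ((v + w * y + u * y * a) / x) * branch x n (A - {y} - {a}) k)" for y a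
  \<comment> \<open>The symmetric part of \<open>h\<close>: \<open>geo_factor x y A\<close> supplies
    the numerator with \<open>y\<close> and \<open>a\<close> exchanged, so both numerators occur and
    only \<open>1 / (y - a)\<close> changes sign.\<close>
  define R where "R y a = diag_factor y * diag_factor a * (\<Prod>b\<in>A - {y, a}. pair_factor b y) * (\<Prod>b\<in>A - {y, a}. pair_factor b a)
    * branch x n (A - {y, a}) k * ((v + w * y + u * y * a) * (v + w * a + u * a * y)) * x / ((y - x) * (a - x))
    * ((a * y) powi ?K / x powi ?K)" for y a
  have h_R: "h y a = R y a / (y - a)" if "y \<in> A" "a \<in> A" "y \<noteq> a" for y a
  proof -
    have e: "A - {y} - {a} = A - {y, a}" by auto
    have "geo_factor x y A = diag_factor y * ((v + w * a + u * a * y) / (y - a)) * (\<Prod>b\<in>A - {y, a}. pair_factor b y) * x / (y - x)"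
      using head_factor_split[OF Suc.prems(1) that(1,2) that(3)[symmetric]] by (simp add: geo_factor_eq pair_factor_def)
    moreover have "geo_factor x a (A - {y}) = diag_factor a * (\<Prod>b\<in>A - {y, a}. pair_factor b a) * x / (a - x)"
      by (simp add: geo_factor_eq head_factor_def e)
    ultimately show ?thesis
      using x0 by (simp add: h_def R_def e power_int_divide_distrib power_int_mult_distrib mult_ac)
  qed
  have R_sym: "R a y = R y a" for y a
    unfolding R_def by (simp add: insert_commute[of a y] mult_ac)
  have anti: "h a y = - h y a" if "y \<in> A" "a \<in> A" "y \<noteq> a" for y a
    using that by (simp add: h_R R_sym[of a y]) (metis minus_diff_eq minus_divide_right)
  have anti_sum: "(\<Sum>a\<in>A. \<Sum>b\<in>A - {a}. h a b) = 0"
    by (rule sum_double_antisym[OF Suc.prems(1)]) (rule anti)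
  have "(\<Sum>a\<in>A. geo_factor x a A * branch_used x (Suc n) (A - {a}) k a)
      = (\<Sum>y\<in>A. (\<Sum>a\<in>A - {y}. h y a) + head_factor y A * y powi ?K * pair_factor y x * - ((\<Prod>a\<in>A - {y}. pair_factor a x) * sym_sum (Suc n) (A - {y}) k))"
  proof (intro sum.cong refl)
    fix y assume y: "y \<in> A"
    have nz: "y \<noteq> 0" "y \<noteq> x" using y Suc.prems by auto
    have IH: "(\<Sum>a\<in>A - {y}. geo_factor x a (A - {y}) * branch_used x n (A - {y} - {a}) k a) = - ((\<Prod>a\<in>A - {y}. pair_factor a x) * sym_sum (Suc n) (A - {y}) k)"
      using Suc.IH[of "A - {y}"] Suc.prems y by auto
    define S where "S = (\<Sum>a\<in>A - {y}. geo_factor x a (A - {y}) * (a / x) powi ?K * y powi ?K * ((v + w * y + u * y * a) / x) * branch x n (A - {y} - {a}) k)"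
    define N where "N = (v + w * y + u * y * x) / x"
    define E where "E = (\<Prod>a\<in>A - {y}. pair_factor a x) * sym_sum (Suc n) (A - {y}) k"
    have "branch_used x (Suc n) (A - {y}) k y = S - y powi ?K * N * - E"
      unfolding S_def N_def E_def by (subst branch_used_Suc) (use Suc.prems kk nz IH in auto)
    then have "geo_factor x y A * branch_used x (Suc n) (A - {y}) k y = geo_factor x y A * S + y powi ?K * (geo_factor x y A * N) * E"
      by (simp add: algebra_simps)
    also have "geo_factor x y A * S = (\<Sum>a\<in>A - {y}. h y a)"
      by (simp add: h_def S_def sum_distrib_left)
    also have "geo_factor x y A * N = - (head_factor y A * pair_factor y x)"
      using x0 by (simp add: geo_factor_eq N_def pair_factor_swap[of y x])
    finally show "geo_factor x y A * branch_used x (Suc n) (A - {y}) k y = (\<Sum>a\<in>A - {y}. h y a) + head_factor y A * y powi ?K * pair_factor y x * - ((\<Prod>a\<in>A - {y}. pair_factor a x) * sym_sum (Suc n) (A - {y}) k)"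
      unfolding E_def by (simp only: mult_minus_left mult_minus_right mult_ac)
  qed
  also have "\<dots> = - (\<Sum>y\<in>A. head_factor y A * y powi ?K * (pair_factor y x * (\<Prod>a\<in>A - {y}. pair_factor a x)) * sym_sum (Suc n) (A - {y}) k)"
    by (simp only: sum.distrib sum_negf mult_minus_right mult.assoc add_0 anti_sum)
  also have "\<dots> = - (\<Prod>a\<in>A. pair_factor a x) * sym_sum (Suc (Suc n)) A k"
    unfolding sym_sum.simps(2)[of "Suc n"] sum_distrib_left sum_negf[symmetric]
  proof (intro sum.cong refl)
    fix y assume "y \<in> A"
    then have eq: "(\<Prod>a\<in>A. pair_factor a x) = pair_factor y x * (\<Prod>a\<in>A - {y}. pair_factor a x)"
      using Suc.prems(1) by (simp add: prod.remove)
    show "- (head_factor y A * y powi ?K * (pair_factor y x * (\<Prod>a\<in>A - {y}. pair_factor a x)) * sym_sum (Suc n) (A - {y}) k)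
      = - (\<Prod>a\<in>A. pair_factor a x) * (head_factor y A * y powi ?K * sym_sum (Suc n) (A - {y}) k)"
      by (simp only: eq mult_minus_left mult_minus_right mult_ac)
  qed
  finally show ?case .
qed

text \<open>Of the two sums in \<open>branch_Suc\<close>, the first runs over the orderings of
  \<open>insert x A\<close> that end in an element of \<open>A\<close>; the second collapses by
  \<open>sum_branch_used\<close> to those ending in \<open>x\<close>.\<close>

lemma branch_eq_sym_sum:
  assumes "finite A" "card A = n" "x \<notin> A" "0 \<notin> A" "\<And>i. i \<in> {1..n} \<Longrightarrow> k i < k (Suc i)"
  shows "branch x n A k = sym_sum (Suc n) (insert x A) k"
  using assms
proof (induction n arbitrary: A)
  case 0
  then show ?case by (simp add: branch_def head_factor_def diag_factor_def sum_arrow arrow_weight_def algebra_simps)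
next
  case (Suc n)
  let ?K = "k (Suc (Suc n))"
  have kk: "k (Suc n) < ?K" using Suc.prems(5)[of "Suc n"] by simp
  have k': "k i < k (Suc i)" if "i \<in> {1..n}" for i using Suc.prems(5)[of i] that by simp
  have "branch x (Suc n) A k = (\<Sum>a\<in>A. (\<Prod>b\<in>{x}. pair_factor b a) * head_factor a A * a powi ?K * branch x n (A - {a}) k)
     - diag_factor x * x powi ?K * (- (\<Prod>a\<in>A. pair_factor a x) * sym_sum (Suc n) A k)"
    by (simp only: branch_Suc[where A = A and k = k and n = n, OF Suc.prems(3,4) kk] sum_branch_used[where A = A and k = k and n = n, OF Suc.prems(1,2,3,4) k'])
  also have "(\<Sum>a\<in>A. (\<Prod>b\<in>{x}. pair_factor b a) * head_factor a A * a powi ?K * branch x n (A - {a}) k)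
     = (\<Sum>a\<in>A. head_factor a (insert x A) * a powi ?K * sym_sum (Suc n) (insert x A - {a}) k)"
  proof (intro sum.cong refl)
    fix a assume a: "a \<in> A"
    have "insert x A - {a} = insert x (A - {a})" using a Suc.prems(3) by auto
    then show "(\<Prod>b\<in>{x}. pair_factor b a) * head_factor a A * a powi ?K * branch x n (A - {a}) k = head_factor a (insert x A) * a powi ?K * sym_sum (Suc n) (insert x A - {a}) k"
      using Suc.IH[of "A - {a}"] Suc.prems(1-4) k' a by (simp add: head_factor_def mult_ac del: sym_sum.simps)
  qed
  also have "diag_factor x * x powi ?K * (- (\<Prod>a\<in>A. pair_factor a x) * sym_sum (Suc n) A k) = - (head_factor x (insert x A) * x powi ?K * sym_sum (Suc n) (insert x A - {x}) k)"
    using Suc.prems(1,3) by (simp add: head_factor_def del: sym_sum.simps)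
  finally show ?case
    by (simp only: sym_sum.simps(2)[of "Suc n"] sum.insert[OF Suc.prems(1,3)] diff_minus_eq_add add.commute)
qed

end

end

section \<open>Decomposition of arrowed monotone triangles into rows\<close>

definition row_ok :: "nat \<Rightarrow> (nat \<Rightarrow> int) \<Rightarrow> bool" where
  "row_ok n k \<longleftrightarrow> (\<forall>j. j \<notin> {1..n} \<longrightarrow> k j = 0) \<and> (\<forall>j. 1 \<le> j \<and> j < n \<longrightarrow> k j < k (Suc j))"

definition interlaced :: "nat \<Rightarrow> (nat \<Rightarrow> int) \<Rightarrow> (nat \<Rightarrow> int) \<Rightarrow> (nat \<Rightarrow> arrow) \<Rightarrow> bool" where
  "interlaced n f k e \<longleftrightarrow>
     (\<forall>j\<in>{1..n}. k j + ne_part (e j) \<le> f j \<and> f j \<le> k (Suc j) - nw_part (e (Suc j)))"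

lemma add_ne_part_le: "a + ne_part d \<le> b \<longleftrightarrow> a \<le> b \<and> (a = b \<longrightarrow> d = NW)"
  by (auto simp: ne_part_def)

lemma le_diff_nw_part: "b \<le> a - nw_part d \<longleftrightarrow> b \<le> a \<and> (a = b \<longrightarrow> d = NE)"
  by (auto simp: nw_part_def)

text \<open>Interlacing and both arrow rules merge into the inequalities of
  \<open>interlaced\<close>, which bound each upper entry separately once the decorations are
  fixed.\<close>

lemma arrowed_monotone_triangle_iff:
  "arrowed_monotone_triangle n m d \<longleftrightarrow>
     (\<forall>i. i \<notin> {1..n} \<longrightarrow> m i = (\<lambda>_. 0) \<and> d i = (\<lambda>_. NWNE)) \<and>
     (\<forall>i\<in>{1..n}. row_ok i (m i) \<and> (\<forall>j. j \<notin> {1..i} \<longrightarrow> d i j = NWNE)) \<and>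
     (\<forall>i\<in>{1..<n}. interlaced i (m i) (m (Suc i)) (d (Suc i)))" (is "?L \<longleftrightarrow> ?R")
proof
  assume L: ?L
  have out: "m i = (\<lambda>_. 0) \<and> d i = (\<lambda>_. NWNE)" if "i \<notin> {1..n}" for i
  proof -
    have "\<not> in_tri n i j" for j using that by (auto simp: in_tri_def)
    then show ?thesis using L by (auto simp: arrowed_monotone_triangle_def monotone_triangle_def)
  qed
  have row: "row_ok i (m i) \<and> (\<forall>j. j \<notin> {1..i} \<longrightarrow> d i j = NWNE)" if "i \<in> {1..n}" for i
  proof -
    have "\<not> in_tri n i j" if "j \<notin> {1..i}" for j using that by (auto simp: in_tri_def)
    then show ?thesis using L that by (auto simp: arrowed_monotone_triangle_def monotone_triangle_def row_ok_def)
  qed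
  have "interlaced i (m i) (m (Suc i)) (d (Suc i))" if "i \<in> {1..<n}" for i
    unfolding interlaced_def add_ne_part_le le_diff_nw_part
  proof (intro ballI conjI impI)
    fix j assume j: "j \<in> {1..i}"
    show "m (Suc i) j \<le> m i j" "m i j \<le> m (Suc i) (Suc j)"
      using L that j unfolding arrowed_monotone_triangle_def monotone_triangle_def by auto
    have nw: "\<And>i j. in_tri n i j \<Longrightarrow> 2 \<le> j \<Longrightarrow> m i j = m (i-1) (j-1) \<Longrightarrow> d i j = NE"
      and ne: "\<And>i j. in_tri n i j \<Longrightarrow> j < i \<Longrightarrow> m i j = m (i-1) j \<Longrightarrow> d i j = NW"
      using L unfolding arrowed_monotone_triangle_def by blast+
    show "d (Suc i) j = NW" if "m (Suc i) j = m i j"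
      using ne[of "Suc i" j] that j \<open>i \<in> {1..<n}\<close> by (auto simp: in_tri_def)
    show "d (Suc i) (Suc j) = NE" if "m (Suc i) (Suc j) = m i j"
      using nw[of "Suc i" "Suc j"] that j \<open>i \<in> {1..<n}\<close> by (auto simp: in_tri_def)
  qed
  with out row show ?R by blast
next
  assume R: ?R
  then have out: "\<And>i. i \<notin> {1..n} \<Longrightarrow> m i = (\<lambda>_. 0) \<and> d i = (\<lambda>_. NWNE)"
    and row: "\<And>i. i \<in> {1..n} \<Longrightarrow> row_ok i (m i) \<and> (\<forall>j. j \<notin> {1..i} \<longrightarrow> d i j = NWNE)"
    and rel: "\<And>i j. i \<in> {1..<n} \<Longrightarrow> j \<in> {1..i} \<Longrightarrow> m (Suc i) j \<le> m i j \<and> (m (Suc i) j = m i j \<longrightarrow> d (Suc i) j = NW) \<and>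
      m i j \<le> m (Suc i) (Suc j) \<and> (m (Suc i) (Suc j) = m i j \<longrightarrow> d (Suc i) (Suc j) = NE)"
    unfolding interlaced_def add_ne_part_le le_diff_nw_part by blast+
  have o: "m i j = 0 \<and> d i j = NWNE" if "\<not> in_tri n i j" for i j
    using that out[of i] row[of i] by (cases "i \<in> {1..n}") (auto simp: in_tri_def row_ok_def)
  show ?L unfolding arrowed_monotone_triangle_def monotone_triangle_def
  proof (intro conjI allI impI)
    fix i j
    show "m i j = 0" "d i j = NWNE" if "\<not> in_tri n i j" using o that by auto
    show "m (i + 1) j \<le> m i j" "m i j \<le> m (i + 1) (j + 1)" if "1 \<le> j \<and> j \<le> i \<and> i < n"
      using rel[of i j] that by auto
    show "m i j < m i (j + 1)" if "1 \<le> j \<and> j < i \<and> i \<le> n"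
      using row[of i] that by (auto simp: row_ok_def)
    show "d i j = NE" if "in_tri n i j \<and> 2 \<le> j \<and> m i j = m (i - 1) (j - 1)"
    proof -
      have "i - 1 \<in> {1..<n}" "j - 1 \<in> {1..i - 1}" "Suc (i - 1) = i" "Suc (j - 1) = j" using that by (auto simp: in_tri_def)
      then show ?thesis using rel[of "i - 1" "j - 1"] that by auto
    qed
    show "d i j = NW" if "in_tri n i j \<and> j < i \<and> m i j = m (i - 1) j"
    proof -
      have "i - 1 \<in> {1..<n}" "j \<in> {1..i - 1}" "Suc (i - 1) = i" using that by (auto simp: in_tri_def)
      then show ?thesis using rel[of "i - 1" j] that by auto
    qed
  qed
qed

definition AMT_bottom :: "nat \<Rightarrow> (nat \<Rightarrow> int) \<Rightarrow> ((nat \<Rightarrow> nat \<Rightarrow> int) \<times> (nat \<Rightarrow> nat \<Rightarrow> arrow)) set" where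
  "AMT_bottom n k = {(m, d). arrowed_monotone_triangle n m d \<and> m n = k}"

text \<open>Rows above \<open>k\<close>, with the decorations of the first \<open>n\<close> entries
  of \<open>k\<close>, built from the right as in \<open>row_branch\<close>. The decoration of entry
  \<open>n + 1\<close> is not stored and acts only through \<open>hi\<close>.\<close>

fun arrowed_rows :: "nat \<Rightarrow> (nat \<Rightarrow> int) \<Rightarrow> int \<Rightarrow> ((nat \<Rightarrow> arrow) \<times> (nat \<Rightarrow> int)) set" where
  "arrowed_rows 0 k hi = {(\<lambda>_. NWNE, \<lambda>_. 0)}"
| "arrowed_rows (Suc n) k hi = (\<lambda>(d, l, e, f). (e(Suc n := d), f(Suc n := l))) `
     (SIGMA d:UNIV. SIGMA l:{k (Suc n) + ne_part d..hi}. arrowed_rows n k (k (Suc n) - nw_part d))"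

lemma finite_arrowed_rows: "finite (arrowed_rows n k hi)"
  by (induction n arbitrary: hi) (auto intro!: finite_imageI finite_SigmaI finite_UNIV_arrow)

lemma mem_arrowed_rows_iff: "(e, f) \<in> arrowed_rows n k hi \<longleftrightarrow>
    (\<forall>j. j \<notin> {1..n} \<longrightarrow> e j = NWNE \<and> f j = 0) \<and>
    (\<forall>j\<in>{1..n}. k j + ne_part (e j) \<le> f j \<and> f j \<le> (if j = n then hi else k (Suc j) - nw_part (e (Suc j))))"
proof (induction n arbitrary: e f hi)
  case 0
  then show ?case by (auto simp: fun_eq_iff)
next
  case (Suc n)
  let ?P = "\<lambda>n hi e f. (\<forall>j. j \<notin> {1..n} \<longrightarrow> e j = NWNE \<and> f j = 0) \<and>
    (\<forall>j\<in>{1..n}. k j + ne_part (e j) \<le> f j \<and> f j \<le> (if j = n then hi else k (Suc j) - nw_part (e (Suc j))))"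
  show ?case
  proof
    assume "(e, f) \<in> arrowed_rows (Suc n) k hi"
    then obtain d l e' f' where *: "e = e'(Suc n := d)" "f = f'(Suc n := l)" "k (Suc n) + ne_part d \<le> l" "l \<le> hi"
      "(e', f') \<in> arrowed_rows n k (k (Suc n) - nw_part d)" by auto
    have P: "?P n (k (Suc n) - nw_part d) e' f'" using Suc.IH *(5) by blast
    have "k j + ne_part (e j) \<le> f j \<and> f j \<le> (if j = Suc n then hi else k (Suc j) - nw_part (e (Suc j)))" if "j \<in> {1..Suc n}" for j
      using bspec[OF conjunct2[OF P], of j] that *(1-4) by (cases "j = Suc n"; cases "j = n") auto
    then show "?P (Suc n) hi e f" using P *(1,2) by auto
  next
    assume R: "?P (Suc n) hi e f"
    let ?e = "e(Suc n := NWNE)" and ?f = "f(Suc n := 0)"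
    have "?P n (k (Suc n) - nw_part (e (Suc n))) ?e ?f"
    proof (intro conjI allI ballI impI)
      fix j assume "j \<notin> {1..n}" then show "?e j = NWNE" "?f j = 0" using R by (auto simp: le_Suc_eq)
    next
      fix j assume j: "j \<in> {1..n}"
      then have "k j + ne_part (e j) \<le> f j \<and> f j \<le> k (Suc j) - nw_part (e (Suc j))"
        using bspec[OF conjunct2[OF R], of j] by auto
      then show "k j + ne_part (?e j) \<le> ?f j"
        "?f j \<le> (if j = n then k (Suc n) - nw_part (e (Suc n)) else k (Suc j) - nw_part (?e (Suc j)))"
        using j by auto
    qed
    then have "(?e, ?f) \<in> arrowed_rows n k (k (Suc n) - nw_part (e (Suc n)))" using Suc.IH by blast
    moreover have "f (Suc n) \<in> {k (Suc n) + ne_part (e (Suc n))..hi}"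
      using bspec[OF conjunct2[OF R], of "Suc n"] by auto
    ultimately show "(e, f) \<in> arrowed_rows (Suc n) k hi"
      by (auto intro!: image_eqI[of _ _ "(e (Suc n), f (Suc n), ?e, ?f)"])
  qed
qed

lemma AMT_bottom_0: "AMT_bottom 0 (\<lambda>_. 0) = {(\<lambda>_ _. 0, \<lambda>_ _. NWNE)}"
  by (auto simp: AMT_bottom_def arrowed_monotone_triangle_iff fun_eq_iff)

lemma AMT_bottom_Suc_iff:
  "(m, d) \<in> AMT_bottom (Suc n) k \<longleftrightarrow> m (Suc n) = k \<and> row_ok (Suc n) k \<and>
     (\<forall>j. j \<notin> {1..Suc n} \<longrightarrow> d (Suc n) j = NWNE) \<and>
     ((d (Suc n))(Suc n := NWNE), m n) \<in> arrowed_rows n k (k (Suc n) - nw_part (d (Suc n) (Suc n))) \<and>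
     (m(Suc n := \<lambda>_. 0), d(Suc n := \<lambda>_. NWNE)) \<in> AMT_bottom n (m n)" (is "?L \<longleftrightarrow> ?R")
proof -
  have arrowed_rows: "((d (Suc n))(Suc n := NWNE), m n) \<in> arrowed_rows n k (k (Suc n) - nw_part (d (Suc n) (Suc n))) \<longleftrightarrow>
      (\<forall>j. j \<notin> {1..Suc n} \<longrightarrow> d (Suc n) j = NWNE) \<and> (\<forall>j. j \<notin> {1..n} \<longrightarrow> m n j = 0) \<and> interlaced n (m n) k (d (Suc n))"
    unfolding mem_arrowed_rows_iff interlaced_def by (auto simp: le_Suc_eq)
  have A: "(m(Suc n := \<lambda>_. 0), d(Suc n := \<lambda>_. NWNE)) \<in> AMT_bottom n (m n) \<longleftrightarrow>
     (\<forall>i. i \<notin> {1..Suc n} \<longrightarrow> m i = (\<lambda>_. 0) \<and> d i = (\<lambda>_. NWNE)) \<and>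
     (\<forall>i\<in>{1..n}. row_ok i (m i) \<and> (\<forall>j. j \<notin> {1..i} \<longrightarrow> d i j = NWNE)) \<and>
     (\<forall>i\<in>{1..<n}. interlaced i (m i) (m (Suc i)) (d (Suc i)))"
    unfolding AMT_bottom_def arrowed_monotone_triangle_iff mem_Collect_eq case_prod_conv by (auto simp: le_Suc_eq)
  have B: "?L \<longleftrightarrow> m (Suc n) = k \<and> row_ok (Suc n) k \<and> (\<forall>j. j \<notin> {1..Suc n} \<longrightarrow> d (Suc n) j = NWNE) \<and>
     (n \<ge> 1 \<longrightarrow> interlaced n (m n) k (d (Suc n))) \<and>
     (\<forall>i. i \<notin> {1..Suc n} \<longrightarrow> m i = (\<lambda>_. 0) \<and> d i = (\<lambda>_. NWNE)) \<and>
     (\<forall>i\<in>{1..n}. row_ok i (m i) \<and> (\<forall>j. j \<notin> {1..i} \<longrightarrow> d i j = NWNE)) \<and>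
     (\<forall>i\<in>{1..<n}. interlaced i (m i) (m (Suc i)) (d (Suc i)))"
  proof -
    have 1: "(\<forall>i\<in>{1..Suc n}. P i) \<longleftrightarrow> P (Suc n) \<and> (\<forall>i\<in>{1..n}. P i)"
      and 2: "(\<forall>i\<in>{1..<Suc n}. P i) \<longleftrightarrow> (n \<ge> 1 \<longrightarrow> P n) \<and> (\<forall>i\<in>{1..<n}. P i)" for P
    proof -
      have "{1..Suc n} = insert (Suc n) {1..n}" by auto
      then show "(\<forall>i\<in>{1..Suc n}. P i) \<longleftrightarrow> P (Suc n) \<and> (\<forall>i\<in>{1..n}. P i)" by (simp only: ball_simps)
      show "(\<forall>i\<in>{1..<Suc n}. P i) \<longleftrightarrow> (n \<ge> 1 \<longrightarrow> P n) \<and> (\<forall>i\<in>{1..<n}. P i)"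
        by (auto simp: less_Suc_eq)
    qed
    show ?thesis
      unfolding AMT_bottom_def arrowed_monotone_triangle_iff mem_Collect_eq case_prod_conv 1 2
      by (auto simp del: atLeastAtMost_iff)
  qed
  have z: "n \<ge> 1 \<Longrightarrow> row_ok n (m n) \<Longrightarrow> \<forall>j. j \<notin> {1..n} \<longrightarrow> m n j = 0"
    by (simp add: row_ok_def)
  have i0: "interlaced 0 a b cc" for a b cc by (simp add: interlaced_def)
  show ?thesis
  proof (cases "n = 0")
    case True
    then show ?thesis unfolding A B arrowed_rows using i0 by auto
  next
    case False
    then have "n \<in> {1..n}" by auto
    then show ?thesis unfolding A B arrowed_rows using z False by (auto simp del: atLeastAtMost_iff)
  qed
qed

text \<open>Every decoration has a component, so an entry of \<open>k\<close> is strictly larger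
  than its northwest-neighbour or strictly smaller than its northeast-neighbour. Hence the row above
  increases strictly by itself, and its entries range over independent intervals.\<close>

lemma row_ok_arrowed_rows:
  assumes "(e, f) \<in> arrowed_rows n k (k (Suc n) - nw_part d)"
  shows "row_ok n f"
  unfolding row_ok_def
proof (intro conjI allI impI)
  show "f j = 0" if "j \<notin> {1..n}" for j using assms that unfolding mem_arrowed_rows_iff by blast
  fix j assume j: "1 \<le> j \<and> j < n"
  have "\<forall>j\<in>{1..n}. k j + ne_part (e j) \<le> f j \<and> f j \<le> (if j = n then k (Suc n) - nw_part d else k (Suc j) - nw_part (e (Suc j)))"
    using assms unfolding mem_arrowed_rows_iff by blast
  from this[rule_format, of j] this[rule_format, of "Suc j"] j
  have "f j \<le> k (Suc j) - nw_part (e (Suc j))" "k (Suc j) + ne_part (e (Suc j)) \<le> f (Suc j)"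
    by auto
  moreover have "nw_part (e (Suc j)) + ne_part (e (Suc j)) \<ge> 1" by (auto simp: nw_part_def ne_part_def)
  ultimately show "f j < f (Suc j)" by linarith
qed

lemma sum_Sigma':
  "finite A \<Longrightarrow> (\<And>x. x \<in> A \<Longrightarrow> finite (B x)) \<Longrightarrow> sum f (Sigma A B) = (\<Sum>x\<in>A. \<Sum>y\<in>B x. f (x, y))"
  by (simp add: sum.Sigma)

section \<open>Generating function of the triangles with a given bottom row\<close>

context arrow_params
begin

lemma prod_arrow_weight:
  assumes "finite J" "x \<noteq> 0"
  shows "(\<Prod>j\<in>J. arrow_weight x (e j)) = u ^ card {j\<in>J. e j = NE} * v ^ card {j\<in>J. e j = NW} * w ^ card {j\<in>J. e j = NWNE}
    * x powi (int (card {j\<in>J. e j = NE}) - int (card {j\<in>J. e j = NW}))"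
  using assms(1)
proof (induction J rule: finite_induct)
  case (insert i J)
  have "{j\<in>insert i J. e j = y} = (if e i = y then insert i {j\<in>J. e j = y} else {j\<in>J. e j = y})" for y by auto
  then have *: "card {j\<in>insert i J. e j = y} = (if e i = y then Suc (card {j\<in>J. e j = y}) else card {j\<in>J. e j = y})" for y
    using insert.hyps by simp
  show ?case
    unfolding * prod.insert[OF insert.hyps] insert.IH
    using \<open>x \<noteq> 0\<close> by (cases "e i") (simp_all add: arrow_weight_def power_int_diff power_int_add field_simps)
qed simp

lemma weight_AMT_rows:
  assumes "\<And>i. i \<in> {1..n} \<Longrightarrow> X i \<noteq> 0"
  shows "weight_AMT n u v w X m d =
    (\<Prod>i=1..n. (\<Prod>j=1..i. arrow_weight (X i) (d i j)) * X i powi (row_sum m i - row_sum m (i - 1)))"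
proof -
  have "(\<Prod>i=1..n. (\<Prod>j=1..i. arrow_weight (X i) (d i j)) * X i powi (row_sum m i - row_sum m (i - 1)))
    = (\<Prod>i=1..n. u ^ row_count n d NE i * v ^ row_count n d NW i * w ^ row_count n d NWNE i *
        X i powi (row_sum m i - row_sum m (i-1) + int (row_count n d NE i) - int (row_count n d NW i)))"
  proof (intro prod.cong refl)
    fix i assume i: "i \<in> {1..n}"
    have e: "row_count n d y i = card {j \<in> {1..i}. d i j = y}" for y by (simp add: row_count_def)
    show "(\<Prod>j=1..i. arrow_weight (X i) (d i j)) * X i powi (row_sum m i - row_sum m (i - 1))
      = u ^ row_count n d NE i * v ^ row_count n d NW i * w ^ row_count n d NWNE i *
        X i powi (row_sum m i - row_sum m (i-1) + int (row_count n d NE i) - int (row_count n d NW i))"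
      unfolding prod_arrow_weight[OF finite_atLeastAtMost assms[OF i]] e[symmetric]
      using assms[OF i] by (simp add: power_int_add power_int_diff field_simps)
  qed
  then show ?thesis
    by (simp add: weight_AMT_def total_count_def power_sum prod.distrib)
qed

text \<open>Gives \<open>row_branch\<close> its meaning: \<open>sym_sum n A f\<close> stands for the
  triangles with bottom row \<open>f\<close>. The recursions agree because \<open>sym_sum\<close>
  and \<open>arrowed_rows\<close> both peel off the last position.\<close>

lemma sum_arrowed_rows:
  assumes "x \<noteq> 0"
  shows "(\<Sum>(e, f)\<in>arrowed_rows n k hi. (\<Prod>j=1..n. arrow_weight x (e j) * x powi (k j - f j)) * sym_sum n A f) = row_branch x n A k hi"
proof (induction n arbitrary: A hi)
  case 0
  then show ?case by simp
next
  case (Suc n)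
  let ?F = "\<lambda>n A (e, f). (\<Prod>j=1..n. arrow_weight x (e j) * x powi (k j - f j)) * sym_sum n A f"
  let ?h = "\<lambda>(d, l, e, f). (e(Suc n := d), f(Suc n := l))"
  let ?S = "SIGMA d:UNIV. SIGMA l:{k (Suc n) + ne_part d..hi}. arrowed_rows n k (k (Suc n) - nw_part d)"
  have out: "e (Suc n) = NWNE" "f (Suc n) = 0" if "(e, f) \<in> arrowed_rows n k h" for e f h
    using that unfolding mem_arrowed_rows_iff by auto
  have inj: "inj_on ?h ?S"
  proof (rule inj_onI)
    fix a b assume a: "a \<in> ?S" "b \<in> ?S" "?h a = ?h b"
    obtain d l e f where A: "a = (d, l, e, f)" "(e, f) \<in> arrowed_rows n k (k (Suc n) - nw_part d)" using a(1) by auto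
    obtain d' l' e' f' where B: "b = (d', l', e', f')" "(e', f') \<in> arrowed_rows n k (k (Suc n) - nw_part d')" using a(2) by auto
    have eq: "e(Suc n := d) = e'(Suc n := d')" "f(Suc n := l) = f'(Suc n := l')" using a(3) A(1) B(1) by auto
    have "d = d'" "l = l'" using fun_cong[OF eq(1), of "Suc n"] fun_cong[OF eq(2), of "Suc n"] by auto
    moreover have "e = e'" "f = f'" using eq out[OF A(2)] out[OF B(2)] by (metis fun_upd_triv fun_upd_upd)+
    ultimately show "a = b" using A B by simp
  qed
  have F: "?F (Suc n) A (e(Suc n := d), f(Suc n := l)) =
      arrow_weight x d * (x powi (k (Suc n) - l) * (\<Sum>a\<in>A. head_factor a A * a powi l * ?F n (A - {a}) (e, f)))" for d l e f
  proof -
    have "sym_sum n B (f(Suc n := l)) = sym_sum n B f" for B by (rule sym_sum_cong) auto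
    moreover have "(\<Prod>j=1..n. arrow_weight x ((e(Suc n := d)) j) * x powi (k j - (f(Suc n := l)) j)) = (\<Prod>j=1..n. arrow_weight x (e j) * x powi (k j - f j))"
      by (intro prod.cong) auto
    ultimately show ?thesis by (simp add: sum_distrib_left mult_ac)
  qed
  have "sum (?F (Suc n) A) (arrowed_rows (Suc n) k hi) = (\<Sum>y\<in>?S. ?F (Suc n) A (?h y))"
    unfolding arrowed_rows.simps by (subst sum.reindex[OF inj]) (simp add: o_def)
  also have "\<dots> = (\<Sum>d\<in>UNIV. \<Sum>l\<in>{k (Suc n) + ne_part d..hi}. \<Sum>y\<in>arrowed_rows n k (k (Suc n) - nw_part d). ?F (Suc n) A (?h (d, l, y)))"
    by (subst sum_Sigma', use finite_UNIV_arrow finite_arrowed_rows in auto)+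
  also have "\<dots> = (\<Sum>d\<in>UNIV. \<Sum>l\<in>{k (Suc n) + ne_part d..hi}. arrow_weight x d * (x powi (k (Suc n) - l) *
     (\<Sum>a\<in>A. head_factor a A * a powi l * row_branch x n (A - {a}) k (k (Suc n) - nw_part d))))"
  proof (intro sum.cong refl)
    fix d l
    have "(\<Sum>y\<in>arrowed_rows n k (k (Suc n) - nw_part d). ?F (Suc n) A (?h (d, l, y)))
      = (\<Sum>y\<in>arrowed_rows n k (k (Suc n) - nw_part d). arrow_weight x d * (x powi (k (Suc n) - l) * (\<Sum>a\<in>A. head_factor a A * a powi l * ?F n (A - {a}) y)))"
      by (intro sum.cong refl) (use F in auto)
    also have "\<dots> = arrow_weight x d * (x powi (k (Suc n) - l) * (\<Sum>a\<in>A. head_factor a A * a powi l * sum (?F n (A - {a})) (arrowed_rows n k (k (Suc n) - nw_part d))))"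
      unfolding sum_distrib_left by (rule sum.swap)
    finally show "(\<Sum>y\<in>arrowed_rows n k (k (Suc n) - nw_part d). ?F (Suc n) A (?h (d, l, y))) = arrow_weight x d * (x powi (k (Suc n) - l) *
     (\<Sum>a\<in>A. head_factor a A * a powi l * row_branch x n (A - {a}) k (k (Suc n) - nw_part d)))" unfolding Suc.IH .
  qed
  finally show ?case by (simp add: sum_distrib_left)
qed

lemma finite_AMT_bottom: "row_ok n k \<Longrightarrow> finite (AMT_bottom n k)"
proof (induction n arbitrary: k)
  case 0
  then have "k = (\<lambda>_. 0)" by (auto simp: row_ok_def)
  then show ?case by (simp add: AMT_bottom_0)
next
  case (Suc n)
  let ?S = "SIGMA y:(SIGMA d:UNIV. arrowed_rows n k (k (Suc n) - nw_part d)). AMT_bottom n (snd (snd y))"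
  have "finite ?S"
    by (intro finite_SigmaI finite_UNIV_arrow finite_arrowed_rows) (auto intro!: Suc.IH row_ok_arrowed_rows)
  moreover have "AMT_bottom (Suc n) k \<subseteq> (\<lambda>((d, e, f), (m, dd)). (m(Suc n := k), dd(Suc n := e(Suc n := d)))) ` ?S"
  proof (rule subsetI, clarify)
    fix m d assume md: "(m, d) \<in> AMT_bottom (Suc n) k"
    show "(m, d) \<in> (\<lambda>((d, e, f), (m, dd)). (m(Suc n := k), dd(Suc n := e(Suc n := d)))) ` ?S"
      by (rule image_eqI[of _ _ "((d (Suc n) (Suc n), (d (Suc n))(Suc n := NWNE), m n), (m(Suc n := \<lambda>_. 0), d(Suc n := \<lambda>_. NWNE)))"])
         (use md[unfolded AMT_bottom_Suc_iff] in auto)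
  qed
  ultimately show ?case by (meson finite_imageI finite_subset)
qed

theorem sum_AMT_bottom:
  assumes "inj_on X {1..n}" "\<And>i. i \<in> {1..n} \<Longrightarrow> X i \<noteq> 0" "row_ok n k"
  shows "(\<Sum>(m, d)\<in>AMT_bottom n k. weight_AMT n u v w X m d) = sym_sum n (X ` {1..n}) k"
  using assms
proof (induction n arbitrary: k)
  case 0
  then have "k = (\<lambda>_. 0)" by (auto simp: row_ok_def)
  then show ?case by (simp add: AMT_bottom_0 weight_AMT_def total_count_def)
next
  case (Suc n)
  let ?x = "X (Suc n)" and ?A = "X ` {1..n}"
  have x: "?x \<noteq> 0" "?x \<notin> ?A" "0 \<notin> ?A" using Suc.prems(1,2) by (auto simp: inj_on_def, fastforce+)
  have cA: "card ?A = n" using Suc.prems(1) by (subst card_image) (auto simp: inj_on_def)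
  have kk: "k i < k (Suc i)" if "i \<in> {1..n}" for i using Suc.prems(3) that by (auto simp: row_ok_def)
  let ?S = "SIGMA y:(SIGMA d:UNIV. arrowed_rows n k (k (Suc n) - nw_part d)). AMT_bottom n (snd (snd y))"
  let ?W = "\<lambda>(m, d). weight_AMT n u v w X m d" and ?W' = "\<lambda>(m, d). weight_AMT (Suc n) u v w X m d"
  let ?r = "\<lambda>(d, e, f). arrow_weight ?x d * ?x powi k (Suc n) * (\<Prod>j=1..n. arrow_weight ?x (e j) * ?x powi (k j - f j))"
  \<comment> \<open>\<open>J\<close> cuts off the bottom row. Its last decoration becomes a separate
    component because \<open>arrowed_rows\<close> stores only the first \<open>n\<close>, and the
    vacated row gets the default values so that \<open>I\<close> is an exact inverse.\<close>
  define J where "J = (\<lambda>(m, d). ((d (Suc n) (Suc n), (d (Suc n))(Suc n := NWNE), m n),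
    (m(Suc n := \<lambda>_ :: nat. 0 :: int), d(Suc n := \<lambda>_ :: nat. NWNE))))"
  define I where "I = (\<lambda>((d, e, f :: nat \<Rightarrow> int), (m, dd)). (m(Suc n := k), dd(Suc n := e(Suc n := d :: arrow))))"
  have "sum ?W' (AMT_bottom (Suc n) k) = (\<Sum>(y, z)\<in>?S. ?r y * ?W z)"
  proof (rule sum.reindex_bij_witness[where j = J and i = I])
    fix a assume "a \<in> AMT_bottom (Suc n) k"
    then obtain m d where a: "a = (m, d)" "(m, d) \<in> AMT_bottom (Suc n) k" by (cases a) auto
    note R = a(2)[unfolded AMT_bottom_Suc_iff]
    show "I (J a) = a"
      using R a by (auto simp: I_def J_def)
    show "J a \<in> ?S"
      using R a by (auto simp: J_def)
    have W: "weight_AMT (Suc n) u v w X m d = (\<Prod>j=1..Suc n. arrow_weight ?x (d (Suc n) j)) * ?x powi (row_sum m (Suc n) - row_sum m n)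
      * weight_AMT n u v w X (m(Suc n := \<lambda>_. 0)) (d(Suc n := \<lambda>_. NWNE))"
    proof -
      have "weight_AMT n u v w X (m(Suc n := \<lambda>_. 0)) (d(Suc n := \<lambda>_. NWNE))
        = (\<Prod>i=1..n. (\<Prod>j=1..i. arrow_weight (X i) (d i j)) * X i powi (row_sum m i - row_sum m (i - 1)))"
        by (subst weight_AMT_rows) (use Suc.prems(2) in \<open>auto intro!: prod.cong simp: row_sum_def\<close>)
      moreover have "weight_AMT (Suc n) u v w X m d = (\<Prod>i=1..Suc n. (\<Prod>j=1..i. arrow_weight (X i) (d i j)) * X i powi (row_sum m i - row_sum m (i - 1)))"
        using Suc.prems(2) by (intro weight_AMT_rows) auto
      ultimately show ?thesis by (simp add: mult_ac)
    qed
    have mk: "m (Suc n) = k" using R by simp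
    have "?x powi (row_sum m (Suc n) - row_sum m n) = ?x powi k (Suc n) * (\<Prod>j=1..n. ?x powi (k j - m n j))"
    proof -
      have "row_sum m (Suc n) - row_sum m n = k (Suc n) + (\<Sum>j=1..n. k j - m n j)"
        by (simp add: row_sum_def mk sum_subtractf)
      moreover have "?x powi (\<Sum>j\<in>J. h j) = (\<Prod>j\<in>J. ?x powi h j)" if "finite J" for J and h :: "nat \<Rightarrow> int"
        using that x(1) by (induction J rule: finite_induct) (auto simp: power_int_add)
      ultimately show ?thesis using x(1) by (simp add: power_int_add)
    qed
    moreover have "(\<Prod>j=1..n. arrow_weight ?x (((d (Suc n))(Suc n := NWNE)) j) * ?x powi (k j - m n j)) = (\<Prod>j=1..n. arrow_weight ?x (d (Suc n) j)) * (\<Prod>j=1..n. ?x powi (k j - m n j))"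
      unfolding prod.distrib[symmetric] by (intro prod.cong) auto
    ultimately show "(\<lambda>(y, z). ?r y * ?W z) (J a) = ?W' a"
      by (simp add: a W J_def mult_ac)
  next
    fix b assume b: "b \<in> ?S"
    then obtain d e f m dd where B: "b = ((d, e, f), (m, dd))" "(e, f) \<in> arrowed_rows n k (k (Suc n) - nw_part d)" "(m, dd) \<in> AMT_bottom n f" by auto
    have o: "m (Suc n) = (\<lambda>_. 0)" "dd (Suc n) = (\<lambda>_. NWNE)" "m n = f"
      using B(3) by (auto simp: AMT_bottom_def arrowed_monotone_triangle_iff)
    have e: "e j = NWNE" if "j \<notin> {1..n}" for j using B(2) that unfolding mem_arrowed_rows_iff by blast
    have en: "e (Suc n) = NWNE" by (rule e) auto
    have up: "m(Suc n := \<lambda>_. 0) = m" "dd(Suc n := \<lambda>_. NWNE) = dd" "e(Suc n := NWNE) = e" using o en by (auto simp: fun_upd_idem)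
    show "J (I b) = b"
      by (simp add: B(1) I_def J_def o up)
    show "I b \<in> AMT_bottom (Suc n) k"
      unfolding B(1) I_def case_prod_conv AMT_bottom_Suc_iff using B(2,3) Suc.prems(3) e by (auto simp: o up)
  qed
  also have "\<dots> = (\<Sum>y\<in>(SIGMA d:UNIV. arrowed_rows n k (k (Suc n) - nw_part d)). \<Sum>z\<in>AMT_bottom n (snd (snd y)). ?r y * ?W z)"
    by (rule sum.Sigma[symmetric]) (auto intro!: finite_SigmaI finite_UNIV_arrow finite_arrowed_rows finite_AMT_bottom row_ok_arrowed_rows)
  also have "\<dots> = (\<Sum>y\<in>(SIGMA d:UNIV. arrowed_rows n k (k (Suc n) - nw_part d)). ?r y * sym_sum n ?A (snd (snd y)))"
    unfolding sum_distrib_left[symmetric]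
    by (intro sum.cong refl arg_cong2[where f="(*)"] Suc.IH) (use Suc.prems in \<open>auto simp: inj_on_def intro: row_ok_arrowed_rows\<close>)
  also have "\<dots> = (\<Sum>d\<in>UNIV. \<Sum>y\<in>arrowed_rows n k (k (Suc n) - nw_part d). ?r (d, y) * sym_sum n ?A (snd y))"
    by (subst sum.Sigma) (auto simp: finite_UNIV_arrow finite_arrowed_rows intro!: sum.cong)
  also have "\<dots> = branch ?x n ?A k"
    unfolding branch_def sum_arrowed_rows[OF x(1), symmetric] sum_distrib_left by (intro sum.cong refl) (auto simp: mult_ac)
  also have "\<dots> = sym_sum (Suc n) (insert ?x ?A) k"
    by (rule branch_eq_sym_sum) (use x cA kk in auto)
  also have "insert ?x ?A = X ` {1..Suc n}" by (simp add: atLeastAtMostSuc_conv)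
  finally show ?case .
qed

end

section \<open>Determinants and alternants\<close>

lemma det_mat:
  "det (mat n n f) = (\<Sum>p\<in>{p. p permutes {0..<n}}. signof p * (\<Prod>i\<in>{0..<n}. f (i, p i)))"
proof -
  have "p i < n" if "p permutes {0..<n}" "i < n" for p i
    using permutes_in_image[OF that(1), of i] that(2) by simp
  then show ?thesis
    by (subst det_def'[of _ n]) (auto intro!: sum.cong prod.cong)
qed

text \<open>Multilinearity in the rows, each with its own index set. It serves to expand over new
  arms, and over the two arms allowed above a leg in a near-balanced shape.\<close>

lemma det_rows_sum:
  fixes M :: "nat \<Rightarrow> 'b \<Rightarrow> nat \<Rightarrow> 'a::comm_ring_1"
  assumes "\<And>i. i < l \<Longrightarrow> finite (R i)"
  shows "det (mat l l (\<lambda>(i, j). \<Sum>k\<in>R i. f i k * M i k j)) =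
    (\<Sum>g\<in>PiE {0..<l} R. (\<Prod>i\<in>{0..<l}. f i (g i)) * det (mat l l (\<lambda>(i, j). M i (g i) j)))"
proof -
  have "(\<Prod>i\<in>{0..<l}. \<Sum>k\<in>R i. f i k * M i k (p i)) = (\<Sum>g\<in>PiE {0..<l} R. \<Prod>i\<in>{0..<l}. f i (g i) * M i (g i) (p i))" for p
    by (rule prod_sum_PiE) (use assms in auto)
  then have "det (mat l l (\<lambda>(i, j). \<Sum>k\<in>R i. f i k * M i k j)) =
    (\<Sum>p\<in>{p. p permutes {0..<l}}. \<Sum>g\<in>PiE {0..<l} R. signof p * (\<Prod>i\<in>{0..<l}. f i (g i) * M i (g i) (p i)))"
    by (simp add: det_mat sum_distrib_left)
  also have "\<dots> = (\<Sum>g\<in>PiE {0..<l} R. \<Sum>p\<in>{p. p permutes {0..<l}}. signof p * (\<Prod>i\<in>{0..<l}. f i (g i) * M i (g i) (p i)))"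
    by (rule sum.swap)
  finally show ?thesis
    by (simp add: det_mat sum_distrib_left prod.distrib mult_ac)
qed

lemma det_mat_swap: "det (mat n n (\<lambda>(i, j). f j i)) = det (mat n n (\<lambda>(i, j). f i j))"
proof -
  have "mat n n (\<lambda>(i, j). f j i) = transpose_mat (mat n n (\<lambda>(i, j). f i j))" by auto
  then show ?thesis by (simp add: det_transpose[of _ n])
qed

lemma det_cols_sum:
  fixes M :: "nat \<Rightarrow> nat \<Rightarrow> 'b \<Rightarrow> 'a::comm_ring_1"
  assumes "\<And>j. j < l \<Longrightarrow> finite (R j)"
  shows "det (mat l l (\<lambda>(i, j). \<Sum>k\<in>R j. f j k * M i j k)) =
    (\<Sum>g\<in>PiE {0..<l} R. (\<Prod>j\<in>{0..<l}. f j (g j)) * det (mat l l (\<lambda>(i, j). M i j (g j))))"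
proof -
  have "det (mat l l (\<lambda>(i, j). \<Sum>k\<in>R j. f j k * M i j k)) = det (mat l l (\<lambda>(j, i). \<Sum>k\<in>R j. f j k * M i j k))"
    by (rule det_mat_swap)
  also have "\<dots> = (\<Sum>g\<in>PiE {0..<l} R. (\<Prod>j\<in>{0..<l}. f j (g j)) * det (mat l l (\<lambda>(j, i). M i j (g j))))"
    by (rule det_rows_sum[OF assms])
  finally show ?thesis
    unfolding det_mat_swap[of l "\<lambda>i j. M i j (g j)" for g] .
qed

lemma det_equal_rows:
  assumes "i < n" "i' < n" "i \<noteq> i'" "\<And>j. j < n \<Longrightarrow> f i j = f i' j"
  shows "det (mat n n (\<lambda>(i, j). f i j)) = 0"
  by (rule det_identical_rows[of _ n i i']) (use assms in \<open>auto intro!: eq_vecI\<close>)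

lemma det_equal_cols:
  assumes "j < n" "j' < n" "j \<noteq> j'" "\<And>i. i < n \<Longrightarrow> f i j = f i j'"
  shows "det (mat n n (\<lambda>(i, j). f i j)) = 0"
  using det_equal_rows[OF assms(1-3), of "\<lambda>j i. f i j"] assms(4) det_mat_swap[of n f] by simp

lemma det_zero_row:
  assumes "i < n" "\<And>j. j < n \<Longrightarrow> f i j = 0"
  shows "det (mat n n (\<lambda>(i, j). f i j)) = (0 :: 'a :: comm_ring_1)"
proof -
  have "(\<Prod>k\<in>{0..<n}. f k (p k)) = 0" if "p permutes {0..<n}" for p
    using assms permutes_in_image[OF that, of i] by (intro prod_zero) (auto intro!: bexI[of _ i])
  then show ?thesis by (simp add: det_mat)
qed

text \<open>Left multiplication by a unipotent matrix. The multiplier may depend on the row, as it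
  will be a power of \<open>u * x\<close> given by the difference of two arms.\<close>

lemma det_sub_next_row:
  fixes f :: "nat \<Rightarrow> nat \<Rightarrow> 'a::comm_ring_1"
  shows "det (mat n n (\<lambda>(i, j). f i j - (if Suc i < n then e i * f (Suc i) j else 0))) = det (mat n n (\<lambda>(i, j). f i j))"
proof -
  let ?U = "mat n n (\<lambda>(i, j). if i = j then 1 else if j = Suc i then - e i else 0) :: 'a mat"
  let ?F = "mat n n (\<lambda>(i, j). f i j)"
  have "mat n n (\<lambda>(i, j). f i j - (if Suc i < n then e i * f (Suc i) j else 0)) = ?U * ?F"
  proof (rule eq_matI)
    fix i j assume ij: "i < dim_row (?U * ?F)" "j < dim_col (?U * ?F)"
    have "(?U * ?F) $$ (i, j) = (\<Sum>k = 0..<n. (if i = k then 1 else if k = Suc i then - e i else 0) * f k j)"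
      using ij by (auto simp: scalar_prod_def)
    also have "\<dots> = (\<Sum>k = 0..<n. (if k = i then f i j else 0) + (if k = Suc i then - e i * f (Suc i) j else 0))"
      by (intro sum.cong) auto
    also have "\<dots> = f i j - (if Suc i < n then e i * f (Suc i) j else 0)"
      using ij by (simp add: sum.distrib)
    finally show "mat n n (\<lambda>(i, j). f i j - (if Suc i < n then e i * f (Suc i) j else 0)) $$ (i, j) = (?U * ?F) $$ (i, j)"
      using ij by simp
  qed auto
  moreover have "det ?U = 1"
    by (subst det_upper_triangular[of _ n]) (auto simp: prod_list_diag_prod)
  ultimately show ?thesis by (simp add: det_mult[of _ n])
qed

text \<open>The lower triangular companion, with one multiplier for all rows; it will absorb the
  terms \<open>w * complete_sum (i - 1)\<close>.\<close>

lemma det_add_prev_row: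
  fixes f :: "nat \<Rightarrow> nat \<Rightarrow> 'a::comm_ring_1"
  shows "det (mat n n (\<lambda>(i, j). f i j + (if 0 < i then e * f (i - 1) j else 0))) = det (mat n n (\<lambda>(i, j). f i j))"
proof -
  let ?U = "mat n n (\<lambda>(i, j). if i = j then 1 else if i = Suc j then e else 0) :: 'a mat"
  let ?F = "mat n n (\<lambda>(i, j). f i j)"
  have "mat n n (\<lambda>(i, j). f i j + (if 0 < i then e * f (i - 1) j else 0)) = ?U * ?F"
  proof (rule eq_matI)
    fix i j assume ij: "i < dim_row (?U * ?F)" "j < dim_col (?U * ?F)"
    have "(?U * ?F) $$ (i, j) = (\<Sum>k = 0..<n. (if i = k then 1 else if i = Suc k then e else 0) * f k j)"
      using ij by (auto simp: scalar_prod_def)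
    also have "\<dots> = (\<Sum>k = 0..<n. (if k = i then f i j else 0) + (if k = i - 1 then (if 0 < i then e * f (i - 1) j else 0) else 0))"
      by (intro sum.cong) auto
    also have "\<dots> = f i j + (if 0 < i then e * f (i - 1) j else 0)"
      using ij by (simp add: sum.distrib)
    finally show "mat n n (\<lambda>(i, j). f i j + (if 0 < i then e * f (i - 1) j else 0)) $$ (i, j) = (?U * ?F) $$ (i, j)"
      using ij by simp
  qed auto
  moreover have "det ?U = 1"
    by (subst det_lower_triangular[of n]) (auto simp: prod_list_diag_prod)
  ultimately show ?thesis by (simp add: det_mult[of _ n])
qed

section \<open>Minors, the Vandermonde product and alternants\<close>

definition skip :: "nat \<Rightarrow> nat \<Rightarrow> nat" where "skip j i = (if i < j then i else Suc i)"

lemma skip_image: "j \<le> n \<Longrightarrow> skip j ` {..<n} = {..n} - {j}"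
proof -
  assume j: "j \<le> n"
  have "i \<in> skip j ` {..<n}" if "i \<in> {..n} - {j}" for i
    using that j by (intro image_eqI[of _ _ "if i < j then i else i - 1"]) (auto simp: skip_def)
  then show ?thesis by (auto simp: skip_def)
qed

lemma skip_inj: "inj (skip j)" by (auto simp: inj_def skip_def split: if_splits)

lemma mat_delete_mat:
  assumes "r \<le> n" "s \<le> n"
  shows "mat_delete (mat (Suc n) (Suc n) (\<lambda>(i, j). f i j)) r s = mat n n (\<lambda>(i, j). f (skip r i) (skip s j))"
  by (rule eq_matI) (use assms in \<open>auto simp: mat_delete_def skip_def\<close>)

lemma laplace_row:
  fixes f :: "nat \<Rightarrow> nat \<Rightarrow> 'a::comm_ring_1"
  assumes "r \<le> n"
  shows "det (mat (Suc n) (Suc n) (\<lambda>(i, j). f i j)) =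
    (\<Sum>j\<le>n. f r j * ((-1) ^ (r + j) * det (mat n n (\<lambda>(i, k). f (skip r i) (skip j k)))))"
  by (subst laplace_expansion_row[of _ "Suc n" r])
     (use assms in \<open>auto simp: cofactor_def mat_delete_mat lessThan_Suc_atMost intro!: sum.cong\<close>)

definition vandermonde :: "nat \<Rightarrow> (nat \<Rightarrow> 'a::comm_ring_1) \<Rightarrow> 'a" where
  "vandermonde n x = (\<Prod>j<n. \<Prod>i<j. x j - x i)"

lemma vandermonde_Suc: "vandermonde (Suc n) x = vandermonde n x * (\<Prod>i<n. x n - x i)"
  by (simp add: vandermonde_def)

lemma prod_skip:
  assumes "j \<le> n"
  shows "(\<Prod>i<n. F (skip j i)) = (\<Prod>i\<in>{..n} - {j}. F i)"
  by (simp add: skip_image[OF assms, symmetric] prod.reindex[OF inj_on_subset[OF skip_inj]] o_def)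

text \<open>The factors pairing \<open>x j\<close> with a later point, \<open>n - j\<close> in
  number, occur with opposite sign in the last product. The resulting sign is the cofactor sign of
  the last row.\<close>

lemma vandermonde_skip:
  assumes "j \<le> n"
  shows "vandermonde (Suc n) x = (-1) ^ (n + j) * vandermonde n (x \<circ> skip j) * (\<Prod>i\<in>{..n} - {j}. x j - x i)"
  using assms
proof (induction n)
  case 0 then show ?case by (simp add: vandermonde_def)
next
  case (Suc m)
  show ?case
  proof (cases "j = Suc m")
    case True
    have "vandermonde (Suc m) (x \<circ> skip j) = vandermonde (Suc m) x"
      unfolding vandermonde_def True by (intro prod.cong) (auto simp: skip_def)
    moreover have "{..Suc m} - {j} = {..<Suc m}" using True by auto
    moreover have "(-1) ^ (Suc m + j) = (1 :: 'a)" by (simp add: True)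
    ultimately show ?thesis by (simp only: vandermonde_Suc[of "Suc m"] mult_1) (simp add: True)
  next
    case False
    then have j: "j \<le> m" using Suc.prems by simp
    have 1: "(\<Prod>i<Suc m. x (Suc m) - x i) = (x (Suc m) - x j) * (\<Prod>i<m. x (Suc m) - x (skip j i))"
      using prod_skip[OF j, of "\<lambda>i. x (Suc m) - x i"] j by (simp add: lessThan_Suc_atMost prod.remove)
    have 2: "vandermonde (Suc m) (x \<circ> skip j) = vandermonde m (x \<circ> skip j) * (\<Prod>i<m. x (Suc m) - x (skip j i))"
      using j by (simp add: vandermonde_Suc) (simp add: skip_def)
    have "{..Suc m} - {j} = insert (Suc m) ({..m} - {j})" using j by auto
    then have 3: "(\<Prod>i\<in>{..Suc m} - {j}. x j - x i) = (x j - x (Suc m)) * (\<Prod>i\<in>{..m} - {j}. x j - x i)"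
      by simp
    have "vandermonde (Suc (Suc m)) x = (-1) ^ (m + j) * vandermonde m (x \<circ> skip j) * (\<Prod>i\<in>{..m} - {j}. x j - x i) *
        ((x (Suc m) - x j) * (\<Prod>i<m. x (Suc m) - x (skip j i)))"
      unfolding vandermonde_Suc[of "Suc m" x] Suc.IH[OF j] 1 ..
    also have "\<dots> = (-1) ^ (Suc m + j) * vandermonde (Suc m) (x \<circ> skip j) * (\<Prod>i\<in>{..Suc m} - {j}. x j - x i)"
      unfolding 2 3 by (simp add: algebra_simps)
    finally show ?thesis .
  qed
qed

lemma vandermonde_nonzero:
  fixes x :: "nat \<Rightarrow> 'a::field"
  assumes "inj_on x {..<n}"
  shows "vandermonde n x \<noteq> 0"
proof -
  have "x j - x i \<noteq> 0" if "j < n" "i < j" for i j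
    using inj_onD[OF assms, of j i] that by auto
  then show ?thesis by (simp add: vandermonde_def)
qed

text \<open>The determinant of \<open>\<phi> i\<close> at the points of \<open>A\<close> divided by the Vandermonde determinant, expanded along
  the last row.\<close>

fun alternant :: "(nat \<Rightarrow> 'a \<Rightarrow> 'a) \<Rightarrow> nat \<Rightarrow> 'a set \<Rightarrow> 'a::field" where
  "alternant \<phi> 0 A = 1"
| "alternant \<phi> (Suc n) A = (\<Sum>a\<in>A. \<phi> n a * (\<Prod>b\<in>A - {a}. 1 / (a - b)) * alternant \<phi> n (A - {a}))"

lemma alternant_cong: "(\<And>i a. i < n \<Longrightarrow> a \<in> A \<Longrightarrow> \<phi> i a = \<psi> i a) \<Longrightarrow> alternant \<phi> n A = alternant \<psi> n A"
proof (induction n arbitrary: A)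
  case (Suc n)
  have "alternant \<phi> n (A - {a}) = alternant \<psi> n (A - {a})" for a
    by (rule Suc.IH) (use Suc.prems in auto)
  then show ?case using Suc.prems by (auto intro!: sum.cong)
qed simp

text \<open>Laplace expansion along the last row. The cofactor signs cancel against those of
  \<open>vandermonde_skip\<close>, so \<open>alternant\<close> carries no signs and depends only on
  the set of points.\<close>

lemma det_eq_alternant:
  fixes x :: "nat \<Rightarrow> 'a::field"
  assumes "inj_on x {..<n}"
  shows "det (mat n n (\<lambda>(i, j). \<phi> i (x j))) = vandermonde n x * alternant \<phi> n (x ` {..<n})"
  using assms
proof (induction n arbitrary: x)
  case 0 then show ?case by (simp add: vandermonde_def)
next
  case (Suc n)
  have ne: "x i \<noteq> x j" if "i \<le> n" "j \<le> n" "i \<noteq> j" for i j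
    using Suc.prems that by (auto simp: inj_on_def)
  have "det (mat (Suc n) (Suc n) (\<lambda>(i, j). \<phi> i (x j))) =
    (\<Sum>j\<le>n. \<phi> n (x j) * ((-1) ^ (n + j) * det (mat n n (\<lambda>(i, k). \<phi> (skip n i) (x (skip j k))))))"
    by (rule laplace_row) simp
  also have "\<dots> = (\<Sum>j\<le>n. vandermonde (Suc n) x * (\<phi> n (x j) * (\<Prod>b\<in>x ` {..n} - {x j}. 1 / (x j - b)) * alternant \<phi> n (x ` {..n} - {x j})))"
  proof (intro sum.cong refl)
    fix j assume "j \<in> {..n}"
    then have j: "j \<le> n" by simp
    have "inj_on (x \<circ> skip j) {..<n}"
      by (rule comp_inj_on[OF inj_on_subset[OF skip_inj]])
         (use Suc.prems in \<open>auto simp: skip_image[OF j] lessThan_Suc_atMost intro: inj_on_subset\<close>)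
    moreover have "x ` ({..n} - {j}) = (x \<circ> skip j) ` {..<n}"
      by (simp add: skip_image[OF j, symmetric] image_comp)
    ultimately have 1: "det (mat n n (\<lambda>(i, k). \<phi> i (x (skip j k)))) = vandermonde n (x \<circ> skip j) * alternant \<phi> n (x ` ({..n} - {j}))"
      using Suc.IH[of "x \<circ> skip j"] by (simp add: o_def)
    have 2: "mat n n (\<lambda>(i, k). \<phi> (skip n i) (x (skip j k))) = mat n n (\<lambda>(i, k). \<phi> i (x (skip j k)))"
      by (rule eq_matI) (auto simp: skip_def)
    have im: "x ` ({..n} - {j}) = x ` {..n} - {x j}" using ne j by auto
    have 3: "(\<Prod>b\<in>x ` {..n} - {x j}. 1 / (x j - b)) = 1 / (\<Prod>i\<in>{..n} - {j}. x j - x i)"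
      unfolding im[symmetric] using Suc.prems
      by (subst prod.reindex) (auto simp: lessThan_Suc_atMost prod_dividef intro: inj_on_subset)
    have "(\<Prod>i\<in>{..n} - {j}. x j - x i) \<noteq> 0" using ne j by auto
    then show "\<phi> n (x j) * ((-1) ^ (n + j) * det (mat n n (\<lambda>(i, k). \<phi> (skip n i) (x (skip j k))))) =
       vandermonde (Suc n) x * (\<phi> n (x j) * (\<Prod>b\<in>x ` {..n} - {x j}. 1 / (x j - b)) * alternant \<phi> n (x ` {..n} - {x j}))"
      unfolding 2 1 3 im vandermonde_skip[OF j] by simp
  qed
  also have "\<dots> = vandermonde (Suc n) x * alternant \<phi> (Suc n) (x ` {..<Suc n})"
    unfolding sum_distrib_left[symmetric] lessThan_Suc_atMost alternant.simps
    by (subst sum.reindex) (use Suc.prems in \<open>auto simp: lessThan_Suc_atMost\<close>)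
  finally show ?case .
qed

text \<open>Up to the Vandermonde product this is a determinant in which \<open>\<phi> m\<close>
  occupies both row \<open>m\<close> and the last row.\<close>

lemma alternant_repeated:
  fixes \<phi> :: "nat \<Rightarrow> 'a \<Rightarrow> 'a::field"
  assumes "finite A" "card A = Suc n" "m < n"
  shows "(\<Sum>a\<in>A. \<phi> m a * (\<Prod>b\<in>A - {a}. 1 / (a - b)) * alternant \<phi> n (A - {a})) = 0"
proof -
  obtain x where "bij_betw x {0..<card A} A" using ex_bij_betw_nat_finite[OF assms(1)] by blast
  then have x: "inj_on x {..<Suc n}" "x ` {..<Suc n} = A"
    by (auto simp: bij_betw_def assms(2) lessThan_atLeast0)
  let ?\<psi> = "\<phi>(n := \<phi> m)"
  have "det (mat (Suc n) (Suc n) (\<lambda>(i, j). ?\<psi> i (x j))) = 0"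
    by (rule det_equal_rows[of m _ n]) (use assms(3) in auto)
  then have "vandermonde (Suc n) x * alternant ?\<psi> (Suc n) A = 0"
    unfolding det_eq_alternant[OF x(1)] x(2) .
  then have "alternant ?\<psi> (Suc n) A = 0"
    using vandermonde_nonzero[OF x(1)] by (simp only: mult_eq_0_iff) blast
  moreover have "alternant ?\<psi> n B = alternant \<phi> n B" for B by (rule alternant_cong) auto
  ultimately show ?thesis by simp
qed

text \<open>A row operation: multiples of the lower functions may be added to the top one, with
  coefficients \<open>co m\<close> that are the same at all points.\<close>

lemma alternant_top:
  fixes \<phi> :: "nat \<Rightarrow> 'a \<Rightarrow> 'a::field"
  assumes "finite A" "card A = Suc n" "\<And>a. a \<in> A \<Longrightarrow> \<psi> a = \<phi> n a + (\<Sum>m<n. co m * \<phi> m a)"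
  shows "(\<Sum>a\<in>A. \<psi> a * (\<Prod>b\<in>A - {a}. 1 / (a - b)) * alternant \<phi> n (A - {a})) = alternant \<phi> (Suc n) A"
proof -
  let ?R = "\<lambda>a. (\<Prod>b\<in>A - {a}. 1 / (a - b)) * alternant \<phi> n (A - {a})"
  have "(\<Sum>a\<in>A. \<psi> a * ?R a) = (\<Sum>a\<in>A. \<phi> n a * ?R a + (\<Sum>m<n. co m * (\<phi> m a * ?R a)))"
    by (intro sum.cong refl) (simp only: assms(3) distrib_right sum_distrib_right mult.assoc)
  also have "\<dots> = (\<Sum>a\<in>A. \<phi> n a * ?R a) + (\<Sum>m<n. co m * (\<Sum>a\<in>A. \<phi> m a * ?R a))"
    unfolding sum.distrib sum_distrib_left by (subst sum.swap) simp
  also have "(\<Sum>m<n. co m * (\<Sum>a\<in>A. \<phi> m a * ?R a)) = 0"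
    using alternant_repeated[OF assms(1,2), of _ \<phi>] by (intro sum.neutral) (simp add: mult.assoc)
  finally show ?thesis by (simp add: mult.assoc)
qed

lemma monic_prod_expand:
  fixes B :: "'b set" and z :: "'b \<Rightarrow> 'a::field"
  assumes "finite B"
  shows "\<exists>co. \<forall>x. (\<Prod>b\<in>B. x - z b) = x ^ card B + (\<Sum>m<card B. co m * x ^ m)"
proof -
  let ?P = "\<Prod>b\<in>B. [:- z b, 1:]"
  have deg: "degree ?P = card B"
    by (subst degree_prod_eq_sum_degree) auto
  have lc: "coeff ?P (card B) = 1"
    using lead_coeff_prod[of "\<lambda>b. [:- z b, 1:]" B] deg by simp
  have "(\<Prod>b\<in>B. x - z b) = x ^ card B + (\<Sum>m<card B. coeff ?P m * x ^ m)" for x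
  proof -
    have "(\<Prod>b\<in>B. x - z b) = poly ?P x" by (simp add: poly_prod)
    also have "\<dots> = (\<Sum>m\<le>card B. coeff ?P m * x ^ m)" by (simp add: poly_altdef deg)
    also have "\<dots> = x ^ card B + (\<Sum>m<card B. coeff ?P m * x ^ m)"
      by (simp add: lessThan_Suc_atMost[symmetric] lc)
    finally show ?thesis .
  qed
  then show ?thesis by blast
qed

text \<open>The top monomial is replaced by the monic polynomial of the same degree that vanishes at
  every point except \<open>a0\<close>, so a single term survives.\<close>

lemma alternant_monomials:
  "finite A \<Longrightarrow> card A = n \<Longrightarrow> alternant (\<lambda>i x. x ^ i) n A = (1 :: 'a::field)"
proof (induction n arbitrary: A)
  case (Suc n)
  then obtain a0 where a0: "a0 \<in> A" by fastforce
  obtain co where co: "\<And>x. (\<Prod>b\<in>A - {a0}. x - b) = x ^ n + (\<Sum>m<n. co m * x ^ m)"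
    using monic_prod_expand[of "A - {a0}" "\<lambda>b. b"] Suc.prems a0 by auto
  have "alternant (\<lambda>i x. x ^ i) (Suc n) A =
    (\<Sum>a\<in>A. (\<Prod>b\<in>A - {a0}. a - b) * (\<Prod>b\<in>A - {a}. 1 / (a - b)) * alternant (\<lambda>i x. x ^ i) n (A - {a}))"
    by (rule alternant_top[symmetric, OF Suc.prems co])
  also have "\<dots> = (\<Sum>a\<in>A. if a = a0 then 1 else 0)"
  proof (intro sum.cong refl)
    fix a assume a: "a \<in> A"
    show "(\<Prod>b\<in>A - {a0}. a - b) * (\<Prod>b\<in>A - {a}. 1 / (a - b)) * alternant (\<lambda>i x. x ^ i) n (A - {a}) = (if a = a0 then 1 else 0)"
    proof (cases "a = a0")
      case True
      have "(\<Prod>b\<in>A - {a0}. a0 - b) \<noteq> 0" using Suc.prems by auto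
      moreover have "alternant (\<lambda>i x. x ^ i) n (A - {a0}) = 1" using Suc a0 by simp
      ultimately show ?thesis using True by (simp add: prod_dividef)
    next
      case False
      then have "(\<Prod>b\<in>A - {a0}. a - b) = 0" using a Suc.prems(1) by auto
      then show ?thesis using False by simp
    qed
  qed
  finally show ?case using a0 Suc.prems(1) by simp
qed simp

lemma det_vandermonde:
  fixes x :: "nat \<Rightarrow> 'a::field"
  assumes "inj_on x {..<n}"
  shows "det (mat n n (\<lambda>(i, j). x j ^ i)) = vandermonde n x"
  using det_eq_alternant[OF assms, of "\<lambda>i x. x ^ i"] alternant_monomials[of "x ` {..<n}" n] card_image[OF assms] by simp

text \<open>Expansion into principal minors in a form fit for induction: the indices in
  \<open>cs\<close> are already chosen, those in \<open>zs\<close> are open. By linearity in the row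
  of the first open index, its \<open>1\<close> deletes the index and the remaining part keeps
  it.\<close>

lemma det_identity_plus:
  fixes M :: "'b \<Rightarrow> 'b \<Rightarrow> 'a::comm_ring_1"
  shows "det (mat (length (cs @ zs)) (length (cs @ zs)) (\<lambda>(i, j).
      (if i = j \<and> length cs \<le> i then 1 else 0) + M ((cs @ zs) ! i) ((cs @ zs) ! j))) =
    (\<Sum>ys\<leftarrow>subseqs zs. det (mat (length (cs @ ys)) (length (cs @ ys)) (\<lambda>(i, j). M ((cs @ ys) ! i) ((cs @ ys) ! j))))"
proof (induction zs arbitrary: cs)
  case Nil
  show ?case by (auto intro!: arg_cong[where f = det])
next
  case (Cons z zs)
  let ?D = "\<lambda>cs zs. det (mat (length (cs @ zs)) (length (cs @ zs)) (\<lambda>(i, j).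
      (if i = j \<and> length cs \<le> i then 1 else 0) + M ((cs @ zs) ! i) ((cs @ zs) ! j)))"
  let ?r = "length cs" and ?n = "length (cs @ zs)"
  \<comment> \<open>\<open>f 0\<close> has the additional \<open>1\<close> in row \<open>?r\<close>,
    \<open>f 1\<close> lacks it, and the two agree in all other rows.\<close>
  define f where "f b i j = (if i = j \<and> ?r + b \<le> i then 1 else 0) + M ((cs @ z # zs) ! i) ((cs @ z # zs) ! j)" for b i j
  have r: "?r \<le> ?n" by simp
  have f_skip: "f 0 (skip ?r i) k = f 1 (skip ?r i) k" for i k
    by (auto simp: f_def skip_def)
  have f_r: "f 0 ?r j = f 1 ?r j + (if j = ?r then 1 else 0)" for j by (auto simp: f_def)
  have len: "length (cs @ z # zs) = Suc ?n" by simp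
  have "?D cs (z # zs) = det (mat (Suc ?n) (Suc ?n) (\<lambda>(i, j). f 0 i j))"
    unfolding len f_def by simp
  also have "\<dots> = (\<Sum>j\<le>?n. f 0 ?r j * ((-1) ^ (?r + j) * det (mat ?n ?n (\<lambda>(i, k). f 0 (skip ?r i) (skip j k)))))"
    by (rule laplace_row[OF r])
  also have "\<dots> = (\<Sum>j\<le>?n. f 1 ?r j * ((-1) ^ (?r + j) * det (mat ?n ?n (\<lambda>(i, k). f 1 (skip ?r i) (skip j k)))))
      + (\<Sum>j\<le>?n. if j = ?r then det (mat ?n ?n (\<lambda>(i, k). f 0 (skip ?r i) (skip ?r k))) else 0)"
    unfolding sum.distrib[symmetric] f_r f_skip by (intro sum.cong refl) (auto simp: algebra_simps)
  also have "(\<Sum>j\<le>?n. f 1 ?r j * ((-1) ^ (?r + j) * det (mat ?n ?n (\<lambda>(i, k). f 1 (skip ?r i) (skip j k)))))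
      = det (mat (Suc ?n) (Suc ?n) (\<lambda>(i, j). f 1 i j))"
    by (rule laplace_row[OF r, symmetric])
  also have "\<dots> = ?D (cs @ [z]) zs" unfolding f_def by simp
  also have "(\<Sum>j\<le>?n. if j = ?r then det (mat ?n ?n (\<lambda>(i, k). f 0 (skip ?r i) (skip ?r k))) else 0)
     = det (mat ?n ?n (\<lambda>(i, k). f 0 (skip ?r i) (skip ?r k)))" by simp
  also have "\<dots> = ?D cs zs"
  proof -
    have "(cs @ z # zs) ! skip ?r i = (cs @ zs) ! i" for i
      by (auto simp: skip_def nth_append)
    moreover have "(skip ?r i = skip ?r j \<and> ?r \<le> skip ?r i) \<longleftrightarrow> (i = j \<and> ?r \<le> i)" for i j
      by (auto simp: skip_def)
    ultimately show ?thesis unfolding f_def by simp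
  qed
  finally show ?case unfolding Cons.IH by (simp add: Let_def o_def)
qed

section \<open>Set-valued fillings\<close>

text \<open>The lower bound \<open>t\<close> is a parameter so that deleting the value
  \<open>t\<close> stays within the family; \<open>C\<close> is any set of cells because the
  remaining cells are recognized as a shape only later.\<close>

definition fillings :: "nat \<Rightarrow> nat \<Rightarrow> (nat \<times> nat) set \<Rightarrow> (nat \<times> nat \<Rightarrow> nat set) set" where
  "fillings N t C = {F.
     (\<forall>x. x \<notin> C \<longrightarrow> F x = {}) \<and>
     (\<forall>x\<in>C. F x \<noteq> {} \<and> F x \<subseteq> {t..N}) \<and>
     (\<forall>r c. (r, c) \<in> C \<and> r < c \<longrightarrow> card (F (r, c)) = 1) \<and>
     (\<forall>r c. (r, c) \<in> C \<and> (r, Suc c) \<in> C \<longrightarrow> Max (F (r, Suc c)) \<le> Max (F (r, c))) \<and>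
     (\<forall>r c. (r, c) \<in> C \<and> (Suc r, c) \<in> C \<longrightarrow> (\<forall>x\<in>F (r, c). \<forall>y\<in>F (Suc r, c). y < x))}"

lemma SBCSPP_filling_iff: "SBCSPP_filling n a b F \<longleftrightarrow> F \<in> fillings n 1 (cells a b)"
  by (simp add: SBCSPP_filling_def fillings_def)

lemma fillingsD:
  assumes "F \<in> fillings N t C"
  shows "x \<notin> C \<Longrightarrow> F x = {}" "x \<in> C \<Longrightarrow> F x \<noteq> {}" "F x \<subseteq> {t..N}" "finite (F x)"
    "(r, c) \<in> C \<Longrightarrow> r < c \<Longrightarrow> card (F (r, c)) = 1"
    "(r, c) \<in> C \<Longrightarrow> (r, Suc c) \<in> C \<Longrightarrow> Max (F (r, Suc c)) \<le> Max (F (r, c))"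
    "(r, c) \<in> C \<Longrightarrow> (Suc r, c) \<in> C \<Longrightarrow> i \<in> F (r, c) \<Longrightarrow> j \<in> F (Suc r, c) \<Longrightarrow> j < i"
proof -
  show 1: "F x = {}" if "x \<notin> C" using assms that unfolding fillings_def by blast
  show 2: "F x \<noteq> {}" if "x \<in> C" using assms that unfolding fillings_def by blast
  show 3: "F x \<subseteq> {t..N}"
  proof (cases "x \<in> C")
    case True then show ?thesis using assms unfolding fillings_def by blast
  qed (use 1 in simp)
  then show "finite (F x)" by (rule finite_subset) simp
qed (use assms in \<open>auto simp: fillings_def\<close>)

lemma finite_fillings:
  assumes "finite C"
  shows "finite (fillings N t C)"
proof (rule finite_subset)
  show "fillings N t C \<subseteq> {F. \<forall>x. (x \<in> C \<longrightarrow> F x \<in> Pow {t..N}) \<and> (x \<notin> C \<longrightarrow> F x = {})}"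
    using fillingsD(1,3) by blast
  show "finite {F. \<forall>x. (x \<in> C \<longrightarrow> F x \<in> Pow {t..N}) \<and> (x \<notin> C \<longrightarrow> F x = {})}"
    by (rule finite_set_of_finite_funs) (use assms in auto)
qed

text \<open>\<open>\<mu>\<close> is what remains; \<open>C - \<mu>\<close> holds the cells filled
  with the smallest value alone. A cell above another cell of \<open>C\<close> must remain, since
  its entries exceed those below it; this makes \<open>C - \<mu>\<close> a horizontal strip.\<close>

definition strips :: "(nat \<times> nat) set \<Rightarrow> (nat \<times> nat) set set" where
  "strips C = {\<mu>. \<mu> \<subseteq> C \<and> (\<forall>r c. (r, c) \<in> C \<and> (r, Suc c) \<in> \<mu> \<longrightarrow> (r, c) \<in> \<mu>) \<and>
     (\<forall>r c. (r, c) \<in> C \<and> (Suc r, c) \<in> C \<longrightarrow> (r, c) \<in> \<mu>)}"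

text \<open>The cells that may contain the smallest value next to larger ones.\<close>

definition strip_ends :: "(nat \<times> nat) set \<Rightarrow> (nat \<times> nat) set \<Rightarrow> (nat \<times> nat) set" where
  "strip_ends C \<mu> = {(r, c) \<in> \<mu>. c \<le> r \<and> (Suc r, c) \<notin> C}"

definition add_value :: "nat \<Rightarrow> (nat \<times> nat) set \<Rightarrow> (nat \<times> nat) set \<times> (nat \<times> nat) set \<times> (nat \<times> nat \<Rightarrow> nat set) \<Rightarrow> nat \<times> nat \<Rightarrow> nat set" where
  "add_value t C = (\<lambda>(\<mu>, E, G) x. if x \<in> C - \<mu> then {t} else if x \<in> E then insert t (G x) else G x)"

definition del_value :: "nat \<Rightarrow> (nat \<times> nat) set \<Rightarrow> (nat \<times> nat \<Rightarrow> nat set) \<Rightarrow> (nat \<times> nat) set \<times> (nat \<times> nat) set \<times> (nat \<times> nat \<Rightarrow> nat set)" where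
  "del_value t C F = ({x \<in> C. F x \<noteq> {t}}, {x \<in> C. t \<in> F x \<and> F x \<noteq> {t}}, \<lambda>x. F x - {t})"

lemma del_value_in:
  assumes F: "F \<in> fillings N t C"
  shows "del_value t C F \<in> (SIGMA \<mu>:strips C. Pow (strip_ends C \<mu>) \<times> fillings N (Suc t) \<mu>)"
proof -
  note D = fillingsD[OF F]
  let ?\<mu> = "{x \<in> C. F x \<noteq> {t}}"
  have big: "\<exists>i\<in>F x. t < i" if "x \<in> ?\<mu>" for x
  proof -
    have "\<exists>i\<in>F x. i \<noteq> t" using that D(2)[of x] by auto
    then obtain i where "i \<in> F x" "i \<noteq> t" by blast
    then show ?thesis using D(3)[of x] by (intro bexI[of _ i]) auto
  qed
  \<comment> \<open>Deleting the smallest value does not change the maximum of a set with a larger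
    element, so the row condition, which concerns maxima only, is inherited.\<close>
  have Max_minus: "Max (F x - {t}) = Max (F x)" if x: "x \<in> ?\<mu>" for x
  proof -
    obtain i where i: "i \<in> F x" "t < i" using big[OF x] by blast
    then have "Max (F x) \<ge> i" using D(4) by simp
    then have "Max (F x) \<noteq> t" using i by simp
    moreover have "Max (F x) \<in> F x" using i D(4) by (intro Max_in) auto
    ultimately have "Max (F x) \<in> F x - {t}" by simp
    then show ?thesis using D(4) by (intro Max_eqI) auto
  qed
  have strip: "?\<mu> \<in> strips C"
    unfolding strips_def
  proof (rule CollectI, intro conjI allI impI)
    show "(r, c) \<in> ?\<mu>" if rc: "(r, c) \<in> C \<and> (r, Suc c) \<in> ?\<mu>" for r c
    proof -
      obtain i where i: "i \<in> F (r, Suc c)" "t < i" using big rc by blast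
      have "i \<le> Max (F (r, Suc c))" using i D(4) by simp
      also have "\<dots> \<le> Max (F (r, c))" by (rule D(6)) (use rc in auto)
      finally have "F (r, c) \<noteq> {t}" using i(2) by auto
      then show ?thesis using rc by auto
    qed
    show "(r, c) \<in> ?\<mu>" if rc: "(r, c) \<in> C \<and> (Suc r, c) \<in> C" for r c
    proof -
      obtain j where j: "j \<in> F (Suc r, c)" using D(2) rc by blast
      then have "t \<le> j" using D(3)[of "(Suc r, c)"] by auto
      moreover have "j < t" if "F (r, c) = {t}" using D(7)[of r c t j] rc j that by auto
      ultimately show ?thesis using rc by auto
    qed
  qed auto
  \<comment> \<open>A cell holding \<open>t\<close> and other values is not above the diagonal,
    where the sets are singletons, and has no cell below it, which would need a value less than
    \<open>t\<close>.\<close>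
  have ends: "{x \<in> C. t \<in> F x \<and> F x \<noteq> {t}} \<subseteq> strip_ends C ?\<mu>"
  proof
    fix x assume x: "x \<in> {x \<in> C. t \<in> F x \<and> F x \<noteq> {t}}"
    obtain r c where rc: "x = (r, c)" by (cases x)
    have "\<not> r < c"
    proof
      assume "r < c"
      then have "card (F x) = 1" using D(5)[of r c] x rc by blast
      then show False using x by (auto simp: card_1_singleton_iff)
    qed
    moreover have "(Suc r, c) \<notin> C"
    proof
      assume "(Suc r, c) \<in> C"
      then obtain j where "j \<in> F (Suc r, c)" using D(2) by blast
      then have "j < t" "t \<le> j" using D(7)[of r c t j] D(3)[of "(Suc r, c)"] x rc \<open>(Suc r, c) \<in> C\<close> by auto
      then show False by simp
    qed
    ultimately show "x \<in> strip_ends C ?\<mu>" using x rc by (auto simp: strip_ends_def)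
  qed
  have fil: "(\<lambda>x. F x - {t}) \<in> fillings N (Suc t) ?\<mu>"
    unfolding fillings_def
  proof (rule CollectI, intro conjI allI ballI impI)
    fix x assume "x \<notin> ?\<mu>" then show "F x - {t} = {}" using D(1)[of x] by auto
  next
    fix x assume x: "x \<in> ?\<mu>"
    then obtain i where "i \<in> F x" "t < i" using big by blast
    then show "F x - {t} \<noteq> {}" by auto
    show "F x - {t} \<subseteq> {Suc t..N}" using D(3)[of x] by fastforce
  next
    fix r c assume rc: "(r, c) \<in> ?\<mu> \<and> r < c"
    then have "card (F (r, c)) = 1" using D(5)[of r c] by blast
    then have "t \<notin> F (r, c)" using rc by (auto simp: card_1_singleton_iff)
    then show "card (F (r, c) - {t}) = 1" using \<open>card (F (r, c)) = 1\<close> by simp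
  next
    fix r c assume rc: "(r, c) \<in> ?\<mu> \<and> (r, Suc c) \<in> ?\<mu>"
    show "Max (F (r, Suc c) - {t}) \<le> Max (F (r, c) - {t})"
      unfolding Max_minus[OF conjunct1[OF rc]] Max_minus[OF conjunct2[OF rc]]
      by (rule D(6)) (use rc in auto)
  next
    fix r c i j assume "(r, c) \<in> ?\<mu> \<and> (Suc r, c) \<in> ?\<mu>" "i \<in> F (r, c) - {t}" "j \<in> F (Suc r, c) - {t}"
    then show "j < i" using D(7)[of r c i j] by blast
  qed
  from strip ends fil show ?thesis by (simp add: del_value_def)
qed

lemma add_value_in:
  assumes "t \<le> N" and a: "a \<in> (SIGMA \<mu>:strips C. Pow (strip_ends C \<mu>) \<times> fillings N (Suc t) \<mu>)"
  shows "add_value t C a \<in> fillings N t C" "del_value t C (add_value t C a) = a"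
proof -
  obtain \<mu> E G where A: "a = (\<mu>, E, G)" "\<mu> \<in> strips C" "E \<subseteq> strip_ends C \<mu>" "G \<in> fillings N (Suc t) \<mu>"
    using a by auto
  note D = fillingsD[OF A(4)]
  have S: "\<mu> \<subseteq> C" "\<And>r c. (r, c) \<in> C \<Longrightarrow> (r, Suc c) \<in> \<mu> \<Longrightarrow> (r, c) \<in> \<mu>" "\<And>r c. (r, c) \<in> C \<Longrightarrow> (Suc r, c) \<in> C \<Longrightarrow> (r, c) \<in> \<mu>"
    using A(2) unfolding strips_def by blast+
  have E: "E \<subseteq> \<mu>" "\<And>r c. (r, c) \<in> E \<Longrightarrow> c \<le> r \<and> (Suc r, c) \<notin> C" using A(3) unfolding strip_ends_def by auto
  define F where "F = add_value t C a"
  have F1: "F x = {t}" if "x \<in> C - \<mu>" for x using that by (simp add: F_def add_value_def A(1))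
  have F2: "F x = insert t (G x)" if "x \<in> E" for x using that E S by (auto simp: F_def add_value_def A(1))
  have F3: "F x = G x" if "x \<notin> E" "x \<in> \<mu> \<or> x \<notin> C" for x using that by (auto simp: F_def add_value_def A(1))
  have tG: "t \<notin> G x" for x using D(3)[of x] by auto
  have Gbig: "Suc t \<le> i" if "i \<in> G x" for i x using D(3)[of x] that by auto
  have finF: "finite (F x)" for x
    using F1[of x] F2[of x] F3[of x] D(4)[of x] by (cases "x \<in> E"; cases "x \<in> C - \<mu>") auto
  have FG: "F x \<noteq> {t}" "F x - {t} = G x" "F x \<noteq> {}" "Max (F x) = Max (G x)" if x: "x \<in> \<mu>" for x
  proof -
    have F: "F x = G x \<or> F x = insert t (G x)" using F2 F3 x by blast
    have ne: "G x \<noteq> {}" using D(2) x by blast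
    show "F x \<noteq> {t}" "F x - {t} = G x" "F x \<noteq> {}" using F ne tG[of x] by auto
    have "t \<le> Max (G x)" using Gbig[of "Max (G x)" x] ne D(4)[of x] Max_in by fastforce
    then show "Max (F x) = Max (G x)" using F Max_insert[OF D(4)[of x] ne, of t] by auto
  qed
  have out: "F x = {}" if "x \<notin> C" for x
    using that F3[of x] E(1) S(1) D(1)[of x] by auto
  have sub: "F x \<noteq> {} \<and> F x \<subseteq> {t..N}" if "x \<in> C" for x
  proof (cases "x \<in> \<mu>")
    case True
    have "F x \<subseteq> insert t (G x)" using FG(2)[OF True] by auto
    moreover have "G x \<subseteq> {t..N}" using D(3)[of x] by auto
    ultimately show ?thesis using FG(3)[OF True] \<open>t \<le> N\<close> by fastforce
  qed (use F1 that \<open>t \<le> N\<close> in auto)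
  have "F \<in> fillings N t C"
    unfolding fillings_def
  proof (intro CollectI conjI allI ballI impI)
    fix r c assume rc: "(r, c) \<in> C \<and> r < c"
    then have "(r, c) \<notin> E" using E(2) by force
    then show "card (F (r, c)) = 1"
      using F1[of "(r, c)"] F3[of "(r, c)"] D(5)[of r c] rc by (cases "(r, c) \<in> \<mu>") auto
  next
    fix r c assume rc: "(r, c) \<in> C \<and> (r, Suc c) \<in> C"
    show "Max (F (r, Suc c)) \<le> Max (F (r, c))"
    proof (cases "(r, Suc c) \<in> \<mu>")
      case True
      then have "(r, c) \<in> \<mu>" using S(2) rc by blast
      then show ?thesis using True FG(4) D(6) by simp
    next
      case False
      then have "F (r, Suc c) = {t}" using F1 rc by auto
      moreover have "Max (F (r, c)) \<in> F (r, c)" using sub rc finF by (intro Max_in) auto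
      ultimately show ?thesis using sub[of "(r, c)"] rc by auto
    qed
  next
    fix r c i j assume rc: "(r, c) \<in> C \<and> (Suc r, c) \<in> C" and i: "i \<in> F (r, c)" and j: "j \<in> F (Suc r, c)"
    have m: "(r, c) \<in> \<mu>" using S(3) rc by blast
    have "(r, c) \<notin> E" using E(2) rc by blast
    then have iG: "i \<in> G (r, c)" using F3 m i by auto
    show "j < i"
    proof (cases "j = t")
      case True then show ?thesis using Gbig[OF iG] by simp
    next
      case False
      then have "(Suc r, c) \<in> \<mu>" using F1[of "(Suc r, c)"] j rc by auto
      then show ?thesis using False FG(2)[of "(Suc r, c)"] j iG m D(7) by blast
    qed
  qed (use out sub in auto)
  then show "add_value t C a \<in> fillings N t C" by (simp add: F_def)
  have "{x \<in> C. F x \<noteq> {t}} = \<mu>" using F1 FG(1) S(1) by blast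
  moreover have "{x \<in> C. t \<in> F x \<and> F x \<noteq> {t}} = E"
  proof (intro equalityI subsetI)
    fix x assume x: "x \<in> {x \<in> C. t \<in> F x \<and> F x \<noteq> {t}}"
    then have "x \<in> \<mu>" using F1 by blast
    then show "x \<in> E" using F3[of x] tG[of x] x by auto
  next
    fix x assume "x \<in> E"
    then show "x \<in> {x \<in> C. t \<in> F x \<and> F x \<noteq> {t}}" using F2[of x] FG(1)[of x] E(1) S(1) by auto
  qed
  moreover have "(\<lambda>x. F x - {t}) = G"
  proof
    fix x
    show "F x - {t} = G x"
      using FG(2)[of x] F1[of x] out[of x] D(1)[of x] S(1) by (cases "x \<in> \<mu>"; cases "x \<in> C") auto
  qed
  ultimately show "del_value t C (add_value t C a) = a"
    unfolding F_def[symmetric] by (simp add: del_value_def A(1))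
qed

lemma add_del_value:
  assumes "F \<in> fillings N t C"
  shows "add_value t C (del_value t C F) = F"
proof
  fix x
  show "add_value t C (del_value t C F) x = F x"
    using fillingsD(1)[OF assms, of x] by (auto simp: add_value_def del_value_def)
qed

lemma sum_Pow_power:
  fixes q :: "'a::comm_ring_1"
  assumes "finite A"
  shows "(\<Sum>E\<in>Pow A. q ^ card E) = (1 + q) ^ card A"
  using prod_add[OF assms, of "\<lambda>_. q" "\<lambda>_. 1"] by (simp add: add.commute)

context arrow_params
begin

text \<open>The factor \<open>v ^ ((n + 1) choose 2)\<close> and the weight of the shape are split
  off, so each entry on or below the diagonal counts \<open>1 / v\<close> and the rest is a product
  over cells.\<close>

definition cell_weight :: "(nat \<Rightarrow> 'a) \<Rightarrow> nat \<times> nat \<Rightarrow> nat set \<Rightarrow> 'a" where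
  "cell_weight X x S = (if fst x < snd x then u else (1 / v) ^ card S) * w ^ (card S - 1) * (\<Prod>i\<in>S. X i)"

definition filling_gf :: "(nat \<Rightarrow> 'a) \<Rightarrow> nat \<Rightarrow> nat \<Rightarrow> (nat \<times> nat) set \<Rightarrow> 'a" where
  "filling_gf X N t C = (\<Sum>F\<in>fillings N t C. \<Prod>x\<in>C. cell_weight X x (F x))"

text \<open>The cells of \<open>strip_ends\<close> decide independently whether they also contain
  \<open>t\<close>; this produces the power of \<open>1 + w * X t / v\<close>.\<close>

lemma filling_gf_rec:
  assumes C: "finite C" and t: "t \<le> N"
  shows "filling_gf X N t C = (\<Sum>\<mu>\<in>strips C. (\<Prod>x\<in>C - \<mu>. cell_weight X x {t}) * (1 + w * X t / v) ^ card (strip_ends C \<mu>) * filling_gf X N (Suc t) \<mu>)"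
proof -
  let ?S = "SIGMA \<mu>:strips C. Pow (strip_ends C \<mu>) \<times> fillings N (Suc t) \<mu>"
  \<comment> \<open>The price of adding \<open>t\<close> to a cell with larger values: it is an
    entry without a new cell, hence \<open>w\<close>, and lies on or below the diagonal, hence
    \<open>1 / v\<close>.\<close>
  let ?q = "w * X t / v"
  have finS: "finite (strips C)" by (rule finite_subset[of _ "Pow C"]) (use C in \<open>auto simp: strips_def\<close>)
  have fin\<mu>: "finite \<mu>" "finite (strip_ends C \<mu>)" if "\<mu> \<in> strips C" for \<mu>
  proof -
    show "finite \<mu>" using that C finite_subset by (auto simp: strips_def)
    then show "finite (strip_ends C \<mu>)" by (rule rev_finite_subset) (auto simp: strip_ends_def)
  qed
  have "filling_gf X N t C = (\<Sum>(\<mu>, E, G)\<in>?S. (\<Prod>x\<in>C - \<mu>. cell_weight X x {t}) * ?q ^ card E * (\<Prod>x\<in>\<mu>. cell_weight X x (G x)))"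
    unfolding filling_gf_def
  proof (rule sum.reindex_bij_witness[where i = "add_value t C" and j = "del_value t C"])
    fix F assume F: "F \<in> fillings N t C"
    show "add_value t C (del_value t C F) = F" by (rule add_del_value[OF F])
    show "del_value t C F \<in> ?S" by (rule del_value_in[OF F])
    obtain \<mu> E G where m: "del_value t C F = (\<mu>, E, G)" by (metis prod_cases3)
    have S: "\<mu> \<in> strips C" "E \<subseteq> strip_ends C \<mu>" "G \<in> fillings N (Suc t) \<mu>" using del_value_in[OF F] m by auto
    note D = fillingsD[OF S(3)]
    have E: "E \<subseteq> \<mu>" "\<mu> \<subseteq> C" using S(1,2) by (auto simp: strip_ends_def strips_def)
    have Fx: "F x = (if x \<in> C - \<mu> then {t} else if x \<in> E then insert t (G x) else G x)" for x
      using add_del_value[OF F] m by (auto simp: add_value_def)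
    have "(\<Prod>x\<in>C. cell_weight X x (F x)) = (\<Prod>x\<in>C - \<mu>. cell_weight X x {t}) * (\<Prod>x\<in>\<mu>. cell_weight X x (F x))"
      by (subst prod.subset_diff[OF E(2) C]) (simp add: Fx)
    also have "(\<Prod>x\<in>\<mu>. cell_weight X x (F x)) = (\<Prod>x\<in>\<mu>. (if x \<in> E then ?q else 1) * cell_weight X x (G x))"
    proof (intro prod.cong refl)
      fix x assume x: "x \<in> \<mu>"
      have "cell_weight X x (insert t (G x)) = ?q * cell_weight X x (G x)" if "x \<in> E"
      proof -
        have "snd x \<le> fst x" using that S(2) by (auto simp: strip_ends_def)
        moreover have "t \<notin> G x" using D(3)[of x] by auto
        moreover have "card (G x) > 0" using D(2)[OF x] D(4)[of x] by (simp add: card_gt_0_iff)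
        then have "w ^ card (G x) = w * w ^ (card (G x) - 1)" by (cases "card (G x)") auto
        ultimately show ?thesis using D(4)[of x] by (simp add: cell_weight_def)
      qed
      then show "cell_weight X x (F x) = (if x \<in> E then ?q else 1) * cell_weight X x (G x)"
        using Fx[of x] x by auto
    qed
    also have "\<dots> = ?q ^ card E * (\<Prod>x\<in>\<mu>. cell_weight X x (G x))"
    proof -
      have "(\<Prod>x\<in>\<mu>. if x \<in> E then ?q else 1) = (\<Prod>x\<in>E. ?q)"
        using E(1) fin\<mu>(1)[OF S(1)] by (simp add: prod.If_cases Int_absorb1)
      then show ?thesis by (simp add: prod.distrib)
    qed
    finally show "(\<lambda>(\<mu>, E, G). (\<Prod>x\<in>C - \<mu>. cell_weight X x {t}) * ?q ^ card E * (\<Prod>x\<in>\<mu>. cell_weight X x (G x))) (del_value t C F) = (\<Prod>x\<in>C. cell_weight X x (F x))"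
      by (simp add: m mult_ac)
  qed (use add_value_in[OF t] in auto)
  also have "\<dots> = (\<Sum>\<mu>\<in>strips C. \<Sum>E\<in>Pow (strip_ends C \<mu>). \<Sum>G\<in>fillings N (Suc t) \<mu>. (\<Prod>x\<in>C - \<mu>. cell_weight X x {t}) * ?q ^ card E * (\<Prod>x\<in>\<mu>. cell_weight X x (G x)))"
  proof (subst sum_Sigma')
    show "finite (strips C)" by (rule finS)
    show "finite (Pow (strip_ends C \<mu>) \<times> fillings N (Suc t) \<mu>)" if "\<mu> \<in> strips C" for \<mu>
      using fin\<mu>[OF that] finite_fillings by auto
  qed (rule sum.cong[OF refl], subst sum.cartesian_product, rule sum.cong, auto)
  also have "\<dots> = (\<Sum>\<mu>\<in>strips C. (\<Prod>x\<in>C - \<mu>. cell_weight X x {t}) * (\<Sum>E\<in>Pow (strip_ends C \<mu>). ?q ^ card E) * filling_gf X N (Suc t) \<mu>)"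
    by (simp only: filling_gf_def mult.assoc sum_distrib_left[symmetric] sum_distrib_right[symmetric])
  finally show ?thesis using fin\<mu> by (simp add: sum_Pow_power)
qed

end

section \<open>Horizontal strips in Frobenius coordinates\<close>

text \<open>Hook \<open>i\<close> is indexed from \<open>0\<close> and has its corner at \<open>(i + 1, i + 1)\<close>. Both \<open>A i\<close> and \<open>B i\<close> count the
  corner, so they exceed the Frobenius coordinates by one, and \<open>A i = B i = 0\<close> encodes an absent hook.\<close>

definition hooks :: "nat \<Rightarrow> (nat \<Rightarrow> nat) \<Rightarrow> (nat \<Rightarrow> nat) \<Rightarrow> (nat \<times> nat) set" where
  "hooks l A B = {(r, c). if r < c then 0 < r \<and> r \<le> l \<and> c < r + A (r - 1) else 0 < c \<and> c \<le> l \<and> r < c + B (c - 1)}"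

text \<open>The cell above the end of the next row must remain, so a new arm still exceeds the next
  old arm; only the last hook may vanish. A leg loses at most its lowest cell, hence the two values
  in \<open>leg_range\<close>.\<close>

definition arm_range :: "nat \<Rightarrow> (nat \<Rightarrow> nat) \<Rightarrow> nat \<Rightarrow> nat set" where
  "arm_range l A i = {(if Suc i < l then Suc (A (Suc i)) else 0)..A i}"

definition leg_range :: "(nat \<Rightarrow> nat) \<Rightarrow> nat \<Rightarrow> nat set" where
  "leg_range B j = {B j - 1..B j}"

definition strict_desc :: "nat \<Rightarrow> (nat \<Rightarrow> nat) \<Rightarrow> bool" where
  "strict_desc l A \<longleftrightarrow> (\<forall>i. Suc i < l \<longrightarrow> A (Suc i) < A i)"

text \<open>The leg ranges overlap, so strict descent of the legs has to be imposed, whereas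
  \<open>arm_range\<close> forces it for the arms. A hook can only vanish as a whole.\<close>

definition proper_hooks :: "nat \<Rightarrow> (nat \<Rightarrow> nat) \<Rightarrow> (nat \<Rightarrow> nat) \<Rightarrow> bool" where
  "proper_hooks l A B \<longleftrightarrow> strict_desc l B \<and> (\<forall>i<l. A i = 0 \<longleftrightarrow> B i = 0)"

definition legs :: "(nat \<times> nat) set \<Rightarrow> nat \<Rightarrow> nat" where
  "legs \<mu> i = card {r. Suc i \<le> r \<and> (r, Suc i) \<in> \<mu>}"

definition arms :: "(nat \<times> nat) set \<Rightarrow> nat \<Rightarrow> nat" where
  "arms \<mu> i = (if legs \<mu> i = 0 then 0 else Suc (card {c. Suc i < c \<and> (Suc i, c) \<in> \<mu>}))"

lemma hooks_cong: "(\<And>i. i < l \<Longrightarrow> A i = A' i \<and> B i = B' i) \<Longrightarrow> hooks l A B = hooks l A' B'"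
  unfolding hooks_def by (intro Collect_cong) (auto split: if_splits)

lemma hooks_above: "r < c \<Longrightarrow> (r, c) \<in> hooks l A B \<longleftrightarrow> 0 < r \<and> r \<le> l \<and> c < r + A (r - 1)"
  by (simp add: hooks_def)

lemma hooks_below: "c \<le> r \<Longrightarrow> (r, c) \<in> hooks l A B \<longleftrightarrow> 0 < c \<and> c \<le> l \<and> r < c + B (c - 1)"
  by (simp add: hooks_def)

lemma finite_hooks: "finite (hooks l A B)"
proof (rule finite_subset)
  let ?m = "l + (\<Sum>i<l. A i) + (\<Sum>i<l. B i)"
  have le: "A (i - 1) \<le> (\<Sum>i<l. A i)" "B (i - 1) \<le> (\<Sum>i<l. B i)" if "0 < i" "i \<le> l" for i
    using that by (auto intro!: member_le_sum)
  show "hooks l A B \<subseteq> {..?m} \<times> {..?m}"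
  proof
    fix x assume x: "x \<in> hooks l A B"
    obtain r c where rc: "x = (r, c)" by (cases x)
    show "x \<in> {..?m} \<times> {..?m}"
    proof (cases "r < c")
      case True
      then show ?thesis using x le(1)[of r] unfolding rc hooks_above[OF True] by auto
    next
      case False
      then have "c \<le> r" by simp
      then show ?thesis using x le(2)[of c] unfolding rc hooks_below[OF \<open>c \<le> r\<close>] by auto
    qed
  qed
qed simp

lemma initial_segment:
  fixes S :: "nat set"
  assumes "finite S" "S \<subseteq> {m..}" "\<And>x. m \<le> x \<Longrightarrow> Suc x \<in> S \<Longrightarrow> x \<in> S"
  shows "S = {m..<m + card S}"
proof (cases "S = {}")
  case False
  have "x \<in> S" if "m \<le> x" "x \<le> Max S" for x
    using that(2,1)
  proof (induction rule: inc_induct)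
    case base then show ?case using False assms(1) by simp
  next
    case (step n) then show ?case using assms(3)[of n] by simp
  qed
  then have S: "S = {m..<Suc (Max S)}"
    using assms(1,2) by (auto simp: less_Suc_eq_le)
  have "card S = Suc (Max S) - m" by (subst S) simp
  moreover have "m \<le> Max S" using False assms(1,2) by (meson Max_in atLeast_iff subsetD)
  ultimately have "m + card S = Suc (Max S)" by simp
  then show ?thesis using S by argo
qed simp

lemma legs_hooks: "i < l \<Longrightarrow> legs (hooks l A B) i = B i"
proof -
  assume "i < l"
  then have "{r. Suc i \<le> r \<and> (r, Suc i) \<in> hooks l A B} = {Suc i..<Suc i + B i}" by (auto simp: hooks_def)
  then show ?thesis by (simp add: legs_def)
qed

lemma arms_hooks: "i < l \<Longrightarrow> proper_hooks l A B \<Longrightarrow> arms (hooks l A B) i = A i"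
proof -
  assume i: "i < l" "proper_hooks l A B"
  then have "{c. Suc i < c \<and> (Suc i, c) \<in> hooks l A B} = {Suc (Suc i)..<Suc i + A i}" by (auto simp: hooks_def)
  then show ?thesis using i by (auto simp: arms_def legs_hooks proper_hooks_def)
qed

locale hook_shape =
  fixes l :: nat and A B :: "nat \<Rightarrow> nat"
  assumes A_desc: "strict_desc l A" and B_desc: "strict_desc l B"
    and A_pos: "\<And>i. i < l \<Longrightarrow> 0 < A i" and B_pos: "\<And>i. i < l \<Longrightarrow> 0 < B i"
begin

definition hook_pairs :: "((nat \<Rightarrow> nat) \<times> (nat \<Rightarrow> nat)) set" where
  "hook_pairs = {(A', B'). A' \<in> PiE {0..<l} (arm_range l A) \<and> B' \<in> PiE {0..<l} (leg_range B) \<and> proper_hooks l A' B'}"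

lemma hooks_in_strips:
  assumes "(A', B') \<in> hook_pairs"
  shows "hooks l A' B' \<in> strips (hooks l A B)"
proof -
  have A': "(if Suc i < l then Suc (A (Suc i)) else 0) \<le> A' i" "A' i \<le> A i" if "i < l" for i
    using assms that unfolding hook_pairs_def arm_range_def PiE_def Pi_def by auto
  have B': "B i - 1 \<le> B' i" "B' i \<le> B i" if "i < l" for i
    using assms that unfolding hook_pairs_def leg_range_def PiE_def Pi_def by auto
  have pred_le: "A' (i - 1) \<le> A (i - 1)" "B' (i - 1) \<le> B (i - 1)" if "0 < i" "i \<le> l" for i
    using that A'(2)[of "i - 1"] B'(2)[of "i - 1"] by auto
  have g0: "\<And>i. Suc i < l \<Longrightarrow> B' (Suc i) < B' i" "\<And>i. i < l \<Longrightarrow> A' i = 0 \<longleftrightarrow> B' i = 0"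
    using assms unfolding hook_pairs_def proper_hooks_def strict_desc_def by auto
  have g: "i < l \<Longrightarrow> B' i < B' (i - 1)" "i \<le> l \<Longrightarrow> A' (i - 1) = 0 \<longleftrightarrow> B' (i - 1) = 0"
    "i < l \<Longrightarrow> Suc (A i) \<le> A' (i - 1)" "i \<le> l \<Longrightarrow> B (i - 1) - 1 \<le> B' (i - 1)" if "0 < i" for i
    using that g0(1)[of "i - 1"] g0(2)[of "i - 1"] A'(1)[of "i - 1"] B'(1)[of "i - 1"] by auto
  show ?thesis
    unfolding strips_def
  proof (rule CollectI, intro conjI allI impI)
    show "hooks l A' B' \<subseteq> hooks l A B"
    proof
      fix x assume x: "x \<in> hooks l A' B'"
      obtain r c where rc: "x = (r, c)" by (cases x)
      show "x \<in> hooks l A B"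
        using x pred_le(1)[of r] pred_le(2)[of c] unfolding rc hooks_def by (auto split: if_splits)
    qed
  next
    fix r c assume rc: "(r, c) \<in> hooks l A B \<and> (r, Suc c) \<in> hooks l A' B'"
    consider "r < c" | "r = c" | "c < r" by linarith
    then show "(r, c) \<in> hooks l A' B'"
    proof cases
      case 1 then show ?thesis using rc by (auto simp: hooks_above)
    next
      case 2
      then have "0 < c" "c \<le> l" using rc by (auto simp: hooks_below)
      moreover have "A' (c - 1) \<noteq> 0" using rc 2 by (auto simp: hooks_above)
      ultimately show ?thesis using 2 g(2)[of c] by (auto simp: hooks_below)
    next
      case 3
      then have "0 < c" "c < l" "r < Suc c + B' c" using rc by (auto simp: hooks_below)
      then show ?thesis using 3 g(1)[of c] by (auto simp: hooks_below)
    qed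
  next
    fix r c assume rc: "(r, c) \<in> hooks l A B \<and> (Suc r, c) \<in> hooks l A B"
    consider "Suc r < c" | "Suc r = c" | "c \<le> r" by linarith
    then show "(r, c) \<in> hooks l A' B'"
    proof cases
      case 1
      then have "0 < r" "Suc r \<le> l" "c < Suc r + A r" using rc by (auto simp: hooks_above)
      then show ?thesis using 1 g(3)[of r] by (auto simp: hooks_above)
    next
      case 2
      then have "0 < r" "Suc r \<le> l" using rc by (auto simp: hooks_above hooks_below)
      then show ?thesis using 2 g(3)[of r] A_pos[of r] by (auto simp: hooks_above)
    next
      case 3
      then have "0 < c" "c \<le> l" "Suc r < c + B (c - 1)" using rc by (auto simp: hooks_below)
      then show ?thesis using 3 g(4)[of c] by (auto simp: hooks_below)
    qed
  qed
qed

text \<open>In each column from the diagonal downwards, and in each row to the right of it, the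
  remaining cells form an initial segment, so \<open>\<mu>\<close> is determined by the lengths of
  these segments.\<close>

lemma strips_hooks:
  assumes "\<mu> \<in> strips (hooks l A B)"
  shows "hooks l (arms \<mu>) (legs \<mu>) = \<mu>" "proper_hooks l (arms \<mu>) (legs \<mu>)"
    "\<And>i. i < l \<Longrightarrow> arms \<mu> i \<in> arm_range l A i" "\<And>i. i < l \<Longrightarrow> legs \<mu> i \<in> leg_range B i"
proof -
  have sub: "\<mu> \<subseteq> hooks l A B"
    and row: "\<And>r c. (r, c) \<in> hooks l A B \<Longrightarrow> (r, Suc c) \<in> \<mu> \<Longrightarrow> (r, c) \<in> \<mu>"
    and col: "\<And>r c. (r, c) \<in> hooks l A B \<Longrightarrow> (Suc r, c) \<in> hooks l A B \<Longrightarrow> (r, c) \<in> \<mu>"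
    using assms unfolding strips_def by blast+
  have fin: "finite \<mu>" using finite_subset[OF sub finite_hooks] .
  have Bm: "(r, Suc i) \<in> \<mu> \<longleftrightarrow> r < Suc i + legs \<mu> i" if "i < l" "Suc i \<le> r" for i r
  proof -
    let ?S = "{r. Suc i \<le> r \<and> (r, Suc i) \<in> \<mu>}"
    have fS: "finite ?S" by (rule finite_subset[of _ "fst ` \<mu>"]) (use fin in force)+
    have stepS: "x \<in> ?S" if x: "Suc i \<le> x" "Suc x \<in> ?S" for x
    proof -
      have d: "(Suc x, Suc i) \<in> hooks l A B" using x sub by auto
      then have "(x, Suc i) \<in> hooks l A B" using x by (auto simp: hooks_below)
      then show ?thesis using col[OF _ d] x(1) by blast
    qed
    have "?S = {Suc i..<Suc i + legs \<mu> i}" unfolding legs_def by (rule initial_segment[OF fS _ stepS]) auto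
    from arg_cong[OF this, of "\<lambda>T. r \<in> T"] show ?thesis using that by simp
  qed
  have Am: "(Suc i, c) \<in> \<mu> \<longleftrightarrow> c < Suc i + arms \<mu> i" if i: "i < l" "Suc i < c" for i c
  proof -
    let ?S = "{c. Suc i < c \<and> (Suc i, c) \<in> \<mu>}"
    have fS: "finite ?S" by (rule finite_subset[of _ "snd ` \<mu>"]) (use fin in force)+
    have stepS: "x \<in> ?S" if x: "Suc (Suc i) \<le> x" "Suc x \<in> ?S" for x
    proof -
      have d: "(Suc i, Suc x) \<in> hooks l A B" using x sub by auto
      then have "(Suc i, x) \<in> hooks l A B" using x by (auto simp: hooks_above)
      then show ?thesis using row[of "Suc i" x] x by simp
    qed
    define k where "k = card ?S"
    have S: "?S = {Suc (Suc i)..<Suc (Suc i) + k}" unfolding k_def by (rule initial_segment[OF fS _ stepS]) auto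
    have "?S = {}" if "legs \<mu> i = 0"
    proof (rule ccontr)
      assume "?S \<noteq> {}"
      then have "Suc (Suc i) \<in> ?S" unfolding S by simp
      then have "(Suc i, Suc (Suc i)) \<in> \<mu>" by simp
      moreover have "(Suc i, Suc i) \<in> hooks l A B" using i(1) B_pos by (auto simp: hooks_below)
      ultimately have "(Suc i, Suc i) \<in> \<mu>" using row by blast
      then show False using Bm[of i "Suc i"] i(1) that by simp
    qed
    then have "legs \<mu> i = 0 \<Longrightarrow> (Suc i, c) \<notin> \<mu>" using i(2) by blast
    moreover have "(Suc i, c) \<in> \<mu> \<longleftrightarrow> c < Suc (Suc i) + k"
      using arg_cong[OF S, of "\<lambda>T. c \<in> T"] i(2) by simp
    ultimately have "(Suc i, c) \<in> \<mu> \<longleftrightarrow> legs \<mu> i \<noteq> 0 \<and> c < Suc (Suc i) + k" by blast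
    then show ?thesis using i(2) by (auto simp: arms_def k_def)
  qed
  have Am': "(r, c) \<in> \<mu> \<longleftrightarrow> c < r + arms \<mu> (r - 1)" if "0 < r" "r \<le> l" "r < c" for r c
    using Am[of "r - 1" c] that by simp
  have Bm': "(r, c) \<in> \<mu> \<longleftrightarrow> r < c + legs \<mu> (c - 1)" if "0 < c" "c \<le> l" "c \<le> r" for r c
    using Bm[of "c - 1" r] that by simp
  have "(r, c) \<in> hooks l (arms \<mu>) (legs \<mu>) \<longleftrightarrow> (r, c) \<in> \<mu>" for r c
  proof (cases "r < c")
    case True
    have "0 < r \<and> r \<le> l" if "(r, c) \<in> \<mu>" using that sub hooks_above[OF True] by blast
    then show ?thesis unfolding hooks_above[OF True] using Am' True by blast
  next
    case False
    then have le: "c \<le> r" by simp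
    have "0 < c \<and> c \<le> l" if "(r, c) \<in> \<mu>" using that sub hooks_below[OF le] by blast
    then show ?thesis unfolding hooks_below[OF le] using Bm' le by blast
  qed
  then show "hooks l (arms \<mu>) (legs \<mu>) = \<mu>" by auto
  have Bd: "B (Suc i) < B i" if "Suc i < l" for i using B_desc that unfolding strict_desc_def by blast
  have Bpos: "legs \<mu> i \<noteq> 0" if "Suc i < l" for i
  proof -
    have "2 \<le> B i" using Bd[OF that] B_pos[OF that] by simp
    then have "(Suc i, Suc i) \<in> \<mu>" using that by (intro col) (auto simp: hooks_below)
    then show ?thesis using Bm[of i "Suc i"] that by simp
  qed
  show "proper_hooks l (arms \<mu>) (legs \<mu>)"
    unfolding proper_hooks_def strict_desc_def
  proof (intro conjI allI impI)
    fix i assume i: "Suc i < l"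
    show "legs \<mu> (Suc i) < legs \<mu> i"
    proof (cases "legs \<mu> (Suc i) = 0")
      case True then show ?thesis using Bpos[OF i] by simp
    next
      case False
      \<comment> \<open>The row of the lowest remaining cell in the next column; the cell to its
        left must remain as well.\<close>
      let ?r = "Suc i + legs \<mu> (Suc i)"
      have m: "(?r, Suc (Suc i)) \<in> \<mu>" using Bm[of "Suc i" ?r] i False by simp
      then have "?r < Suc (Suc i) + B (Suc i)" using sub False by (auto simp: hooks_below)
      then have "?r < Suc i + B i" using Bd[OF i] by simp
      then have "(?r, Suc i) \<in> hooks l A B" using i by (auto simp: hooks_below)
      then have "(?r, Suc i) \<in> \<mu>" using row m by blast
      then show ?thesis using Bm[of i ?r] i by simp
    qed
  qed (simp add: arms_def)
  show "legs \<mu> i \<in> leg_range B i" if i: "i < l" for i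
  proof -
    have "legs \<mu> i \<le> B i"
    proof (rule ccontr)
      assume *: "\<not> legs \<mu> i \<le> B i"
      then have "(Suc i + B i, Suc i) \<in> \<mu>" using Bm[of i "Suc i + B i"] i by simp
      then have "(Suc i + B i, Suc i) \<in> hooks l A B" using sub by blast
      then show False by (simp add: hooks_below)
    qed
    moreover have "B i - 1 \<le> legs \<mu> i"
    proof (cases "B i = 1")
      case False
      then have "2 \<le> B i" using B_pos[OF i] by simp
      \<comment> \<open>The last cell but one of its column: it has a cell below it and must
        remain.\<close>
      then have "(i + B i - 1, Suc i) \<in> \<mu>" using i by (intro col) (auto simp: hooks_below)
      moreover have "Suc i \<le> i + B i - 1" using \<open>2 \<le> B i\<close> by linarith
      ultimately have "i + B i - 1 < Suc i + legs \<mu> i" using Bm[OF i] by blast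
      then show ?thesis by linarith
    qed simp
    ultimately show ?thesis by (simp add: leg_range_def)
  qed
  show "arms \<mu> i \<in> arm_range l A i" if i: "i < l" for i
  proof -
    have "arms \<mu> i \<le> A i"
    proof (rule ccontr)
      assume *: "\<not> arms \<mu> i \<le> A i"
      then have "(Suc i, Suc i + A i) \<in> \<mu>" using Am[of i "Suc i + A i"] i A_pos[OF i] by simp
      then have "(Suc i, Suc i + A i) \<in> hooks l A B" using sub by blast
      then show False using A_pos[OF i] by (simp add: hooks_above)
    qed
    moreover have "Suc (A (Suc i)) \<le> arms \<mu> i" if s: "Suc i < l"
    proof -
      \<comment> \<open>The last column of the next row, so the cell of row \<open>Suc i\<close> in
        it has a cell below.\<close>
      let ?c = "Suc i + A (Suc i)"
      have a: "0 < A (Suc i)" "A (Suc i) < A i" "0 < B (Suc i)" using s A_pos B_pos A_desc by (auto simp: strict_desc_def)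
      have "(Suc i, ?c) \<in> hooks l A B" using a i by (simp add: hooks_above)
      moreover have "(Suc (Suc i), ?c) \<in> hooks l A B"
        using a s by (cases "A (Suc i) = 1") (auto simp: hooks_above hooks_below)
      ultimately have "(Suc i, ?c) \<in> \<mu>" using col by blast
      then show ?thesis using Am[of i ?c] i a by simp
    qed
    ultimately show ?thesis by (simp add: arm_range_def)
  qed
qed

lemma sum_strips:
  "(\<Sum>\<mu>\<in>strips (hooks l A B). f \<mu>) = (\<Sum>(A', B')\<in>hook_pairs. f (hooks l A' B'))"
proof (rule sum.reindex_bij_witness[where i = "\<lambda>(A', B'). hooks l A' B'"
      and j = "\<lambda>\<mu>. (restrict (arms \<mu>) {0..<l}, restrict (legs \<mu>) {0..<l})"])
  fix \<mu> assume \<mu>: "\<mu> \<in> strips (hooks l A B)"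
  have 1: "hooks l (restrict (arms \<mu>) {0..<l}) (restrict (legs \<mu>) {0..<l}) = \<mu>"
    using strips_hooks(1)[OF \<mu>] hooks_cong[of l "restrict (arms \<mu>) {0..<l}" "arms \<mu>" "restrict (legs \<mu>) {0..<l}" "legs \<mu>"] by simp
  then show "(case (restrict (arms \<mu>) {0..<l}, restrict (legs \<mu>) {0..<l}) of (A', B') \<Rightarrow> hooks l A' B') = \<mu>" by simp
  show "(restrict (arms \<mu>) {0..<l}, restrict (legs \<mu>) {0..<l}) \<in> hook_pairs"
    using strips_hooks(2-4)[OF \<mu>] unfolding hook_pairs_def proper_hooks_def strict_desc_def by auto
  show "(case (restrict (arms \<mu>) {0..<l}, restrict (legs \<mu>) {0..<l}) of (A', B') \<Rightarrow> f (hooks l A' B')) = f \<mu>"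
    using 1 by simp
next
  fix b assume b: "b \<in> hook_pairs"
  obtain A' B' where B: "b = (A', B')" by (cases b)
  show "(case b of (A', B') \<Rightarrow> hooks l A' B') \<in> strips (hooks l A B)" using hooks_in_strips b B by simp
  have g: "proper_hooks l A' B'" and P: "A' \<in> PiE {0..<l} (arm_range l A)" "B' \<in> PiE {0..<l} (leg_range B)" using b B by (auto simp: hook_pairs_def)
  have "restrict (arms (hooks l A' B')) {0..<l} = A'" "restrict (legs (hooks l A' B')) {0..<l} = B'"
    using P g by (auto simp: fun_eq_iff arms_hooks legs_hooks PiE_def extensional_def)
  then show "(restrict (arms (case b of (A', B') \<Rightarrow> hooks l A' B')) {0..<l}, restrict (legs (case b of (A', B') \<Rightarrow> hooks l A' B')) {0..<l}) = b"
    using B by simp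
qed

end

section \<open>The Giambelli formula\<close>

lemma det_zero_col:
  assumes "j < n" "\<And>i. i < n \<Longrightarrow> f i j = 0"
  shows "det (mat n n (\<lambda>(i, j). f i j)) = (0 :: 'a :: comm_ring_1)"
  using det_zero_row[OF assms(1), of "\<lambda>j i. f i j"] assms(2) det_mat_swap[of n f] by simp

lemma strict_desc_antimono:
  assumes "strict_desc l B" "j \<le> i" "i < l"
  shows "B i \<le> B j"
  using assms(2,3)
proof (induction rule: dec_induct)
  case (step n)
  then have "B (Suc n) < B n" using assms(1) by (simp add: strict_desc_def)
  then show ?case using step by simp
qed simp

lemma hooks_Diff:
  assumes A: "\<And>i. i < l \<Longrightarrow> A' i \<le> A i \<and> 0 < A i" and B: "\<And>i. i < l \<Longrightarrow> B' i \<le> B i"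
  shows "hooks l A B - hooks l A' B' =
    (\<lambda>(i, c). (Suc i, c)) ` (SIGMA i:{0..<l}. {Suc i + max 1 (A' i)..<Suc i + A i}) \<union>
    (\<lambda>(i, r). (r, Suc i)) ` (SIGMA i:{0..<l}. {Suc i + B' i..<Suc i + B i})" (is "?L = ?U \<union> ?V")
proof -
  have "(r, c) \<in> ?L \<longleftrightarrow> (r, c) \<in> ?U \<union> ?V" for r c
  proof (cases "r < c")
    case True
    have "(r, c) \<notin> ?V" using True by auto
    moreover have "(r, c) \<in> ?U \<longleftrightarrow> (\<exists>i. r = Suc i \<and> i < l \<and> Suc i + max 1 (A' i) \<le> c \<and> c < Suc i + A i)" by (auto simp: image_iff)
    ultimately show ?thesis using True by (cases r) (auto simp: hooks_above)
  next
    case False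
    have "(r, c) \<notin> ?U" using False by auto
    moreover have "(r, c) \<in> ?V \<longleftrightarrow> (\<exists>i. c = Suc i \<and> i < l \<and> Suc i + B' i \<le> r \<and> r < Suc i + B i)" by (auto simp: image_iff)
    ultimately show ?thesis using False by (cases c) (auto simp: hooks_below)
  qed
  then show ?thesis unfolding set_eq_iff split_paired_All by blast
qed

text \<open>A remaining cell with no cell of the old shape below it is the old bottom of its column,
  so exactly the legs that kept their length contribute, one cell each.\<close>

lemma strip_ends_hooks:
  assumes B: "\<And>i. i < l \<Longrightarrow> B' i \<le> B i \<and> 0 < B i"
  shows "strip_ends (hooks l A B) (hooks l A' B') = (\<lambda>i. (i + B' i, Suc i)) ` {i\<in>{0..<l}. B' i = B i}"
proof -
  have "(r, c) \<in> strip_ends (hooks l A B) (hooks l A' B') \<longleftrightarrow> (r, c) \<in> (\<lambda>i. (i + B' i, Suc i)) ` {i\<in>{0..<l}. B' i = B i}" for r c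
  proof (cases c)
    case 0
    then show ?thesis by (auto simp: strip_ends_def hooks_below)
  next
    case (Suc i)
    have "(r, c) \<in> strip_ends (hooks l A B) (hooks l A' B') \<longleftrightarrow> c \<le> r \<and> i < l \<and> r < Suc i + B' i \<and> \<not> Suc r < Suc i + B i"
      unfolding strip_ends_def using Suc by (auto simp: hooks_below)
    also have "\<dots> \<longleftrightarrow> i < l \<and> B' i = B i \<and> r = i + B' i" using Suc B[of i] by auto
    finally show ?thesis using Suc by (auto simp: image_iff)
  qed
  then show ?thesis unfolding set_eq_iff split_paired_All by blast
qed

context arrow_params
begin

text \<open>The weight of a strip separates into one factor per arm and one per leg, which matches
  an expansion of a determinant in its rows and columns.\<close>

lemma strip_weight:
  assumes A: "\<And>i. i < l \<Longrightarrow> A' i \<le> A i \<and> 0 < A i" and B: "\<And>i. i < l \<Longrightarrow> B' i \<in> leg_range B i \<and> 0 < B i"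
  shows "(\<Prod>y\<in>hooks l A B - hooks l A' B'. cell_weight X y {t}) * (1 + w * X t / v) ^ card (strip_ends (hooks l A B) (hooks l A' B')) =
    (\<Prod>i\<in>{0..<l}. (u * X t) ^ (A i - max 1 (A' i))) * (\<Prod>j\<in>{0..<l}. if B' j = B j then 1 + w * X t / v else X t / v)"
proof -
  have B': "B' i \<le> B i" "B i - 1 \<le> B' i" "0 < B i" if "i < l" for i using B[OF that] by (auto simp: leg_range_def)
  let ?U = "(\<lambda>(i, c). (Suc i, c)) ` (SIGMA i:{0..<l}. {Suc i + max 1 (A' i)..<Suc i + A i})"
  let ?V = "(\<lambda>(i, r). (r, Suc i)) ` (SIGMA i:{0..<l}. {Suc i + B' i..<Suc i + B i})"
  have "(\<Prod>y\<in>hooks l A B - hooks l A' B'. cell_weight X y {t}) = (\<Prod>y\<in>?U. cell_weight X y {t}) * (\<Prod>y\<in>?V. cell_weight X y {t})"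
  proof -
    have "hooks l A B - hooks l A' B' = ?U \<union> ?V" by (rule hooks_Diff) (use A B'(1) in auto)
    then show ?thesis by (simp only:) (rule prod.union_disjoint, auto)
  qed
  also have "(\<Prod>y\<in>?U. cell_weight X y {t}) = (\<Prod>x\<in>(SIGMA i:{0..<l}. {Suc i + max 1 (A' i)..<Suc i + A i}). u * X t)"
    by (subst prod.reindex, force simp: inj_on_def, rule prod.cong[OF refl], auto simp: cell_weight_def)
  also have "\<dots> = (\<Prod>i\<in>{0..<l}. (u * X t) ^ (A i - max 1 (A' i)))" by (simp add: power_sum)
  also have "(\<Prod>y\<in>?V. cell_weight X y {t}) = (\<Prod>x\<in>(SIGMA i:{0..<l}. {Suc i + B' i..<Suc i + B i}). X t / v)"
    by (subst prod.reindex, force simp: inj_on_def, rule prod.cong[OF refl], auto simp: cell_weight_def)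
  also have "\<dots> = (\<Prod>i\<in>{0..<l}. (X t / v) ^ (B i - B' i))" by (simp add: power_sum)
  finally have 1: "(\<Prod>y\<in>hooks l A B - hooks l A' B'. cell_weight X y {t}) = (\<Prod>i\<in>{0..<l}. (u * X t) ^ (A i - max 1 (A' i))) * (\<Prod>i\<in>{0..<l}. (X t / v) ^ (B i - B' i))" .
  have "card (strip_ends (hooks l A B) (hooks l A' B')) = card {i\<in>{0..<l}. B' i = B i}"
    by (subst strip_ends_hooks) (use B' in \<open>auto intro!: card_image simp: inj_on_def\<close>)
  then have 2: "(1 + w * X t / v) ^ card (strip_ends (hooks l A B) (hooks l A' B')) = (\<Prod>i\<in>{0..<l}. if B' i = B i then 1 + w * X t / v else 1)"
    by (simp add: prod.If_cases Int_def)
  have "(\<Prod>i\<in>{0..<l}. (X t / v) ^ (B i - B' i)) * (\<Prod>i\<in>{0..<l}. if B' i = B i then 1 + w * X t / v else 1)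
     = (\<Prod>j\<in>{0..<l}. if B' j = B j then 1 + w * X t / v else X t / v)"
    unfolding prod.distrib[symmetric]
  proof (intro prod.cong refl)
    fix i assume "i \<in> {0..<l}"
    then have "B' i = B i \<or> B i - B' i = 1" using B'[of i] by auto
    then show "(X t / v) ^ (B i - B' i) * (if B' i = B i then 1 + w * X t / v else 1) = (if B' i = B i then 1 + w * X t / v else X t / v)"
      by auto
  qed
  then show ?thesis unfolding 1 2 by (simp only: mult.assoc)
qed

text \<open>The first variable of the list belongs to the smallest value. The exponent \<open>a - max 1 a'\<close> leaves out
  the corner cell when the whole hook is new (\<open>a' = 0\<close>), as that cell is weighted with the leg.\<close>

fun hook_gf :: "'a list \<Rightarrow> nat \<Rightarrow> nat \<Rightarrow> 'a" where
  "hook_gf [] a b = (if a = 0 \<and> b = 0 then 1 else 0)"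
| "hook_gf (x # xs) a b = (if a = 0 \<or> b = 0 then (if a = 0 \<and> b = 0 then 1 else 0)
     else (\<Sum>a'\<le>a. (u * x) ^ (a - max 1 a') * ((1 + w * x / v) * hook_gf xs a' b + x / v * hook_gf xs a' (b - 1))))"

lemma hook_gf_0: "hook_gf xs 0 b = (if b = 0 then 1 else 0)" "hook_gf xs a 0 = (if a = 0 then 1 else 0)"
  by (cases xs; simp)+

lemma (in hook_shape) PiE_bounds:
  assumes "A' \<in> PiE {0..<l} (arm_range l A)" "B' \<in> PiE {0..<l} (leg_range B)"
  shows "i < l \<Longrightarrow> A' i \<le> A i" "Suc i < l \<Longrightarrow> A (Suc i) < A' i" "i < l \<Longrightarrow> B' i \<le> B i" "i < l \<Longrightarrow> B i - 1 \<le> B' i"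
    "Suc i < l \<Longrightarrow> B' (Suc i) \<le> B' i"
proof -
  have A': "A' i \<in> arm_range l A i" and B': "B' i \<in> leg_range B i" if "i < l" for i using assms that by auto
  show "i < l \<Longrightarrow> A' i \<le> A i" "Suc i < l \<Longrightarrow> A (Suc i) < A' i" using A'[of i] by (auto simp: arm_range_def)
  show B: "i < l \<Longrightarrow> B' i \<le> B i" "i < l \<Longrightarrow> B i - 1 \<le> B' i" for i using B'[of i] by (auto simp: leg_range_def)
  show "B' (Suc i) \<le> B' i" if "Suc i < l"
  proof -
    have "B (Suc i) < B i" using B_desc that by (simp add: strict_desc_def)
    then show ?thesis using B(1)[of "Suc i"] B(2)[of i] that by simp
  qed
qed

text \<open>Ranges of arms and legs that do not come from a shape contribute zero, which makes it possible to
  sum over all of them independently.\<close>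

lemma det_hook_gf_improper:
  assumes s: "hook_shape l A B" and A': "A' \<in> PiE {0..<l} (arm_range l A)" and B': "B' \<in> PiE {0..<l} (leg_range B)"
    and ng: "\<not> proper_hooks l A' B'"
  shows "det (mat l l (\<lambda>(i, j). hook_gf xs (A' i) (B' j))) = 0"
proof -
  interpret hook_shape l A B by fact
  note b = PiE_bounds[OF A' B']
  show ?thesis
  proof (cases "strict_desc l B'")
    case False
    then obtain i where i: "Suc i < l" "\<not> B' (Suc i) < B' i" by (auto simp: strict_desc_def)
    then have "B' (Suc i) = B' i" using b(5) by (simp add: order_antisym)
    then show ?thesis using det_equal_cols[of i l "Suc i" "\<lambda>i j. hook_gf xs (A' i) (B' j)"] i by simp
  next
    case True
    then obtain i where i: "i < l" "(A' i = 0) \<noteq> (B' i = 0)" using ng by (auto simp: proper_hooks_def)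
    \<comment> \<open>Only the last hook can be absent: before it, \<open>arm_range\<close> forces a
      positive arm and strict descent a positive leg. The mismatch therefore sits at the last index
      and produces a zero row or a zero column.\<close>
    have last: "j \<le> i" if "j < l" for j
    proof (rule ccontr)
      assume "\<not> j \<le> i"
      then have "Suc i < l" using that by simp
      then have "A' i \<noteq> 0" "B' i \<noteq> 0" using b(2) True by (fastforce simp: strict_desc_def)+
      then show False using i by simp
    qed
    show ?thesis
    proof (cases "A' i = 0")
      case True
      have "B' j \<noteq> 0" if "j < l" for j
        using strict_desc_antimono[OF \<open>strict_desc l B'\<close> last[OF that] i(1)] i True by auto
      then show ?thesis using det_zero_row[of i l "\<lambda>i j. hook_gf xs (A' i) (B' j)"] i True by (simp add: hook_gf_0)
    next
      case False
      have "A' j \<noteq> 0" if "j < l" for j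
      proof (cases "j = i")
        case False
        then have "Suc j < l" using last[OF that] i(1) by simp
        then show ?thesis using b(2) by fastforce
      qed (use \<open>A' i \<noteq> 0\<close> in simp)
      then show ?thesis using det_zero_col[of i l "\<lambda>i j. hook_gf xs (A' i) (B' j)"] i False by (simp add: hook_gf_0)
    qed
  qed
qed

text \<open>In \<open>hook_gf\<close> the new arm runs over all values up to \<open>A i\<close>.
  Subtracting a multiple of the next row removes those up to \<open>A (Suc i)\<close> and leaves
  \<open>arm_range\<close>; after expansion in rows and columns the improper pairs drop out.\<close>

lemma det_hook_gf_Cons:
  assumes s: "hook_shape l A B"
  shows "det (mat l l (\<lambda>(i, j). hook_gf (x # xs) (A i) (B j))) =
    (\<Sum>(A', B')\<in>hook_shape.hook_pairs l A B. (\<Prod>i\<in>{0..<l}. (u * x) ^ (A i - max 1 (A' i))) *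
       (\<Prod>j\<in>{0..<l}. if B' j = B j then 1 + w * x / v else x / v) * det (mat l l (\<lambda>(i, j). hook_gf xs (A' i) (B' j))))"
proof -
  interpret hook_shape l A B by fact
  define F where "F i a = (u * x) ^ (A i - max 1 a)" for i a
  define E where "E j b = (if b = B j then 1 + w * x / v else x / v)" for j b
  define T where "T a j = (\<Sum>b\<in>leg_range B j. E j b * hook_gf xs a b)" for a j
  have T: "T a j = (1 + w * x / v) * hook_gf xs a (B j) + x / v * hook_gf xs a (B j - 1)" if "j < l" for a j
  proof -
    have "leg_range B j = {B j - 1, B j}" "B j - 1 \<noteq> B j" using B_pos[OF that] by (auto simp: leg_range_def)
    then show ?thesis unfolding T_def E_def by (simp add: add.commute)
  qed
  have hook_gf: "hook_gf (x # xs) (A i) (B j) = (\<Sum>a\<le>A i. F i a * T a j)" if "i < l" "j < l" for i j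
    unfolding T[OF that(2)] F_def using A_pos[OF that(1)] B_pos[OF that(2)] by simp
  have H: "hook_gf (x # xs) (A i) (B j) - (if Suc i < l then (u * x) ^ (A i - A (Suc i)) * hook_gf (x # xs) (A (Suc i)) (B j) else 0)
      = (\<Sum>a\<in>arm_range l A i. F i a * T a j)" if ij: "i < l" "j < l" for i j
  proof (cases "Suc i < l")
    case True
    have lt: "A (Suc i) < A i" using A_desc True by (simp add: strict_desc_def)
    \<comment> \<open>With this multiplier the two rows agree term by term for the arms they share.
      The exponents add up because \<open>A (Suc i)\<close> is at least \<open>1\<close>.\<close>
    have "F i a = (u * x) ^ (A i - A (Suc i)) * F (Suc i) a" if "a \<le> A (Suc i)" for a
    proof -
      have "A i - max 1 a = (A i - A (Suc i)) + (A (Suc i) - max 1 a)" using that lt A_pos[OF True] by auto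
      then show ?thesis by (simp add: F_def power_add)
    qed
    then have "(u * x) ^ (A i - A (Suc i)) * hook_gf (x # xs) (A (Suc i)) (B j) = (\<Sum>a\<le>A (Suc i). F i a * T a j)"
      unfolding hook_gf[OF True ij(2)] sum_distrib_left by (intro sum.cong) (auto simp: mult.assoc)
    moreover have "{..A i} = {..A (Suc i)} \<union> arm_range l A i" "{..A (Suc i)} \<inter> arm_range l A i = {}" "finite (arm_range l A i)"
      using lt True by (auto simp: arm_range_def)
    ultimately show ?thesis using True unfolding hook_gf[OF ij] by (simp add: sum.union_disjoint)
  next
    case False
    then have "arm_range l A i = {..A i}" by (auto simp: arm_range_def)
    then show ?thesis unfolding hook_gf[OF ij] using False by simp
  qed
  let ?W = "\<lambda>A' B'. (\<Prod>i\<in>{0..<l}. F i (A' i)) * (\<Prod>j\<in>{0..<l}. E j (B' j)) * det (mat l l (\<lambda>(i, j). hook_gf xs (A' i) (B' j)))"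
  have "det (mat l l (\<lambda>(i, j). hook_gf (x # xs) (A i) (B j)))
      = det (mat l l (\<lambda>(i, j). hook_gf (x # xs) (A i) (B j) - (if Suc i < l then (u * x) ^ (A i - A (Suc i)) * hook_gf (x # xs) (A (Suc i)) (B j) else 0)))"
    by (rule det_sub_next_row[symmetric, of l "\<lambda>i j. hook_gf (x # xs) (A i) (B j)" "\<lambda>i. (u * x) ^ (A i - A (Suc i))"])
  also have "\<dots> = det (mat l l (\<lambda>(i, j). \<Sum>a\<in>arm_range l A i. F i a * T a j))"
    by (intro arg_cong[where f = det] eq_matI) (auto simp: H simp del: hook_gf.simps)
  also have "\<dots> = (\<Sum>A'\<in>PiE {0..<l} (arm_range l A). (\<Prod>i\<in>{0..<l}. F i (A' i)) * det (mat l l (\<lambda>(i, j). T (A' i) j)))"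
    by (rule det_rows_sum) (simp add: arm_range_def)
  also have "\<dots> = (\<Sum>A'\<in>PiE {0..<l} (arm_range l A). \<Sum>B'\<in>PiE {0..<l} (leg_range B). ?W A' B')"
    unfolding T_def by (subst det_cols_sum) (simp_all add: leg_range_def sum_distrib_left mult.assoc)
  also have "\<dots> = (\<Sum>(A', B')\<in>PiE {0..<l} (arm_range l A) \<times> PiE {0..<l} (leg_range B). ?W A' B')"
    by (rule sum.cartesian_product)
  also have "\<dots> = (\<Sum>(A', B')\<in>hook_pairs. ?W A' B')"
  proof (rule sum.mono_neutral_right)
    show "finite (PiE {0..<l} (arm_range l A) \<times> PiE {0..<l} (leg_range B))"
      by (intro finite_cartesian_product finite_PiE) (auto simp: arm_range_def leg_range_def)
    show "hook_pairs \<subseteq> PiE {0..<l} (arm_range l A) \<times> PiE {0..<l} (leg_range B)" by (auto simp: hook_pairs_def)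
    show "\<forall>y\<in>PiE {0..<l} (arm_range l A) \<times> PiE {0..<l} (leg_range B) - hook_pairs. (case y of (A', B') \<Rightarrow> ?W A' B') = 0"
    proof
      fix y assume y: "y \<in> PiE {0..<l} (arm_range l A) \<times> PiE {0..<l} (leg_range B) - hook_pairs"
      obtain A' B' where Y: "y = (A', B')" by (cases y)
      then have "A' \<in> PiE {0..<l} (arm_range l A)" "B' \<in> PiE {0..<l} (leg_range B)" "\<not> proper_hooks l A' B'" using y by (auto simp: hook_pairs_def)
      then show "(case y of (A', B') \<Rightarrow> ?W A' B') = 0" using det_hook_gf_improper[OF s] Y by simp
    qed
  qed
  finally show ?thesis unfolding F_def E_def .
qed

text \<open>Both sides obey the same recursion in the smallest value, so the induction runs
  downwards in \<open>t\<close>. For \<open>l = 1\<close> the statement identifies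
  \<open>hook_gf\<close> as the generating function of a single hook.\<close>

theorem filling_gf_eq_det:
  assumes "t \<le> Suc N" "hook_shape l A B"
  shows "filling_gf X N t (hooks l A B) = det (mat l l (\<lambda>(i, j). hook_gf (map X [t..<Suc N]) (A i) (B j)))"
  using assms
proof (induction arbitrary: l A B rule: inc_induct)
  case base
  interpret hook_shape l A B by fact
  show ?case
  proof (cases "l = 0")
    case True
    then have "hooks l A B = {}" by (auto simp: hooks_def)
    moreover have "fillings N (Suc N) {} = {\<lambda>_. {}}" by (auto simp: fillings_def fun_eq_iff)
    ultimately show ?thesis using True by (simp add: filling_gf_def)
  next
    case False
    then have "(1, 1) \<in> hooks l A B" using B_pos[of 0] by (simp add: hooks_below)
    then have "fillings N (Suc N) (hooks l A B) = {}" using fillingsD(2,3)[of _ N "Suc N" "hooks l A B" "(1, 1)"] by fastforce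
    moreover have "det (mat l l (\<lambda>(i, j). hook_gf [] (A i) (B j))) = 0"
      using det_zero_row[of 0 l "\<lambda>i j. hook_gf [] (A i) (B j)"] False A_pos[of 0] by simp
    ultimately show ?thesis by (simp add: filling_gf_def)
  qed
next
  case (step t)
  interpret hook_shape l A B by fact
  let ?xs = "map X [Suc t..<Suc N]"
  have xs: "map X [t..<Suc N] = X t # ?xs" using step.hyps by (simp add: upt_conv_Cons del: upt_Suc)
  have IH: "filling_gf X N (Suc t) (hooks l A' B') = det (mat l l (\<lambda>(i, j). hook_gf ?xs (A' i) (B' j)))" if "(A', B') \<in> hook_pairs" for A' B'
  proof -
    have P: "A' \<in> PiE {0..<l} (arm_range l A)" "B' \<in> PiE {0..<l} (leg_range B)" and g: "proper_hooks l A' B'" using that by (auto simp: hook_pairs_def)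
    note b = PiE_bounds[OF P]
    have Ad: "strict_desc l A'" unfolding strict_desc_def using b(1,2) by (meson le_less_trans)
    have Bd: "strict_desc l B'" using g by (simp add: proper_hooks_def)
    show ?thesis
    proof (cases "l = 0 \<or> B' (l - 1) \<noteq> 0")
      case True
      have "B' i \<noteq> 0" if "i < l" for i
      proof -
        have "i \<le> l - 1" "l - 1 < l" using that by simp_all
        then show ?thesis using strict_desc_antimono[OF Bd] True that by fastforce
      qed
      moreover from this have "A' i \<noteq> 0" if "i < l" for i
        using g that by (simp add: proper_hooks_def)
      ultimately have "hook_shape l A' B'"
        using Ad Bd by unfold_locales auto
      then show ?thesis by (rule step.IH)
    next
      case False
      \<comment> \<open>The last hook has been used up. Its row of the matrix is
        \<open>(0, ..., 0, 1)\<close>, so the determinant reduces to the first \<open>m\<close>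
        hooks, which form a shape again.\<close>
      then obtain m where m: "l = Suc m" "B' m = 0" by (cases l) auto
      have A0: "A' m = 0" using g m by (simp add: proper_hooks_def)
      have pos: "B' i \<noteq> 0" if "i < m" for i
        using Bd that m unfolding strict_desc_def by (metis Suc_less_eq gr_implies_not0)
      then have "A' i \<noteq> 0" if "i < m" for i using g that m unfolding proper_hooks_def by auto
      with pos have s': "hook_shape m A' B'"
        using Ad Bd m by unfold_locales (auto simp: strict_desc_def)
      have "(r, c) \<in> hooks l A' B' \<longleftrightarrow> (r, c) \<in> hooks m A' B'" for r c
        using m A0 by (auto simp: hooks_def le_Suc_eq)
      then have "hooks l A' B' = hooks m A' B'" by auto
      moreover have "det (mat l l (\<lambda>(i, j). hook_gf ?xs (A' i) (B' j))) = det (mat m m (\<lambda>(i, j). hook_gf ?xs (A' i) (B' j)))"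
      proof -
        have "det (mat l l (\<lambda>(i, j). hook_gf ?xs (A' i) (B' j))) = (\<Sum>j\<le>m. hook_gf ?xs (A' m) (B' j) *
            ((-1) ^ (m + j) * det (mat m m (\<lambda>(i, k). hook_gf ?xs (A' (skip m i)) (B' (skip j k))))))"
          unfolding m(1) by (rule laplace_row) simp
        also have "\<dots> = (\<Sum>j\<le>m. if j = m then det (mat m m (\<lambda>(i, k). hook_gf ?xs (A' (skip m i)) (B' (skip m k)))) else 0)"
        proof (intro sum.cong refl)
          fix j assume j: "j \<in> {..m}"
          have "hook_gf ?xs 0 (B' j) = (if j = m then 1 else 0)"
            using j pos[of j] m(2) by (cases "j = m") (auto simp: hook_gf_0(1))
          then show "hook_gf ?xs (A' m) (B' j) * ((-1) ^ (m + j) * det (mat m m (\<lambda>(i, k). hook_gf ?xs (A' (skip m i)) (B' (skip j k)))))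
            = (if j = m then det (mat m m (\<lambda>(i, k). hook_gf ?xs (A' (skip m i)) (B' (skip m k)))) else 0)"
            by (simp add: A0 del: upt_Suc)
        qed
        also have "\<dots> = det (mat m m (\<lambda>(i, k). hook_gf ?xs (A' (skip m i)) (B' (skip m k))))" by simp
        also have "mat m m (\<lambda>(i, k). hook_gf ?xs (A' (skip m i)) (B' (skip m k))) = mat m m (\<lambda>(i, j). hook_gf ?xs (A' i) (B' j))"
          by (rule eq_matI) (auto simp: skip_def)
        finally show ?thesis .
      qed
      ultimately show ?thesis using step.IH[OF s'] by simp
    qed
  qed
  have "filling_gf X N t (hooks l A B) = (\<Sum>(A', B')\<in>hook_pairs. (\<Prod>y\<in>hooks l A B - hooks l A' B'. cell_weight X y {t}) *
      (1 + w * X t / v) ^ card (strip_ends (hooks l A B) (hooks l A' B')) * filling_gf X N (Suc t) (hooks l A' B'))"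
    using step.hyps by (simp add: filling_gf_rec[OF finite_hooks] sum_strips)
  also have "\<dots> = (\<Sum>(A', B')\<in>hook_pairs. (\<Prod>i\<in>{0..<l}. (u * X t) ^ (A i - max 1 (A' i))) *
       (\<Prod>j\<in>{0..<l}. if B' j = B j then 1 + w * X t / v else X t / v) * det (mat l l (\<lambda>(i, j). hook_gf ?xs (A' i) (B' j))))"
  proof (intro sum.cong refl, clarify)
    fix A' B' assume AB: "(A', B') \<in> hook_pairs"
    then have P: "A' \<in> PiE {0..<l} (arm_range l A)" "B' \<in> PiE {0..<l} (leg_range B)" by (auto simp: hook_pairs_def)
    have "(\<Prod>y\<in>hooks l A B - hooks l A' B'. cell_weight X y {t}) * (1 + w * X t / v) ^ card (strip_ends (hooks l A B) (hooks l A' B')) =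
      (\<Prod>i\<in>{0..<l}. (u * X t) ^ (A i - max 1 (A' i))) * (\<Prod>j\<in>{0..<l}. if B' j = B j then 1 + w * X t / v else X t / v)"
      by (rule strip_weight) (use PiE_bounds(1)[OF P] P A_pos B_pos in auto)
    then show "(\<Prod>y\<in>hooks l A B - hooks l A' B'. cell_weight X y {t}) * (1 + w * X t / v) ^ card (strip_ends (hooks l A B) (hooks l A' B')) * filling_gf X N (Suc t) (hooks l A' B') =
      (\<Prod>i\<in>{0..<l}. (u * X t) ^ (A i - max 1 (A' i))) * (\<Prod>j\<in>{0..<l}. if B' j = B j then 1 + w * X t / v else X t / v) * det (mat l l (\<lambda>(i, j). hook_gf ?xs (A' i) (B' j)))"
      using IH[OF AB] by simp
  qed
  also have "\<dots> = det (mat l l (\<lambda>(i, j). hook_gf (map X [t..<Suc N]) (A i) (B j)))"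
    unfolding xs by (rule det_hook_gf_Cons[OF step.prems, symmetric])
  finally show ?case .
qed

end

section \<open>Summation over near-balanced shapes\<close>

lemma det_col_scale:
  fixes f :: "nat \<Rightarrow> nat \<Rightarrow> 'a::comm_ring_1"
  shows "det (mat n n (\<lambda>(i, j). s j * f i j)) = (\<Prod>j<n. s j) * det (mat n n (\<lambda>(i, j). f i j))"
proof -
  have "(\<Prod>i\<in>{0..<n}. s (p i)) = (\<Prod>j<n. s j)" if "p permutes {0..<n}" for p
    using prod.permute[OF that, of s] by (simp add: o_def lessThan_atLeast0)
  then show ?thesis by (simp add: det_mat prod.distrib sum_distrib_left mult_ac)
qed

text \<open>The sign is left unspecified: it will occur on both sides of an equation and only has to
  be invertible. The reversal mediates between descending Frobenius coordinates and ascending rows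
  of alternants.\<close>

lemma det_reverse_rows:
  "\<exists>s :: 'a::comm_ring_1. s * s = 1 \<and> (\<forall>f :: nat \<Rightarrow> nat \<Rightarrow> 'a. det (mat n n (\<lambda>(i, j). f (n - 1 - i) j)) = s * det (mat n n (\<lambda>(i, j). f i j)))"
proof -
  define p where "p i = (if i < n then n - 1 - i else i)" for i
  have "p permutes {0..<n}"
    by (rule bij_imp_permutes[OF bij_betw_byWitness[where f' = p]]) (auto simp: p_def)
  then have "det (mat n n (\<lambda>(i, j). mat n n (\<lambda>(i, j). f i j) $$ (p i, j))) = signof p * det (mat n n (\<lambda>(i, j). f i j))" for f :: "nat \<Rightarrow> nat \<Rightarrow> 'a"
    by (intro det_permute_rows) auto
  moreover have "mat n n (\<lambda>(i, j). mat n n (\<lambda>(i, j). f i j) $$ (p i, j)) = mat n n (\<lambda>(i, j). f (n - 1 - i) j)" for f :: "nat \<Rightarrow> nat \<Rightarrow> 'a"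
    by (rule eq_matI) (auto simp: p_def)
  moreover have "signof p * signof p = (1 :: 'a)" by (simp add: sign_def)
  ultimately show ?thesis by metis
qed

text \<open>Matches the possible leg sequences with the index lists of the principal minors in
  \<open>det_identity_plus\<close>.\<close>

lemma set_subseqs_rev_upt:
  "set (subseqs (rev [0..<n])) = {b. sorted_wrt (>) b \<and> set b \<subseteq> {..<n}}"
proof (induction n)
  case (Suc n)
  let ?S = "\<lambda>n. {b. sorted_wrt (>) b \<and> set b \<subseteq> {..<n :: nat}}"
  have "b \<in> (#) n ` ?S n \<union> ?S n" if b: "sorted_wrt (>) b" "set b \<subseteq> {..<Suc n}" for b
  proof (cases b)
    case (Cons a b')
    have a: "a \<le> n" "\<And>y. y \<in> set b' \<Longrightarrow> y < a" "sorted_wrt (>) b'" using b Cons by auto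
    show ?thesis
    proof (cases "a = n")
      case True
      then have "b' \<in> ?S n" using a by blast
      then show ?thesis using Cons True by blast
    next
      case False
      then have "set b \<subseteq> {..<n}" using a(1) a(2) Cons by fastforce
      then show ?thesis using b(1) by blast
    qed
  qed simp
  moreover have "(#) n ` ?S n \<union> ?S n \<subseteq> ?S (Suc n)"
    by (auto simp: less_Suc_eq subset_iff)
  ultimately have "(#) n ` ?S n \<union> ?S n = ?S (Suc n)" by blast
  moreover have "set (subseqs (rev [0..<Suc n])) = (#) n ` set (subseqs (rev [0..<n])) \<union> set (subseqs (rev [0..<n]))"
    by (simp add: Let_def)
  ultimately show ?case unfolding Suc.IH by simp
qed auto

lemma distinct_subseqs_rev_upt: "distinct (subseqs (rev [0..<n]))"
  using distinct_set_subseqs[of "rev [0..<n]"] by (simp add: distinct_map)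

lemma cells_eq_hooks:
  assumes "length b = length a"
  shows "cells a b = hooks (length a) (\<lambda>i. Suc (a ! i)) (\<lambda>i. Suc (b ! i))"
proof -
  have "(r, c) \<in> cells a b \<longleftrightarrow> (r, c) \<in> hooks (length a) (\<lambda>i. Suc (a ! i)) (\<lambda>i. Suc (b ! i))" for r c
  proof -
    consider "r < c" | "r = c" | "c < r" by linarith
    then show ?thesis
    proof cases
      case 1 then show ?thesis by (auto simp: cells_def hooks_above less_Suc_eq_le)
    next
      case 2 then show ?thesis by (auto simp: cells_def hooks_below less_Suc_eq_le)
    next
      case 3 then show ?thesis by (auto simp: cells_def hooks_below less_Suc_eq_le)
    qed
  qed
  then show ?thesis unfolding set_eq_iff split_paired_All by blast
qed

lemma hook_shape_frobenius:
  assumes "sorted_wrt (>) a" "sorted_wrt (>) b" "length b = length a"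
  shows "hook_shape (length a) (\<lambda>i. Suc (a ! i)) (\<lambda>i. Suc (b ! i))"
  using assms by unfold_locales (auto simp: strict_desc_def sorted_wrt_iff_nth_less)

text \<open>Entries strictly decrease down the first column, so an entry in row \<open>r\<close> is
  at most \<open>n + 1 - r\<close>. This confines the leg sequences to a finite set.\<close>

lemma legs_bounded:
  assumes "F \<in> fillings n 1 (hooks l A B)" "0 < l" "0 < B 0"
  shows "B 0 \<le> n"
proof -
  have bound: "x + r \<le> Suc n" if "1 \<le> r" "r \<le> B 0" "x \<in> F (r, 1)" for r x
    using that
  proof (induction r arbitrary: x rule: nat_induct_at_least)
    case base
    then show ?case using fillingsD(3)[OF assms(1), of "(1, 1)"] by auto
  next
    case (Suc r)
    have m: "(r, 1) \<in> hooks l A B" "(Suc r, 1) \<in> hooks l A B" using Suc assms by (auto simp: hooks_below)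
    then obtain y where y: "y \<in> F (r, 1)" using fillingsD(2)[OF assms(1)] by blast
    then have "x < y" using fillingsD(7)[OF assms(1) m(1)] m Suc.prems by simp
    then show ?case using Suc.IH[OF _ y] Suc.prems by simp
  qed
  obtain x where "x \<in> F (B 0, 1)" "1 \<le> x"
  proof -
    have m: "(B 0, 1) \<in> hooks l A B" using assms by (auto simp: hooks_below)
    then obtain x where "x \<in> F (B 0, 1)" using fillingsD(2)[OF assms(1)] by blast
    then show thesis using that fillingsD(3)[OF assms(1), of "(B 0, 1)"] by auto
  qed
  then show ?thesis using bound[of "B 0" x] assms(3) by simp
qed

section \<open>Hooks with marked leg length, and the sum over all shapes\<close>

context arrow_params
begin

lemma hook_gf_vanish: "length xs < b \<Longrightarrow> hook_gf xs a b = 0"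
  by (induction xs arbitrary: a b) auto

text \<open>Marking the leg by powers of \<open>\<beta>\<close> turns the recursion in the leg into
  a multiplication. The last term comes from \<open>a' = 0\<close>, where the whole hook is filled
  with the smallest value.\<close>

lemma hook_gf_sum_Cons:
  assumes "length xs < n"
  shows "(\<Sum>b<n. hook_gf (x # xs) (Suc a) (Suc b) * \<beta> ^ b) =
    (\<Sum>a'\<le>a. (u * x) ^ (a - a') * ((1 + w * x / v + x / v * \<beta>) * (\<Sum>b<n. hook_gf xs (Suc a') (Suc b) * \<beta> ^ b))) + (u * x) ^ a * (x / v)"
proof -
  define P where "P a = (\<Sum>b<n. hook_gf xs a (Suc b) * \<beta> ^ b)" for a
  have P0: "P 0 = 0" by (simp add: P_def hook_gf_0)
  have sh: "(\<Sum>b<n. hook_gf xs a b * \<beta> ^ b) = (if a = 0 then 1 else 0) + \<beta> * P a" for a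
  proof -
    obtain m where m: "n = Suc m" using assms by (cases n) auto
    have "(\<Sum>b<n. hook_gf xs a b * \<beta> ^ b) = hook_gf xs a 0 + (\<Sum>b<m. hook_gf xs a (Suc b) * \<beta> ^ Suc b)"
      unfolding m by (simp only: sum.lessThan_Suc_shift power_0 mult_1_right)
    \<comment> \<open>The sum in \<open>P a\<close> has one more term, which vanishes because there
      are fewer than \<open>n\<close> variables for a leg of length \<open>n\<close>.\<close>
    also have "(\<Sum>b<m. hook_gf xs a (Suc b) * \<beta> ^ Suc b) = \<beta> * P a"
      using hook_gf_vanish[of xs n a] assms by (simp add: P_def m sum_distrib_left mult_ac)
    finally show ?thesis by (simp add: hook_gf_0)
  qed
  have "(\<Sum>b<n. hook_gf (x # xs) (Suc a) (Suc b) * \<beta> ^ b) =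
    (\<Sum>b<n. \<Sum>a'\<le>Suc a. (u * x) ^ (Suc a - max 1 a') * ((1 + w * x / v) * (hook_gf xs a' (Suc b) * \<beta> ^ b) + x / v * (hook_gf xs a' b * \<beta> ^ b)))"
    by (intro sum.cong refl) (simp add: sum_distrib_right distrib_right mult.assoc del: sum.atMost_Suc)
  also have "\<dots> = (\<Sum>a'\<le>Suc a. (u * x) ^ (Suc a - max 1 a') * ((1 + w * x / v) * P a' + x / v * ((if a' = 0 then 1 else 0) + \<beta> * P a')))"
    unfolding sh[symmetric] unfolding P_def
    by (subst sum.swap) (simp only: sum.distrib sum_distrib_left[symmetric])
  also have "\<dots> = (u * x) ^ a * (x / v) + (\<Sum>a'\<le>a. (u * x) ^ (a - a') * ((1 + w * x / v) * P (Suc a') + x / v * (\<beta> * P (Suc a'))))"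
    unfolding sum.atMost_Suc_shift by (simp add: P0)
  finally show ?thesis unfolding P_def[symmetric] by (simp add: algebra_simps)
qed

text \<open>At this argument the leg factor of a variable \<open>x\<close> is
  \<open>1 - x / z\<close>. It is zero for \<open>x = z\<close>, so nothing after \<open>z\<close>
  in the list matters; for the variables before \<open>z\<close>, the factor \<open>z - x\<close>
  makes the sum over arms telescope.\<close>

lemma hook_gf_sum:
  assumes "z \<in> set xs" "z \<noteq> 0" "v \<noteq> 0" "length xs \<le> n"
  shows "(\<Sum>b<n. hook_gf xs (Suc a) (Suc b) * (- (w + v / z)) ^ b) = (u * z) ^ a * z / v"
  using assms(1,4)
proof (induction xs arbitrary: a)
  case (Cons x xs)
  let ?\<beta> = "- (w + v / z)"
  have d: "1 + w * x / v + x / v * ?\<beta> = 1 - x / z" using assms(2,3) by (simp add: field_simps)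
  have len: "length xs < n" using Cons.prems by simp
  show ?case
  proof (cases "x = z")
    case True
    then show ?thesis unfolding hook_gf_sum_Cons[OF len] d using assms(2) by simp
  next
    case False
    then have IH: "(\<Sum>b<n. hook_gf xs (Suc a') (Suc b) * ?\<beta> ^ b) = (u * z) ^ a' * z / v" for a'
      using Cons by simp
    have "(\<Sum>a'\<le>a. (u * x) ^ (a - a') * ((1 - x / z) * ((u * z) ^ a' * z / v))) + (u * x) ^ a * (x / v)
      = (\<Sum>a'\<le>a. u ^ a / v * ((z - x) * (x ^ (a - a') * z ^ a'))) + u ^ a / v * x ^ Suc a"
    proof (intro arg_cong2[where f = "(+)"] sum.cong refl)
      fix a' assume "a' \<in> {..a}"
      then have ua: "u ^ a = u ^ (a - a') * u ^ a'" by (simp add: power_add[symmetric])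
      have e: "(1 - x / z) * z = z - x" using assms(2) by (simp add: left_diff_distrib)
      have "(u * x) ^ (a - a') * ((1 - x / z) * ((u * z) ^ a' * z / v)) = u ^ a / v * (((1 - x / z) * z) * (x ^ (a - a') * z ^ a'))"
        unfolding ua by (simp add: power_mult_distrib mult_ac)
      then show "(u * x) ^ (a - a') * ((1 - x / z) * ((u * z) ^ a' * z / v)) = u ^ a / v * ((z - x) * (x ^ (a - a') * z ^ a'))"
        unfolding e .
    qed (simp add: power_mult_distrib)
    also have "\<dots> = u ^ a / v * ((z - x) * (\<Sum>a'<Suc a. x ^ (Suc a - Suc a') * z ^ a') + x ^ Suc a)"
      by (simp add: sum_distrib_left distrib_left lessThan_Suc_atMost)
    also have "(z - x) * (\<Sum>a'<Suc a. x ^ (Suc a - Suc a') * z ^ a') = z ^ Suc a - x ^ Suc a"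
      by (rule power_diff_sumr2[symmetric])
    finally show ?thesis unfolding hook_gf_sum_Cons[OF len] d IH by (simp add: power_mult_distrib)
  qed
qed simp

text \<open>Over a leg \<open>i\<close> the arms \<open>i\<close> and \<open>i + 1\<close> are
  allowed; they contribute \<open>w\<close> and \<open>1\<close> to the weight of the shape.\<close>

definition nb_entry :: "'a list \<Rightarrow> nat \<Rightarrow> nat \<Rightarrow> 'a" where
  "nb_entry xs i j = w * hook_gf xs (Suc i) (Suc j) + hook_gf xs (Suc (Suc i)) (Suc j)"

lemma weight_SBCSPP_eq:
  assumes v: "v \<noteq> 0" and F: "F \<in> fillings n 1 (cells a b)" and fin: "finite (cells a b)"
  shows "weight_SBCSPP n u v w X a b F = weight_shape w a b * v ^ ((n + 1) choose 2) * (\<Prod>x\<in>cells a b. cell_weight X x (F x))"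
proof -
  let ?C = "cells a b"
  note D = fillingsD[OF F]
  have c1: "1 \<le> card (F x)" if "x \<in> ?C" for x
    using D(2)[OF that] D(4)[of x] by (simp add: Suc_le_eq card_gt_0_iff)
  have up: "{(r, c) \<in> ?C. r < c} = {x \<in> ?C. fst x < snd x}" and lo: "{(r, c) \<in> ?C. c \<le> r} = {x \<in> ?C. \<not> fst x < snd x}"
    by auto
  have 1: "(\<Prod>x\<in>?C. if fst x < snd x then u else (1 / v) ^ card (F x)) =
    u ^ card {x \<in> ?C. fst x < snd x} * (1 / v) ^ (\<Sum>x\<in>{x \<in> ?C. \<not> fst x < snd x}. card (F x))"
    using fin by (simp add: prod.If_cases power_sum Int_def)
  have 2: "(\<Prod>x\<in>?C. w ^ (card (F x) - 1)) = w powi (int (\<Sum>x\<in>?C. card (F x)) - int (card ?C))"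
  proof -
    have "int (\<Sum>x\<in>?C. card (F x) - 1) = (\<Sum>x\<in>?C. int (card (F x)) - 1)"
      using c1 by (simp add: of_nat_diff)
    then have eq: "int (\<Sum>x\<in>?C. card (F x)) - int (card ?C) = int (\<Sum>x\<in>?C. card (F x) - 1)"
      by (simp add: sum_subtractf)
    show ?thesis unfolding eq by (simp only: power_int_of_nat power_sum)
  qed
  have 3: "(\<Prod>x\<in>?C. \<Prod>i\<in>F x. X i) = (\<Prod>i=1..n. X i ^ card {x \<in> ?C. i \<in> F x})"
  proof -
    have "(\<Prod>x\<in>?C. \<Prod>i\<in>F x. X i) = (\<Prod>x\<in>?C. \<Prod>i\<in>{1..n}. if i \<in> F x then X i else 1)"
    proof (rule prod.cong[OF refl])
      fix x
      have "{1..n} \<inter> F x = F x" using D(3)[of x] by auto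
      then show "(\<Prod>i\<in>F x. X i) = (\<Prod>i\<in>{1..n}. if i \<in> F x then X i else 1)"
        by (simp add: prod.If_cases)
    qed
    also have "\<dots> = (\<Prod>i\<in>{1..n}. \<Prod>x\<in>?C. if i \<in> F x then X i else 1)" by (rule prod.swap)
    also have "\<dots> = (\<Prod>i=1..n. X i ^ card {x \<in> ?C. i \<in> F x})"
      using fin by (simp add: prod.If_cases Int_def)
    finally show ?thesis .
  qed
  have 4: "v powi (int ((n + 1) choose 2) - int s) = v ^ ((n + 1) choose 2) * (1 / v) ^ s" for s
    using v by (simp add: power_int_diff field_simps)
  show ?thesis
    unfolding weight_SBCSPP_def up lo cell_weight_def prod.distrib by (simp only: 1 2 3 4 mult_ac)
qed

lemma weight_shape_eq:
  assumes "w \<noteq> 0" "length b = length a" "\<And>i. i < length a \<Longrightarrow> a ! i = b ! i + e i \<and> e i \<in> {0, 1}"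
  shows "weight_shape w a b = (\<Prod>i\<in>{0..<length a}. if e i = 0 then w else 1)"
proof -
  have "int (length a) + (\<Sum>i<length a. int (b ! i) - int (a ! i)) = (\<Sum>i<length a. 1 + (int (b ! i) - int (a ! i)))"
    by (simp add: sum.distrib)
  also have "\<dots> = (\<Sum>i\<in>{0..<length a}. if e i = 0 then 1 else 0)"
    unfolding lessThan_atLeast0 by (intro sum.cong refl) (use assms(3) in force)
  finally have "int (length a) + (\<Sum>i<length a. int (b ! i) - int (a ! i)) = (\<Sum>i\<in>{0..<length a}. if e i = 0 then 1 else 0)" .
  moreover have "w powi (\<Sum>i\<in>J. if e i = 0 then 1 else 0) = (\<Prod>i\<in>J. if e i = 0 then w else 1)" if "finite J" for J
    using that assms(1) by (induction J rule: finite_induct) (auto simp: power_int_add)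
  ultimately show ?thesis by (simp add: weight_shape_def)
qed

text \<open>Each row on the right is a sum of two, one per admissible arm. As \<open>b\<close>
  descends strictly and an arm exceeds its leg by at most one, a choice of arms that fails to
  descend has two equal neighbours, and its determinant has equal rows.\<close>

lemma sum_near_balanced:
  assumes w: "w \<noteq> 0" and b: "sorted_wrt (>) b"
  shows "(\<Sum>a\<in>{a. near_balanced a b}. weight_shape w a b * det (mat (length b) (length b) (\<lambda>(i, j). hook_gf xs (Suc (a ! i)) (Suc (b ! j)))))
    = det (mat (length b) (length b) (\<lambda>(i, j). nb_entry xs (b ! i) (b ! j)))"
proof -
  let ?l = "length b"
  let ?P = "PiE {0..<?l} (\<lambda>_. {0, 1 :: nat})"
  let ?W = "\<lambda>g. (\<Prod>i\<in>{0..<?l}. if g i = 0 then w else 1) * det (mat ?l ?l (\<lambda>(i, j). hook_gf xs (Suc (b ! i + g i)) (Suc (b ! j))))"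
  have bs: "b ! j < b ! i" if "i < j" "j < ?l" for i j using b that by (simp add: sorted_wrt_iff_nth_less)
  have "det (mat ?l ?l (\<lambda>(i, j). nb_entry xs (b ! i) (b ! j))) =
    det (mat ?l ?l (\<lambda>(i, j). \<Sum>e\<in>{0, 1 :: nat}. (if e = 0 then w else 1) * hook_gf xs (Suc (b ! i + e)) (Suc (b ! j))))"
    by (simp add: nb_entry_def)
  also have "\<dots> = sum ?W ?P" by (rule det_rows_sum) simp
  also have "\<dots> = sum ?W {g \<in> ?P. \<forall>i. Suc i < ?l \<longrightarrow> b ! Suc i + g (Suc i) < b ! i + g i}"
  proof (rule sum.mono_neutral_right)
    show "finite ?P" by (rule finite_PiE) auto
    show "\<forall>g\<in>?P - {g \<in> ?P. \<forall>i. Suc i < ?l \<longrightarrow> b ! Suc i + g (Suc i) < b ! i + g i}. ?W g = 0"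
    proof
      fix g assume "g \<in> ?P - {g \<in> ?P. \<forall>i. Suc i < ?l \<longrightarrow> b ! Suc i + g (Suc i) < b ! i + g i}"
      then obtain i where g: "g \<in> ?P" and i: "Suc i < ?l" "\<not> b ! Suc i + g (Suc i) < b ! i + g i" by auto
      have "g i \<in> {0, 1}" "g (Suc i) \<in> {0, 1}" using g i by auto
      then have "b ! Suc i + g (Suc i) = b ! i + g i" using i bs[of i "Suc i"] by auto
      then show "?W g = 0"
        using det_equal_rows[of i ?l "Suc i" "\<lambda>i j. hook_gf xs (Suc (b ! i + g i)) (Suc (b ! j))"] i by simp
    qed
  qed auto
  also have "\<dots> = (\<Sum>a\<in>{a. near_balanced a b}. weight_shape w a b * det (mat ?l ?l (\<lambda>(i, j). hook_gf xs (Suc (a ! i)) (Suc (b ! j)))))"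
  proof (rule sum.reindex_bij_witness[where j = "\<lambda>g. map (\<lambda>i. b ! i + g i) [0..<?l]"
        and i = "\<lambda>a. restrict (\<lambda>i. a ! i - b ! i) {0..<?l}"])
    fix g assume g: "g \<in> {g \<in> ?P. \<forall>i. Suc i < ?l \<longrightarrow> b ! Suc i + g (Suc i) < b ! i + g i}"
    let ?a = "map (\<lambda>i. b ! i + g i) [0..<?l]"
    have g01: "g i = 0 \<or> g i = 1" if "i < ?l" for i using g that by (auto simp: PiE_def Pi_def)
    have ext: "g i = undefined" if "\<not> i < ?l" for i using g that by (auto simp: PiE_def extensional_def)
    show "restrict (\<lambda>i. ?a ! i - b ! i) {0..<?l} = g" using ext by (auto simp: fun_eq_iff)
    have "sorted_wrt (>) ?a"
      using g by (subst sorted_wrt_iff_nth_Suc_transp) (auto simp: transp_def)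
    then have "near_balanced ?a b"
      using g01 b by (fastforce simp: near_balanced_def frobenius_def)
    then show "?a \<in> {a. near_balanced a b}" by simp
    have "weight_shape w ?a b = (\<Prod>i\<in>{0..<length ?a}. if g i = 0 then w else 1)"
      by (rule weight_shape_eq[OF w]) (use g01 in auto)
    moreover have "mat ?l ?l (\<lambda>(i, j). hook_gf xs (Suc (?a ! i)) (Suc (b ! j))) = mat ?l ?l (\<lambda>(i, j). hook_gf xs (Suc (b ! i + g i)) (Suc (b ! j)))"
      by (rule eq_matI) (auto simp del: hook_gf.simps)
    ultimately show "weight_shape w ?a b * det (mat ?l ?l (\<lambda>(i, j). hook_gf xs (Suc (?a ! i)) (Suc (b ! j)))) = ?W g"
      by simp
  next
    fix a assume "a \<in> {a. near_balanced a b}"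
    then have a: "length a = ?l" "sorted_wrt (>) a" "\<And>i. i < ?l \<Longrightarrow> a ! i = b ! i \<or> a ! i = b ! i + 1"
      by (auto simp: near_balanced_def frobenius_def)
    let ?g = "restrict (\<lambda>i. a ! i - b ! i) {0..<?l}"
    have ge: "b ! i + ?g i = a ! i" if "i < ?l" for i using a(3)[OF that] that by auto
    show "map (\<lambda>i. b ! i + ?g i) [0..<?l] = a"
      by (rule nth_equalityI) (use a(1) ge in auto)
    have "?g \<in> ?P" using a(3) by fastforce
    moreover have "b ! Suc i + ?g (Suc i) < b ! i + ?g i" if "Suc i < ?l" for i
      using ge[of i] ge[of "Suc i"] that a(1,2) by (simp add: sorted_wrt_iff_nth_less)
    ultimately show "?g \<in> {g \<in> ?P. \<forall>i. Suc i < ?l \<longrightarrow> b ! Suc i + g (Suc i) < b ! i + g i}" by blast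
  qed
  finally show ?thesis by simp
qed

lemma SBCSPP_iff:
  "(a, b, F) \<in> SBCSPP n \<longleftrightarrow> b \<in> set (subseqs (rev [0..<n])) \<and> near_balanced a b \<and> F \<in> fillings n 1 (cells a b)"
proof
  assume "(a, b, F) \<in> SBCSPP n"
  then have nb: "near_balanced a b" and F: "F \<in> fillings n 1 (cells a b)"
    by (auto simp: SBCSPP_def SBCSPP_filling_iff)
  have b: "sorted_wrt (>) b" "length b = length a" using nb by (auto simp: near_balanced_def frobenius_def)
  have "set b \<subseteq> {..<n}"
  proof
    fix y assume "y \<in> set b"
    then obtain i where i: "i < length b" "b ! i = y" by (auto simp: in_set_conv_nth)
    have "Suc (b ! 0) \<le> n"
      using legs_bounded[of F n "length a"] F i b(2) unfolding cells_eq_hooks[OF b(2)] by fastforce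
    moreover have "b ! i \<le> b ! 0"
      using b(1) i(1) by (cases i) (auto simp: sorted_wrt_iff_nth_less less_imp_le)
    ultimately show "y \<in> {..<n}" using i by simp
  qed
  then show "b \<in> set (subseqs (rev [0..<n])) \<and> near_balanced a b \<and> F \<in> fillings n 1 (cells a b)"
    using nb F b by (simp add: set_subseqs_rev_upt)
qed (auto simp: SBCSPP_def SBCSPP_filling_iff)

lemma finite_near_balanced: "finite {a. near_balanced a b}"
proof (rule finite_subset)
  show "{a. near_balanced a b} \<subseteq> {a. set a \<subseteq> {..Suc (Max (set b))} \<and> length a = length b}"
  proof clarify
    fix a assume nb: "near_balanced a b"
    then have len: "length a = length b" by (simp add: near_balanced_def frobenius_def)
    have "y \<le> Suc (Max (set b))" if "y \<in> set a" for y
    proof -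
      obtain i where i: "i < length a" "a ! i = y" using \<open>y \<in> set a\<close> by (auto simp: in_set_conv_nth)
      then have "b ! i \<le> Max (set b)" using len by simp
      moreover have "y \<le> Suc (b ! i)" using nb i by (auto simp: near_balanced_def)
      ultimately show ?thesis by simp
    qed
    then show "set a \<subseteq> {..Suc (Max (set b))} \<and> length a = length b" using len by auto
  qed
qed (simp add: finite_lists_length_eq)

text \<open>Summing over the arms first makes each leg sequence \<open>b\<close> contribute one
  principal minor, the empty shape that of size \<open>0\<close>. The indices are reversed because
  \<open>b\<close> descends.\<close>

theorem sum_SBCSPP:
  assumes v: "v \<noteq> 0" and w: "w \<noteq> 0"
  shows "(\<Sum>(a, b, F)\<in>SBCSPP n. weight_SBCSPP n u v w X a b F) = v ^ ((n + 1) choose 2) *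
    det (mat n n (\<lambda>(i, j). (if i = j then 1 else 0) + nb_entry (map X [1..<Suc n]) (n - 1 - i) (n - 1 - j)))"
proof -
  let ?xs = "map X [1..<Suc n]" and ?V = "v ^ ((n + 1) choose 2)"
  let ?T = "set (subseqs (rev [0..<n]))"
  let ?S = "SIGMA b:?T. SIGMA a:{a. near_balanced a b}. fillings n 1 (cells a b)"
  have fin: "finite (cells a b)" if "near_balanced a b" for a b
    using that by (simp add: cells_eq_hooks finite_hooks near_balanced_def frobenius_def)
  have "(\<Sum>(a, b, F)\<in>SBCSPP n. weight_SBCSPP n u v w X a b F) = (\<Sum>(b, a, F)\<in>?S. weight_SBCSPP n u v w X a b F)"
    by (rule sum.reindex_bij_witness[where i = "\<lambda>(b, a, F). (a, b, F)" and j = "\<lambda>(a, b, F). (b, a, F)"])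
       (auto simp: SBCSPP_iff)
  also have "\<dots> = (\<Sum>b\<in>?T. \<Sum>a\<in>{a. near_balanced a b}. \<Sum>F\<in>fillings n 1 (cells a b). weight_SBCSPP n u v w X a b F)"
  proof (subst sum_Sigma')
    show "finite (SIGMA a:{a. near_balanced a b}. fillings n 1 (cells a b))" for b
      by (intro finite_SigmaI finite_near_balanced finite_fillings fin) simp
    show "(\<Sum>b\<in>?T. \<Sum>y\<in>(SIGMA a:{a. near_balanced a b}. fillings n 1 (cells a b)). case (b, y) of (b, a, F) \<Rightarrow> weight_SBCSPP n u v w X a b F)
      = (\<Sum>b\<in>?T. \<Sum>a\<in>{a. near_balanced a b}. \<Sum>F\<in>fillings n 1 (cells a b). weight_SBCSPP n u v w X a b F)"
      by (intro sum.cong refl, subst sum_Sigma') (auto simp: finite_near_balanced finite_fillings fin)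
  qed simp
  also have "\<dots> = (\<Sum>b\<in>?T. ?V * (\<Sum>a\<in>{a. near_balanced a b}. weight_shape w a b *
      det (mat (length b) (length b) (\<lambda>(i, j). hook_gf ?xs (Suc (a ! i)) (Suc (b ! j))))))"
    unfolding sum_distrib_left
  proof (intro sum.cong refl)
    fix b a assume "b \<in> ?T" "a \<in> {a. near_balanced a b}"
    then have nb: "near_balanced a b" by simp
    then have ab: "sorted_wrt (>) a" "sorted_wrt (>) b" "length b = length a" by (auto simp: near_balanced_def frobenius_def)
    have "(\<Sum>F\<in>fillings n 1 (cells a b). weight_SBCSPP n u v w X a b F) = ?V * (weight_shape w a b * filling_gf X n 1 (cells a b))"
      unfolding filling_gf_def sum_distrib_left by (intro sum.cong refl) (simp add: weight_SBCSPP_eq[OF v _ fin[OF nb]] mult_ac)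
    also have "filling_gf X n 1 (cells a b) = det (mat (length b) (length b) (\<lambda>(i, j). hook_gf ?xs (Suc (a ! i)) (Suc (b ! j))))"
      unfolding cells_eq_hooks[OF ab(3)] ab(3) by (rule filling_gf_eq_det) (use hook_shape_frobenius[OF ab] in auto)
    finally show "(\<Sum>F\<in>fillings n 1 (cells a b). weight_SBCSPP n u v w X a b F) = ?V * (weight_shape w a b *
      det (mat (length b) (length b) (\<lambda>(i, j). hook_gf ?xs (Suc (a ! i)) (Suc (b ! j)))))" .
  qed
  also have "\<dots> = (\<Sum>b\<in>?T. ?V * det (mat (length b) (length b) (\<lambda>(i, j). nb_entry ?xs (b ! i) (b ! j))))"
    by (intro sum.cong refl arg_cong2[where f = "(*)"] sum_near_balanced[OF w]) (simp add: set_subseqs_rev_upt)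
  also have "\<dots> = ?V * (\<Sum>b\<in>?T. det (mat (length b) (length b) (\<lambda>(i, j). nb_entry ?xs (b ! i) (b ! j))))"
    by (simp only: sum_distrib_left)
  also have "(\<Sum>b\<in>?T. det (mat (length b) (length b) (\<lambda>(i, j). nb_entry ?xs (b ! i) (b ! j)))) =
    (\<Sum>b\<leftarrow>subseqs (rev [0..<n]). det (mat (length b) (length b) (\<lambda>(i, j). nb_entry ?xs (b ! i) (b ! j))))"
    by (rule sum_list_distinct_conv_sum_set[OF distinct_subseqs_rev_upt, symmetric])
  also have "\<dots> = det (mat n n (\<lambda>(i, j). (if i = j then 1 else 0) + nb_entry ?xs (rev [0..<n] ! i) (rev [0..<n] ! j)))"
    using det_identity_plus[of "[]" "rev [0..<n]" "nb_entry ?xs"] by simp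
  also have "mat n n (\<lambda>(i, j). (if i = j then 1 else 0) + nb_entry ?xs (rev [0..<n] ! i) (rev [0..<n] ! j)) =
    mat n n (\<lambda>(i, j). (if i = j then 1 else 0) + nb_entry ?xs (n - 1 - i) (n - 1 - j))"
    by (rule eq_matI) (auto simp: rev_nth)
  finally show ?thesis .
qed

end

section \<open>Comparison of the two determinants\<close>

lemma AMT_eq_AMT_bottom: "AMT n = AMT_bottom n (\<lambda>j. if j \<in> {1..n} then int j else 0)"
proof -
  have "(\<forall>j\<in>{1..n}. m n j = int j) \<longleftrightarrow> m n = (\<lambda>j. if j \<in> {1..n} then int j else 0)"
    if "arrowed_monotone_triangle n m d" for m d
  proof -
    have "m n j = 0" if "j \<notin> {1..n}" for j
      using \<open>arrowed_monotone_triangle n m d\<close> that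
      by (auto simp: arrowed_monotone_triangle_def monotone_triangle_def in_tri_def)
    then show ?thesis by (auto simp: fun_eq_iff)
  qed
  then show ?thesis by (auto simp: AMT_def AMT_bottom_def)
qed

section \<open>From the symmetrized sum to complete homogeneous polynomials\<close>

context arrow_params
begin

definition conj_var :: "'a \<Rightarrow> 'a" where "conj_var x = - (w + v / x)"

definition complete_sum :: "nat \<Rightarrow> 'a \<Rightarrow> 'a" where "complete_sum n x = (\<Sum>s<Suc n. conj_var x ^ (n - s) * (u * x) ^ s)"

lemma diag_factor_eq: "diag_factor x = u * x - conj_var x"
  by (simp add: diag_factor_def conj_var_def)

lemma diag_factor_complete: "diag_factor x * complete_sum n x = (u * x) ^ Suc n - conj_var x ^ Suc n"
  using power_diff_sumr2[of "u * x" "Suc n" "conj_var x"] by (simp add: diag_factor_eq complete_sum_def)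

text \<open>What remains of \<open>sym_sum\<close> for the row \<open>(1, ..., n)\<close> without
  its symmetric factors. It resembles an alternant, except that the function attached to
  \<open>a\<close> depends on the whole set \<open>A\<close>.\<close>

fun reduced_sum :: "nat \<Rightarrow> 'a set \<Rightarrow> 'a" where
  "reduced_sum 0 A = 1"
| "reduced_sum (Suc n) A = (\<Sum>a\<in>A. (\<Prod>b\<in>A - {a}. u * a - conj_var b) * (\<Prod>b\<in>A - {a}. 1 / (a - b)) * reduced_sum n (A - {a}))"

text \<open>A variable in position \<open>i\<close> has exponent \<open>i\<close> from the row and
  gains one factor from each of the \<open>n - i\<close> later positions through
  \<open>pair_factor\<close>. The total is \<open>n\<close> in every position, so the monomial is
  symmetric.\<close>

lemma sym_sum_eq_reduced:
  assumes "finite A" "card A = n" "0 \<notin> A"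
  shows "sym_sum n A int = (\<Prod>a\<in>A. diag_factor a) * (\<Prod>a\<in>A. a) ^ n * reduced_sum n A"
  using assms
proof (induction n arbitrary: A)
  case (Suc n)
  have "head_factor a A * a powi int (Suc n) * sym_sum n (A - {a}) int =
    (\<Prod>a\<in>A. diag_factor a) * (\<Prod>a\<in>A. a) ^ Suc n * ((\<Prod>b\<in>A - {a}. u * a - conj_var b) * (\<Prod>b\<in>A - {a}. 1 / (a - b)) * reduced_sum n (A - {a}))"
    if a: "a \<in> A" for a
  proof -
    have IH: "sym_sum n (A - {a}) int = (\<Prod>a\<in>A - {a}. diag_factor a) * (\<Prod>a\<in>A - {a}. a) ^ n * reduced_sum n (A - {a})"
      by (rule Suc.IH) (use Suc.prems a in auto)
    have "pair_factor b a = b * (u * a - conj_var b) * (1 / (a - b))" if "b \<in> A - {a}" for b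
    proof -
      have "b \<noteq> 0" using that Suc.prems by auto
      then have "v + w * b + u * b * a = b * (u * a - conj_var b)" by (simp add: conj_var_def field_simps)
      then show ?thesis by (simp add: pair_factor_def)
    qed
    then have "(\<Prod>b\<in>A - {a}. pair_factor b a) = (\<Prod>b\<in>A - {a}. b) * (\<Prod>b\<in>A - {a}. u * a - conj_var b) * (\<Prod>b\<in>A - {a}. 1 / (a - b))"
      by (simp only: prod.distrib[symmetric] cong: prod.cong)
    moreover have "(\<Prod>a\<in>A. diag_factor a) = diag_factor a * (\<Prod>a\<in>A - {a}. diag_factor a)" "(\<Prod>a\<in>A. a) = a * (\<Prod>a\<in>A - {a}. a)"
      using Suc.prems a by (simp_all add: prod.remove)
    ultimately show ?thesis by (simp add: head_factor_def IH power_mult_distrib mult_ac del: of_nat_Suc)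
  qed
  then show ?case by (simp only: sym_sum.simps reduced_sum.simps sum_distrib_left cong: sum.cong)
qed simp

text \<open>Let \<open>P(t)\<close> be the product of \<open>t - conj_var b\<close> over
  \<open>b \<in> A\<close>. As \<open>P\<close> vanishes at \<open>conj_var a\<close>, the product
  over \<open>A - {a}\<close> is the difference quotient of \<open>P\<close> at \<open>u * a\<close>
  and \<open>conj_var a\<close>. Expanded in powers, it combines the \<open>complete_sum m a\<close>
  with coefficients depending on \<open>A\<close> only, and \<open>alternant_top\<close>
  applies.\<close>

lemma reduced_sum_eq_alternant:
  assumes "finite A" "card A = n" "\<And>a. a \<in> A \<Longrightarrow> diag_factor a \<noteq> 0"
  shows "reduced_sum n A = alternant complete_sum n A"
  using assms
proof (induction n arbitrary: A)
  case (Suc n)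
  obtain co where co: "\<And>t. (\<Prod>b\<in>A. t - conj_var b) = t ^ Suc n + (\<Sum>m<Suc n. co m * t ^ m)"
    using monic_prod_expand[OF Suc.prems(1), of conj_var] Suc.prems(2) by auto
  have top: "(\<Prod>b\<in>A - {a}. u * a - conj_var b) = complete_sum n a + (\<Sum>m<n. co (Suc m) * complete_sum m a)" if a: "a \<in> A" for a
  proof -
    have "(\<Prod>b\<in>A. u * a - conj_var b) = diag_factor a * (\<Prod>b\<in>A - {a}. u * a - conj_var b)"
      using Suc.prems(1) a by (simp add: prod.remove diag_factor_eq)
    moreover have "(\<Prod>b\<in>A. conj_var a - conj_var b) = 0" using Suc.prems(1) a by auto
    ultimately have "diag_factor a * (\<Prod>b\<in>A - {a}. u * a - conj_var b) = (\<Prod>b\<in>A. u * a - conj_var b) - (\<Prod>b\<in>A. conj_var a - conj_var b)" by simp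
    also have "\<dots> = ((u * a) ^ Suc n - conj_var a ^ Suc n) + (\<Sum>m<Suc n. co m * ((u * a) ^ m - conj_var a ^ m))"
      unfolding co by (simp only: right_diff_distrib sum_subtractf) simp
    also have "(\<Sum>m<Suc n. co m * ((u * a) ^ m - conj_var a ^ m)) = (\<Sum>m<n. co (Suc m) * (diag_factor a * complete_sum m a))"
      unfolding sum.lessThan_Suc_shift diag_factor_complete by simp
    also have "(u * a) ^ Suc n - conj_var a ^ Suc n = diag_factor a * complete_sum n a" by (rule diag_factor_complete[symmetric])
    also have "diag_factor a * complete_sum n a + (\<Sum>m<n. co (Suc m) * (diag_factor a * complete_sum m a)) = diag_factor a * (complete_sum n a + (\<Sum>m<n. co (Suc m) * complete_sum m a))"
      by (simp add: distrib_left sum_distrib_left mult_ac)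
    finally show ?thesis using Suc.prems(3)[OF a] by simp
  qed
  have "reduced_sum (Suc n) A = (\<Sum>a\<in>A. (\<Prod>b\<in>A - {a}. u * a - conj_var b) * (\<Prod>b\<in>A - {a}. 1 / (a - b)) * alternant complete_sum n (A - {a}))"
    unfolding reduced_sum.simps by (intro sum.cong refl arg_cong2[where f = "(*)"] Suc.IH) (use Suc.prems in auto)
  also have "\<dots> = alternant complete_sum (Suc n) A" by (rule alternant_top[OF Suc.prems(1,2) top])
  finally show ?case .
qed simp

text \<open>The differences satisfy \<open>conj_var x - conj_var y = v * (x - y) / (x * y)\<close>,
  and each variable occurs in \<open>n - 1\<close> of them.\<close>

lemma vandermonde_conj_var:
  assumes "\<And>i. i < n \<Longrightarrow> x i \<noteq> 0"
  shows "vandermonde n (\<lambda>i. conj_var (x i)) * (\<Prod>i<n. x i) ^ n = v ^ (n choose 2) * (\<Prod>i<n. x i) * vandermonde n x"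
  using assms
proof (induction n)
  case 0 then show ?case by (simp add: vandermonde_def numeral_2_eq_2)
next
  case (Suc n)
  let ?P = "\<Prod>i<n. x i"
  have nz: "x n \<noteq> 0" "?P \<noteq> 0" "\<And>i. i < n \<Longrightarrow> x i \<noteq> 0" using Suc.prems by auto
  have "(\<Prod>i<n. conj_var (x n) - conj_var (x i)) * (?P * x n ^ n) = (\<Prod>i<n. (conj_var (x n) - conj_var (x i)) * (x i * x n))"
    by (simp add: prod.distrib)
  also have "\<dots> = (\<Prod>i<n. v * (x n - x i))"
    by (intro prod.cong refl) (use nz in \<open>auto simp: conj_var_def field_simps\<close>)
  also have "\<dots> = v ^ n * (\<Prod>i<n. x n - x i)" by (simp add: prod.distrib)
  finally have 1: "(\<Prod>i<n. conj_var (x n) - conj_var (x i)) * (?P * x n ^ n) = v ^ n * (\<Prod>i<n. x n - x i)" .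
  have "vandermonde (Suc n) (\<lambda>i. conj_var (x i)) * (\<Prod>i<Suc n. x i) ^ Suc n =
     (vandermonde n (\<lambda>i. conj_var (x i)) * ?P ^ n) * ((\<Prod>i<n. conj_var (x n) - conj_var (x i)) * (?P * x n ^ n)) * x n"
    by (simp add: vandermonde_Suc power_mult_distrib mult_ac)
  also have "\<dots> = (v ^ (n choose 2) * ?P * vandermonde n x) * (v ^ n * (\<Prod>i<n. x n - x i)) * x n"
    unfolding 1 using Suc.IH nz(3) by simp
  also have "\<dots> = v ^ (Suc n choose 2) * (\<Prod>i<Suc n. x i) * vandermonde (Suc n) x"
    by (simp add: vandermonde_Suc numeral_2_eq_2 power_add mult_ac)
  finally show ?case .
qed

lemma det_nb_entry:
  assumes v: "v \<noteq> 0" and inj: "inj_on x {..<n}" and x0: "\<And>i. i < n \<Longrightarrow> x i \<noteq> 0"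
    and xs: "length xs = n" "set xs = x ` {..<n}"
  shows "v ^ (Suc n choose 2) * det (mat n n (\<lambda>(i, j). (if i = j then 1 else 0) + nb_entry xs (n - 1 - i) (n - 1 - j)))
    = (\<Prod>i<n. diag_factor (x i)) * (\<Prod>i<n. x i) ^ n * alternant complete_sum n (x ` {..<n})"
proof -
  let ?I = "mat n n (\<lambda>(i, j). (if i = j then 1 else 0) + nb_entry xs (n - 1 - i) (n - 1 - j))"
  let ?W = "mat n n (\<lambda>(i, k). conj_var (x k) ^ (n - 1 - i))"
  let ?P = "\<Prod>i<n. x i"
  \<comment> \<open>The product with the matrix of powers of \<open>conj_var\<close>. The second
    summand in the bracket is a multiple of the preceding row and disappears by a row
    operation.\<close>
  define F where "F i k = (x k * diag_factor (x k) / v) * (complete_sum i (x k) + (if 0 < i then w * complete_sum (i - 1) (x k) else 0))" for i k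
  have entry: "(\<Sum>j<n. ((if i = j then 1 else 0) + nb_entry xs i j) * conj_var (x k) ^ j) = F i k" if "i < n" "k < n" for i k
  proof -
    have z: "x k \<in> set xs" "x k \<noteq> 0" using that xs x0 by auto
    have s: "(\<Sum>b<n. hook_gf xs (Suc a) (Suc b) * conj_var (x k) ^ b) = (u * x k) ^ a * x k / v" for a
      unfolding conj_var_def by (rule hook_gf_sum[OF z v]) (simp add: xs)
    have "(\<Sum>j<n. ((if i = j then 1 else 0) + nb_entry xs i j) * conj_var (x k) ^ j) =
      (\<Sum>j<n. if i = j then conj_var (x k) ^ j else 0) + (w * (\<Sum>j<n. hook_gf xs (Suc i) (Suc j) * conj_var (x k) ^ j) + (\<Sum>j<n. hook_gf xs (Suc (Suc i)) (Suc j) * conj_var (x k) ^ j))"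
      unfolding sum_distrib_left sum.distrib[symmetric] by (intro sum.cong refl) (auto simp: nb_entry_def algebra_simps)
    also have "\<dots> = conj_var (x k) ^ i + (x k / v) * ((w + u * x k) * (u * x k) ^ i)"
      unfolding s using that by (simp add: algebra_simps)
    also have "\<dots> = (x k / v) * ((w + u * x k) * (u * x k) ^ i - (w + conj_var (x k)) * conj_var (x k) ^ i)"
    proof -
      \<comment> \<open>This rewrites the contribution of the identity matrix so that a difference
        of equal expressions in \<open>u * x k\<close> and \<open>conj_var (x k)\<close>
        appears.\<close>
      have "(x k / v) * (w + conj_var (x k)) = - 1" using z v by (simp add: conj_var_def)
      then have "(x k / v) * ((w + conj_var (x k)) * conj_var (x k) ^ i) = - (conj_var (x k) ^ i)" by (simp only: mult.assoc[symmetric]) simp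
      then show ?thesis by (simp only: right_diff_distrib) simp
    qed
    also have "(w + u * x k) * (u * x k) ^ i - (w + conj_var (x k)) * conj_var (x k) ^ i =
      diag_factor (x k) * complete_sum i (x k) + w * (if 0 < i then diag_factor (x k) * complete_sum (i - 1) (x k) else 0)"
      unfolding diag_factor_complete by (cases i) (auto simp: algebra_simps)
    finally show ?thesis by (simp add: F_def algebra_simps)
  qed
  \<comment> \<open>The minors use descending indices, the Vandermonde matrix ascending ones.
    Reversing the rows of \<open>?W\<close> and of the product costs the same sign \<open>s\<close>,
    which cancels.\<close>
  obtain s where s: "s * s = 1" "\<And>f :: nat \<Rightarrow> nat \<Rightarrow> 'a. det (mat n n (\<lambda>(i, j). f (n - 1 - i) j)) = s * det (mat n n (\<lambda>(i, j). f i j))"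
    using det_reverse_rows[where 'a = 'a] by metis
  have s0: "s \<noteq> 0" using s(1) by auto
  have "?I * ?W = mat n n (\<lambda>(i, k). F (n - 1 - i) k)"
  proof (rule eq_matI)
    fix i k assume "i < dim_row (mat n n (\<lambda>(i, k). F (n - 1 - i) k))" "k < dim_col (mat n n (\<lambda>(i, k). F (n - 1 - i) k))"
    then have ik: "i < n" "k < n" by auto
    have "(?I * ?W) $$ (i, k) = (\<Sum>j<n. ((if i = j then 1 else 0) + nb_entry xs (n - 1 - i) (n - 1 - j)) * conj_var (x k) ^ (n - 1 - j))"
      using ik by (simp add: scalar_prod_def lessThan_atLeast0)
    also have "\<dots> = (\<Sum>j<n. ((if n - 1 - i = j then 1 else 0) + nb_entry xs (n - 1 - i) j) * conj_var (x k) ^ j)"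
      by (rule sum.reindex_bij_witness[where i = "\<lambda>j. n - 1 - j" and j = "\<lambda>j. n - 1 - j"]) (use ik in auto)
    also have "\<dots> = F (n - 1 - i) k" by (rule entry) (use ik in auto)
    finally show "(?I * ?W) $$ (i, k) = mat n n (\<lambda>(i, k). F (n - 1 - i) k) $$ (i, k)" using ik by simp
  qed auto
  moreover have "det (?I * ?W) = det ?I * det ?W" by (rule det_mult[of _ n]) auto
  ultimately have "det ?I * det ?W = det (mat n n (\<lambda>(i, k). F (n - 1 - i) k))" by (simp only:)
  then have "s * (det ?I * det (mat n n (\<lambda>(i, k). conj_var (x k) ^ i))) = s * det (mat n n (\<lambda>(i, k). F i k))"
    unfolding s(2)[of "\<lambda>i k. conj_var (x k) ^ i"] s(2)[of F] by (simp only: mult_ac)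
  then have 1: "det ?I * det (mat n n (\<lambda>(i, k). conj_var (x k) ^ i)) = det (mat n n (\<lambda>(i, k). F i k))"
    using s0 by simp
  have dW: "det (mat n n (\<lambda>(i, k). conj_var (x k) ^ i)) = vandermonde n (\<lambda>i. conj_var (x i))"
  proof (rule det_vandermonde)
    show "inj_on (\<lambda>i. conj_var (x i)) {..<n}"
    proof (rule inj_onI)
      fix i j assume ij: "i \<in> {..<n}" "j \<in> {..<n}" "conj_var (x i) = conj_var (x j)"
      then have "x i = x j" using x0 v by (simp add: conj_var_def field_simps)
      then show "i = j" using inj ij by (auto simp: inj_on_def)
    qed
  qed
  have "det (mat n n (\<lambda>(i, k). F i k)) = (\<Prod>k<n. x k * diag_factor (x k) / v) * det (mat n n (\<lambda>(i, k). complete_sum i (x k)))"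
    unfolding F_def det_col_scale by (simp only: det_add_prev_row[of n "\<lambda>i k. complete_sum i (x k)" w])
  also have "(\<Prod>k<n. x k * diag_factor (x k) / v) = ?P * (\<Prod>k<n. diag_factor (x k)) / v ^ n"
    by (simp add: prod.distrib prod_dividef)
  finally have 2: "det ?I * vandermonde n (\<lambda>i. conj_var (x i)) = ?P * (\<Prod>k<n. diag_factor (x k)) / v ^ n * (vandermonde n x * alternant complete_sum n (x ` {..<n}))"
    using 1 by (simp only: dW det_eq_alternant[OF inj])
  have P0: "?P \<noteq> 0" using x0 by auto
  have V0: "vandermonde n x \<noteq> 0" by (rule vandermonde_nonzero[OF inj])
  have "(det ?I * v ^ (n choose 2)) * (?P * vandermonde n x) = det ?I * (vandermonde n (\<lambda>i. conj_var (x i)) * ?P ^ n)"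
    using vandermonde_conj_var[of n x, OF x0] by (simp only: mult_ac)
  also have "\<dots> = (\<Prod>k<n. diag_factor (x k)) / v ^ n * ?P ^ n * alternant complete_sum n (x ` {..<n}) * (?P * vandermonde n x)"
    unfolding mult.assoc[symmetric] 2 by (simp add: mult_ac)
  finally have E: "(det ?I * v ^ (n choose 2)) * (?P * vandermonde n x) =
    (\<Prod>k<n. diag_factor (x k)) / v ^ n * ?P ^ n * alternant complete_sum n (x ` {..<n}) * (?P * vandermonde n x)" .
  have PV: "?P * vandermonde n x \<noteq> 0" using P0 V0 by simp
  from E have "det ?I * v ^ (n choose 2) = (\<Prod>k<n. diag_factor (x k)) / v ^ n * ?P ^ n * alternant complete_sum n (x ` {..<n})"
    by (simp only: mult_right_cancel[OF PV])
  then have "(det ?I * v ^ (n choose 2)) * v ^ n = (\<Prod>k<n. diag_factor (x k)) * ?P ^ n * alternant complete_sum n (x ` {..<n})"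
    using v by (simp add: field_simps)
  moreover have "v ^ (Suc n choose 2) = v ^ (n choose 2) * v ^ n"
    by (simp add: numeral_2_eq_2 power_add mult_ac)
  ultimately show ?thesis by (simp only: mult_ac)
qed

theorem sum_AMT_eq_sum_SBCSPP:
  assumes v: "v \<noteq> 0" and w: "w \<noteq> 0" and inj: "inj_on X {1..n}" and X0: "\<And>i. i \<in> {1..n} \<Longrightarrow> X i \<noteq> 0"
  shows "(\<Sum>(m, d)\<in>AMT n. weight_AMT n u v w X m d) = (\<Sum>(a, b, F)\<in>SBCSPP n. weight_SBCSPP n u v w X a b F)"
proof -
  let ?A = "X ` {1..n}" and ?x = "\<lambda>i. X (Suc i)"
  have im: "?x ` {..<n} = ?A"
    using image_image[of X Suc "{..<n}"] unfolding image_Suc_lessThan by (rule sym)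
  have injx: "inj_on ?x {..<n}"
    by (rule inj_onI) (use inj_onD[OF inj, of "Suc i" "Suc j" for i j] in force)
  have A: "finite ?A" "card ?A = n" "0 \<notin> ?A" using inj X0 by (auto simp: card_image)
  have pr: "(\<Prod>i<n. f (?x i)) = (\<Prod>a\<in>?A. f a)" for f :: "'a \<Rightarrow> 'a"
    unfolding im[symmetric] by (simp add: prod.reindex[OF injx])
  have "(\<Sum>(m, d)\<in>AMT n. weight_AMT n u v w X m d) = sym_sum n ?A (\<lambda>j. if j \<in> {1..n} then int j else 0)"
    unfolding AMT_eq_AMT_bottom by (rule sum_AMT_bottom[OF inj X0]) (auto simp: row_ok_def)
  also have "\<dots> = sym_sum n ?A int" by (rule sym_sum_cong) simp
  also have "\<dots> = (\<Prod>a\<in>?A. diag_factor a) * (\<Prod>a\<in>?A. a) ^ n * reduced_sum n ?A" by (rule sym_sum_eq_reduced[OF A])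
  also have "\<dots> = (\<Prod>a\<in>?A. diag_factor a) * (\<Prod>a\<in>?A. a) ^ n * alternant complete_sum n ?A"
  \<comment> \<open>The passage to the alternant divides by each \<open>diag_factor a\<close>; if
    one of them is \<open>0\<close>, both sides vanish through the product in front.\<close>
  proof (cases "\<exists>a\<in>?A. diag_factor a = 0")
    case True
    then have "(\<Prod>a\<in>?A. diag_factor a) = 0" using A(1) by (simp add: prod_zero_iff)
    then show ?thesis by simp
  next
    case False
    then show ?thesis using reduced_sum_eq_alternant[OF A(1,2)] by auto
  qed
  also have "\<dots> = (\<Prod>i<n. diag_factor (?x i)) * (\<Prod>i<n. ?x i) ^ n * alternant complete_sum n (?x ` {..<n})"
    unfolding im pr[of diag_factor] pr[of "\<lambda>a. a"] ..
  also have "\<dots> = v ^ (Suc n choose 2) * det (mat n n (\<lambda>(i, j). (if i = j then 1 else 0) + nb_entry (map X [1..<Suc n]) (n - 1 - i) (n - 1 - j)))"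
  proof (rule det_nb_entry[symmetric, OF v injx])
    show "?x i \<noteq> 0" if "i < n" for i using X0 that by simp
    show "set (map X [1..<Suc n]) = ?x ` {..<n}" unfolding im by (simp add: atLeastLessThanSuc_atLeastAtMost del: upt_Suc)
  qed simp
  also have "\<dots> = (\<Sum>(a, b, F)\<in>SBCSPP n. weight_SBCSPP n u v w X a b F)"
    by (simp only: sum_SBCSPP[OF v w] Suc_eq_plus1)
  finally show ?thesis .
qed

end

section \<open>Arbitrary variables\<close>

definition amt_exp :: "nat \<Rightarrow> (nat \<Rightarrow> nat \<Rightarrow> int) \<Rightarrow> (nat \<Rightarrow> nat \<Rightarrow> arrow) \<Rightarrow> nat \<Rightarrow> int" where
  "amt_exp n m d i = row_sum m i - row_sum m (i - 1) + int (row_count n d NE i) - int (row_count n d NW i)"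

text \<open>Needed for the transfer to polynomials. Each entry but the first exceeds its
  northwest-neighbour by at least \<open>1\<close> if it carries \<open>NW\<close>; the first entry
  is at least \<open>1\<close>, as the left edge weakly increases upwards from
  \<open>1\<close>.\<close>

lemma amt_exp_nonneg:
  assumes "(m, d) \<in> AMT n" "i \<in> {1..n}"
  shows "0 \<le> amt_exp n m d i"
proof -
  have amt: "arrowed_monotone_triangle n m d" and bot: "\<And>j. j \<in> {1..n} \<Longrightarrow> m n j = int j"
    using assms(1) by (auto simp: AMT_def)
  have inter: "interlaced i (m i) (m (Suc i)) (d (Suc i))" if "i \<in> {1..<n}" for i
    using amt that unfolding arrowed_monotone_triangle_iff by blast
  have pos: "1 \<le> m i 1" if "i \<le> n" "1 \<le> i" for i
    using that
  proof (induction rule: inc_induct)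
    case base then show ?case using bot[of 1] by simp
  next
    case (step i)
    have "m (Suc i) 1 + ne_part (d (Suc i) 1) \<le> m i 1"
      using inter[of i] step unfolding interlaced_def by auto
    moreover have "0 \<le> ne_part (d (Suc i) 1)" by (simp add: ne_part_def)
    ultimately show ?case using step by simp
  qed
  obtain i' where i: "i = Suc i'" using assms(2) by (cases i) auto
  let ?k = "m (Suc i')" and ?f = "m i'" and ?e = "d (Suc i')"
  let ?N = "\<lambda>j. if ?e j = NW then 1 else 0 :: int"
  have cnt: "int (card {j\<in>S. Q j}) = (\<Sum>j\<in>S. if Q j then 1 else 0)" if "finite S" for S :: "nat set" and Q
    using that by (simp add: sum.If_cases Int_def)
  have "int (row_count n d NW i) = (\<Sum>j=1..Suc i'. ?N j)"
    unfolding row_count_def i by (rule cnt) simp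
  also have "\<dots> = ?N 1 + (\<Sum>j=1..i'. ?N (Suc j))"
    by (subst sum.atLeast_Suc_atMost) (simp_all add: sum.atLeast_Suc_atMost_Suc_shift o_def del: sum.cl_ivl_Suc)
  finally have 1: "int (row_count n d NW i) = ?N 1 + (\<Sum>j=1..i'. ?N (Suc j))" .
  have "row_sum m i = ?k 1 + (\<Sum>j=1..i'. ?k (Suc j))"
    unfolding row_sum_def i by (subst sum.atLeast_Suc_atMost) (simp_all add: sum.atLeast_Suc_atMost_Suc_shift o_def del: sum.cl_ivl_Suc)
  then have "row_sum m i - row_sum m (i - 1) - int (row_count n d NW i) = (?k 1 - ?N 1) + (\<Sum>j=1..i'. ?k (Suc j) - ?f j - ?N (Suc j))"
    unfolding 1 by (simp add: row_sum_def i sum_subtractf)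
  moreover have "0 \<le> ?k 1 - ?N 1" using pos[of "Suc i'"] assms(2) i by auto
  moreover have "0 \<le> (\<Sum>j=1..i'. ?k (Suc j) - ?f j - ?N (Suc j))"
  proof (rule sum_nonneg)
    fix j assume j: "j \<in> {1..i'}"
    then have "?f j \<le> ?k (Suc j) - nw_part (?e (Suc j))"
      using inter[of i'] assms(2) i unfolding interlaced_def by auto
    then show "0 \<le> ?k (Suc j) - ?f j - ?N (Suc j)" by (auto simp: nw_part_def split: if_splits)
  qed
  ultimately show ?thesis by (simp add: amt_exp_def)
qed

text \<open>With natural exponents in place of \<open>powi\<close>, the sum makes sense over every
  commutative ring and commutes with ring homomorphisms.\<close>

definition poly_AMT :: "nat \<Rightarrow> 'a::comm_ring_1 \<Rightarrow> 'a \<Rightarrow> 'a \<Rightarrow> (nat \<Rightarrow> 'a) \<Rightarrow> 'a" where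
  "poly_AMT n u v w X = (\<Sum>(m, d)\<in>AMT n.
     u ^ total_count n d NE * v ^ total_count n d NW * w ^ total_count n d NWNE * (\<Prod>i=1..n. X i ^ nat (amt_exp n m d i)))"

text \<open>Here \<open>vi\<close> stands for the inverse of \<open>v\<close>, so that the expression makes sense over a polynomial ring.\<close>

definition poly_SBCSPP :: "nat \<Rightarrow> 'a::comm_ring_1 \<Rightarrow> 'a \<Rightarrow> 'a \<Rightarrow> 'a \<Rightarrow> (nat \<Rightarrow> 'a) \<Rightarrow> 'a" where
  "poly_SBCSPP n u v vi w X = (\<Sum>(a, b, F)\<in>SBCSPP n.
     w ^ nat (int (length a) + (\<Sum>i<length a. int (b ! i) - int (a ! i))) *
     u ^ card {(r, c) \<in> cells a b. r < c} *
     (v ^ ((n + 1) choose 2) * vi ^ (\<Sum>x \<in> {(r, c) \<in> cells a b. c \<le> r}. card (F x))) *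
     w ^ nat (int (\<Sum>x \<in> cells a b. card (F x)) - int (card (cells a b))) *
     (\<Prod>i=1..n. X i ^ card {x \<in> cells a b. i \<in> F x}))"

lemma powi_nat: "0 \<le> e \<Longrightarrow> x powi e = x ^ nat e"
  by (simp add: power_int_def)

lemma sum_weight_AMT:
  fixes X :: "nat \<Rightarrow> 'a::field"
  shows "(\<Sum>(m, d)\<in>AMT n. weight_AMT n u v w X m d) = poly_AMT n u v w X"
  unfolding poly_AMT_def
proof (intro sum.cong refl, clarify)
  fix m d assume md: "(m, d) \<in> AMT n"
  have "(\<Prod>i=1..n. X i powi (row_sum m i - row_sum m (i-1) + int (row_count n d NE i) - int (row_count n d NW i))) =
    (\<Prod>i=1..n. X i ^ nat (amt_exp n m d i))"
    unfolding amt_exp_def[symmetric] by (intro prod.cong refl powi_nat amt_exp_nonneg[OF md])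
  then show "weight_AMT n u v w X m d = u ^ total_count n d NE * v ^ total_count n d NW * w ^ total_count n d NWNE * (\<Prod>i=1..n. X i ^ nat (amt_exp n m d i))"
    by (simp only: weight_AMT_def)
qed

lemma sum_weight_SBCSPP:
  fixes X :: "nat \<Rightarrow> 'a::field"
  assumes v: "v \<noteq> 0"
  shows "(\<Sum>(a, b, F)\<in>SBCSPP n. weight_SBCSPP n u v w X a b F) = poly_SBCSPP n u v (1 / v) w X"
  unfolding poly_SBCSPP_def
proof (intro sum.cong refl, clarify)
  fix a b F assume abF: "(a, b, F) \<in> SBCSPP n"
  then have nb: "near_balanced a b" and F: "F \<in> fillings n 1 (cells a b)" by (auto simp: SBCSPP_def SBCSPP_filling_iff)
  have "0 \<le> (\<Sum>i<length a. 1 + (int (b ! i) - int (a ! i)))"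
    by (rule sum_nonneg) (use nb in \<open>auto simp: near_balanced_def\<close>)
  then have 1: "0 \<le> int (length a) + (\<Sum>i<length a. int (b ! i) - int (a ! i))" by (simp add: sum.distrib)
  have "card (cells a b) = (\<Sum>x\<in>cells a b. 1)" by simp
  also have "\<dots> \<le> (\<Sum>x\<in>cells a b. card (F x))"
    using fillingsD(2,4)[OF F] by (intro sum_mono) (simp add: Suc_le_eq card_gt_0_iff)
  finally have 2: "0 \<le> int (\<Sum>x \<in> cells a b. card (F x)) - int (card (cells a b))"
    by (simp only: diff_ge_0_iff_ge of_nat_le_iff)
  have 3: "v powi (int ((n + 1) choose 2) - int s) = v ^ ((n + 1) choose 2) * (1 / v) ^ s" for s
    using v by (simp add: power_int_diff field_simps)
  show "weight_SBCSPP n u v w X a b F = w ^ nat (int (length a) + (\<Sum>i<length a. int (b ! i) - int (a ! i))) *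
     u ^ card {(r, c) \<in> cells a b. r < c} *
     (v ^ ((n + 1) choose 2) * (1 / v) ^ (\<Sum>x \<in> {(r, c) \<in> cells a b. c \<le> r}. card (F x))) *
     w ^ nat (int (\<Sum>x \<in> cells a b. card (F x)) - int (card (cells a b))) *
     (\<Prod>i=1..n. X i ^ card {x \<in> cells a b. i \<in> F x})"
    unfolding weight_SBCSPP_def weight_shape_def 3 powi_nat[OF 1] powi_nat[OF 2] ..
qed

lemma (in comm_ring_hom) hom_poly_AMT: "hom (poly_AMT n u v w X) = poly_AMT n (hom u) (hom v) (hom w) (\<lambda>i. hom (X i))"
  unfolding poly_AMT_def hom_sum by (intro sum.cong refl) (auto simp: hom_distribs)

lemma (in comm_ring_hom) hom_poly_SBCSPP:
  "hom (poly_SBCSPP n u v vi w X) = poly_SBCSPP n (hom u) (hom v) (hom vi) (hom w) (\<lambda>i. hom (X i))"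
  unfolding poly_SBCSPP_def hom_sum by (intro sum.cong refl) (auto simp: hom_distribs)

theorem theorem2:
  fixes n :: nat and u v w :: "'a::field" and X :: "nat \<Rightarrow> 'a"
  assumes "n \<ge> 1" and "u \<noteq> 0" and "v \<noteq> 0" and "w \<noteq> 0"
    and "\<forall>i \<in> {1..n}. X i \<noteq> 0"
  shows "(\<Sum>(m, d) \<in> AMT n. weight_AMT n u v w X m d)
       = (\<Sum>(a, b, F) \<in> SBCSPP n. weight_SBCSPP n u v w X a b F)"
proof -
  interpret ev: comm_ring_hom "\<lambda>q :: 'a poly. poly q 0" by unfold_locales auto
  interpret fr: comm_ring_hom "to_fract :: 'a poly \<Rightarrow> 'a poly fract" by unfold_locales auto
  \<comment> \<open>The distinct positive exponents make the \<open>Y i\<close> distinct and nonzero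
    whatever the values of \<open>X\<close>, even over a finite field.\<close>
  define Y where "Y i = [:X i:] + monom 1 i" for i
  have Y_coeff: "coeff (Y i) j = (if i = j then 1 else 0)" if "j \<ge> 1" for i j
    using that by (cases j) (auto simp: Y_def)
  have Y_inj: "inj_on (\<lambda>i. to_fract (Y i)) {1..n}"
  proof (rule inj_onI)
    fix i j assume ij: "i \<in> {1..n}" "j \<in> {1..n}" "to_fract (Y i) = to_fract (Y j)"
    then have "coeff (Y i) j = coeff (Y j) j" by simp
    then have "(if i = j then 1 else 0 :: 'a) = 1" using Y_coeff[of j i] Y_coeff[of j j] ij(2) by simp
    then show "i = j" by (simp split: if_splits)
  qed
  have Y_nz: "to_fract (Y i) \<noteq> 0" if "i \<in> {1..n}" for i
  proof
    assume "to_fract (Y i) = 0"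
    then have "coeff (Y i) i = 0" by simp
    then show False using Y_coeff that by simp
  qed
  have Y_ev: "poly (Y i) 0 = X i" if "i \<in> {1..n}" for i
    using that by (simp add: Y_def poly_monom)
  have vnz: "to_fract [:v:] \<noteq> 0" "to_fract [:w:] \<noteq> 0" using assms by auto
  have "[:v:] * [:1 / v:] = 1" using assms by (simp add: one_pCons)
  then have "to_fract [:v:] * to_fract [:1 / v:] = 1" by (metis to_fract_mult to_fract_1)
  then have vi: "1 / to_fract [:v:] = to_fract [:1 / v:]" using vnz(1) by (simp add: field_simps)
  have "poly_AMT n (to_fract [:u:]) (to_fract [:v:]) (to_fract [:w:]) (\<lambda>i. to_fract (Y i))
      = poly_SBCSPP n (to_fract [:u:]) (to_fract [:v:]) (to_fract [:1 / v:]) (to_fract [:w:]) (\<lambda>i. to_fract (Y i))"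
    using arrow_params.sum_AMT_eq_sum_SBCSPP[OF vnz Y_inj Y_nz, of "to_fract [:u:]"]
    unfolding sum_weight_AMT sum_weight_SBCSPP[OF vnz(1)] vi .
  \<comment> \<open>Since \<open>to_fract\<close> is injective, the identity descends to
    polynomials, where the variable can be set to \<open>0\<close>.\<close>
  then have "poly_AMT n [:u:] [:v:] [:w:] Y = poly_SBCSPP n [:u:] [:v:] [:1 / v:] [:w:] Y"
    unfolding fr.hom_poly_AMT[symmetric] fr.hom_poly_SBCSPP[symmetric] to_fract_eq_iff .
  then have "poly (poly_AMT n [:u:] [:v:] [:w:] Y) 0 = poly (poly_SBCSPP n [:u:] [:v:] [:1 / v:] [:w:] Y) 0"
    by (rule arg_cong)
  then have "poly_AMT n u v w (\<lambda>i. poly (Y i) 0) = poly_SBCSPP n u v (1 / v) w (\<lambda>i. poly (Y i) 0)"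
    unfolding ev.hom_poly_AMT ev.hom_poly_SBCSPP by simp
  moreover have "poly_AMT n u v w (\<lambda>i. poly (Y i) 0) = poly_AMT n u v w X"
    unfolding poly_AMT_def using Y_ev by (intro sum.cong refl) (auto intro!: prod.cong)
  moreover have "poly_SBCSPP n u v (1 / v) w (\<lambda>i. poly (Y i) 0) = poly_SBCSPP n u v (1 / v) w X"
    unfolding poly_SBCSPP_def using Y_ev by (intro sum.cong refl) (auto intro!: prod.cong)
  ultimately show ?thesis
    by (simp only: sum_weight_AMT sum_weight_SBCSPP[OF assms(3)])
qed

end
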